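(* Let $N\ge 2$, $0<s<t\le 1$, and let $\bar m_1=\bar m_1(N,t-s)>0$ be such that for every $m\in(0,\bar m_1)$ the ball of measure $m$ is the only minimizer (up to translations and null sets) of $$\min\{\mathcal F_{s,t}(E): E\subset\mathbb R^N\text{ measurable},\ |E|=m\}.$$ Then there exists a volume $\bar m_2=\bar m_2(N,s,t)\ge\bar m_1$ such that, for every $m>\bar m_2$, the ball of measure $m$ is not a local minimizer of this problem.
   Context: $|\cdot|$ is Lebesgue measure in $\mathbb R^N$, $\omega_N$ is the volume of the unit ball, $P$ is the classical perimeter. For $\alpha\in(0,1)$ and measurable $E\subset\mathbb R^N$, $$P_\alpha(E)=\int_E\int_{E^c}\frac{dx\,dy}{|x-y|^{N+\alpha}}.$$ For $0<s<t<1$, $\mathcal F_{s,t}(E)=(1-t)P_t(E)-sP_s(E)$; for $0<s<t=1$, $\mathcal F_{s,1}(E)=N\omega_NP(E)-sP_s(E)$. The existence of $\bar m_1$ as in the claim is established in the paper. "The ball $B_m$ of measure $m$, centered at $0$ with radius $\rho$, is not a local minimizer" means: for every $\eta>0$ there is a bounded set $E$ with $|E|=m$, whose boundary is $\partial E=\{\rho(1+u(x))x: x\in\partial B(0,1)\}$ for some $u\in C^1(\partial B(0,1))$ with $\|u\|_{C^1}\le\eta$, such that $\mathcal F_{s,t}(E)<\mathcal F_{s,t}(B_m)$. *)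

theory Defs
  imports "HOL-Analysis.Analysis"
begin

section \<open>Fractional and classical perimeter\<close>

definition frac_perimeter :: "real \<Rightarrow> 'a::euclidean_space set \<Rightarrow> ennreal" where
  "frac_perimeter \<alpha> E =
     (\<integral>\<^sup>+x\<in>E. (\<integral>\<^sup>+y\<in>- E.
        ennreal (1 / norm (x - y) powr (real DIM('a) + \<alpha>)) \<partial>lebesgue) \<partial>lebesgue)"

definition C1_field :: "('a::euclidean_space \<Rightarrow> 'a) \<Rightarrow> bool" where
  "C1_field \<phi> \<longleftrightarrow>
     (\<exists>D :: 'a \<Rightarrow> 'a \<Rightarrow>\<^sub>L 'a.
        (\<forall>x. (\<phi> has_derivative blinfun_apply (D x)) (at x)) \<and> continuous_on UNIV D)"

definition divergence :: "('a::euclidean_space \<Rightarrow> 'a) \<Rightarrow> 'a \<Rightarrow> real" where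
  "divergence \<phi> x = (\<Sum>b\<in>Basis. frechet_derivative \<phi> (at x) b \<bullet> b)"

text \<open>De Giorgi's perimeter.\<close>

definition perimeter :: "'a::euclidean_space set \<Rightarrow> ereal" where
  "perimeter E =
     (SUP \<phi> \<in> {\<phi>. C1_field \<phi> \<and> compact (closure {x. \<phi> x \<noteq> 0}) \<and> (\<forall>x. norm (\<phi> x) \<le> 1)}.
        ereal (set_lebesgue_integral lebesgue E (divergence \<phi>)))"

text \<open>Since \<open>\<infinity> - \<infinity> = \<infinity>\<close> in \<^typ>\<open>ereal\<close>, a set whose leading perimeter is infinite has energy
  \<open>\<infinity>\<close>. For sets of finite measure, finiteness of the leading perimeter implies finiteness of the
  subtracted one, so no other indeterminate case occurs.\<close>

definition energy :: "real \<Rightarrow> real \<Rightarrow> 'a::euclidean_space set \<Rightarrow> ereal" where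
  "energy s t E =
     (if t = 1
      then ereal (real DIM('a) * measure lebesgue (ball (0::'a) 1)) * perimeter E
      else ereal (1 - t) * enn2ereal (frac_perimeter t E))
     - ereal s * enn2ereal (frac_perimeter s E)"


section \<open>The constrained problem\<close>

definition has_volume :: "'a::euclidean_space set \<Rightarrow> real \<Rightarrow> bool" where
  "has_volume E m \<longleftrightarrow> E \<in> sets lebesgue \<and> emeasure lebesgue E = ennreal m"

definition is_minimizer :: "real \<Rightarrow> real \<Rightarrow> real \<Rightarrow> 'a::euclidean_space set \<Rightarrow> bool" where
  "is_minimizer s t m E \<longleftrightarrow>
     has_volume E m \<and> (\<forall>F :: 'a set. has_volume F m \<longrightarrow> energy s t E \<le> energy s t F)"

definition is_only_minimizer :: "real \<Rightarrow> real \<Rightarrow> real \<Rightarrow> 'a::euclidean_space set \<Rightarrow> bool" where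
  "is_only_minimizer s t m B \<longleftrightarrow>
     is_minimizer s t m B \<and>
     (\<forall>E :: 'a set. is_minimizer s t m E \<longrightarrow> (\<exists>v. sym_diff E ((+) v ` B) \<in> null_sets lebesgue))"

definition vol_radius :: "'a::euclidean_space itself \<Rightarrow> real \<Rightarrow> real" where
  "vol_radius _ m = (m / measure lebesgue (ball (0::'a) 1)) powr (1 / real DIM('a))"

definition vol_ball :: "real \<Rightarrow> 'a::euclidean_space set" where
  "vol_ball m = ball 0 (vol_radius TYPE('a) m)"

lemma has_volume_vol_ball:
  assumes "m > 0"
  shows "has_volume (vol_ball m :: 'a::euclidean_space set) m"
proof -
  define w where "w = measure lebesgue (ball (0::'a) 1)"
  define r where "r = vol_radius TYPE('a) m"
  have w: "w = unit_ball_vol (real DIM('a))"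
    by (simp add: w_def content_ball)
  then have w0: "w > 0" by simp
  have r0: "r \<ge> 0" by (simp add: r_def vol_radius_def)
  have "r ^ DIM('a) = m / w"
    using assms w0 unfolding r_def vol_radius_def w_def[symmetric]
    by (simp add: powr_realpow[symmetric] powr_powr)
  then have "emeasure lebesgue (ball (0::'a) r) = ennreal m"
    using r0 w0 by (simp add: emeasure_ball flip: w)
  then show ?thesis
    by (simp add: has_volume_def vol_ball_def r_def)
qed


section \<open>Perturbations of the ball\<close>

text \<open>The tangential gradient of a function on the unit sphere: only the values of \<open>u\<close> on the
  sphere matter, and the condition \<open>g \<bullet> x = 0\<close> makes \<open>g\<close> unique in dimension at least 2.\<close>

definition has_sphere_gradient ::
    "('a::euclidean_space \<Rightarrow> real) \<Rightarrow> 'a \<Rightarrow> 'a \<Rightarrow> bool" where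
  "has_sphere_gradient u x g \<longleftrightarrow>
     g \<bullet> x = 0 \<and> (u has_derivative (\<lambda>v. g \<bullet> v)) (at x within sphere 0 1)"

definition sphere_gradient :: "('a::euclidean_space \<Rightarrow> real) \<Rightarrow> 'a \<Rightarrow> 'a" where
  "sphere_gradient u x = (THE g. has_sphere_gradient u x g)"

definition C1_sphere :: "('a::euclidean_space \<Rightarrow> real) \<Rightarrow> bool" where
  "C1_sphere u \<longleftrightarrow>
     (\<forall>x\<in>sphere 0 1. \<exists>g. has_sphere_gradient u x g) \<and>
     continuous_on (sphere 0 1) (sphere_gradient u)"

definition C1_norm_sphere :: "('a::euclidean_space \<Rightarrow> real) \<Rightarrow> real" where
  "C1_norm_sphere u =
     (SUP x\<in>sphere 0 1. \<bar>u x\<bar>) + (SUP x\<in>sphere 0 1. norm (sphere_gradient u x))"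

definition near_ball :: "real \<Rightarrow> real \<Rightarrow> 'a::euclidean_space set \<Rightarrow> bool" where
  "near_ball \<eta> \<rho> E \<longleftrightarrow>
     bounded E \<and>
     (\<exists>u :: 'a \<Rightarrow> real. C1_sphere u \<and> C1_norm_sphere u \<le> \<eta> \<and>
          frontier E = (\<lambda>x. (\<rho> * (1 + u x)) *\<^sub>R x) ` sphere 0 1)"

definition vol_ball_not_local_minimizer ::
    "'a::euclidean_space itself \<Rightarrow> real \<Rightarrow> real \<Rightarrow> real \<Rightarrow> bool" where
  "vol_ball_not_local_minimizer _ s t m \<longleftrightarrow>
     (\<forall>\<eta>>0. \<exists>E :: 'a set.
        has_volume E m \<and> near_ball \<eta> (vol_radius TYPE('a) m) E \<and>
        energy s t E < energy s t (vol_ball m :: 'a set))"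

end

theory Submission
  imports Defs
begin

text \<open>
The competitors are ellipsoids. Let \<open>A\<close> stretch one axis by \<open>sqrt (1 + \<epsilon>)\<close> and shrink another by
the same factor, so that \<open>det A = 1\<close>, and let \<open>E\<close> be the image under \<open>A\<close> of the ball of radius \<open>\<rho>\<close>.
It has the volume of the ball and is a normal graph over the sphere whose \<open>C\<^sup>1\<close> norm is of order
\<open>\<epsilon>\<close>. It suffices to show, with constants independent of \<open>\<epsilon>\<close> and \<open>\<rho>\<close>, that passing from the ball
to \<open>E\<close> raises the leading term of the energy by at most \<open>C * \<epsilon>^2 * \<rho>^(N - t)\<close> and raises \<open>P\<^sub>s\<close> by
at least \<open>c * \<epsilon>^2 * \<rho>^(N - s)\<close> with \<open>c > 0\<close>: as \<open>s < t\<close>, the second gain wins once \<open>\<rho>\<close> is large,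
for all \<open>\<epsilon>\<close> at once.

For the fractional perimeters, a linear change of variables and Fubini turn \<open>P\<^sub>\<alpha>\<close> of the image of the
unit ball \<open>B\<close> under \<open>A\<close> into the integral of \<open>\<bar>B - (B + h)\<bar> * norm (A h)^(-N - \<alpha>)\<close> over all shifts
\<open>h\<close> (\<open>frac_perimeter_diag_map\<close>). The measure of \<open>B - (B + h)\<close> depends only on \<open>norm h\<close>, so up to the
factor \<open>P\<^sub>\<alpha>(B)\<close> this is the average of \<open>\<tau>^(-N - \<alpha>)\<close> for a radial measure, where
\<open>\<tau> = norm (A h) / norm h\<close>. The average of \<open>\<tau>^(-N)\<close> is exactly 1, because \<open>A\<close> preserves volume
(\<open>nn_integral_radial_homogeneous\<close>). Comparing another power of \<open>\<tau>\<close> with \<open>\<tau>^(-N)\<close> removes the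
first-order term: every power averages to at most \<open>1 + M * \<epsilon>^2\<close> (\<open>radial_average_upper\<close>), and by
strict convexity \<open>\<tau>^(-N - s)\<close> averages to at least \<open>1 + c * \<epsilon>^2\<close> for some \<open>c > 0\<close>
(\<open>radial_average_lower\<close>), since \<open>\<tau> - 1\<close> really is of order \<open>\<epsilon>\<close> on an open cone.

For \<open>t = 1\<close> the divergence theorem on the ellipsoid, written with a \<open>C\<^sup>1\<close> cutoff in place of the
indicator function, bounds the De Giorgi perimeter by a radial average of \<open>\<tau>\<close> itself, to which the
same upper estimate applies (\<open>perimeter_stretched_ball_upper\<close>); an explicit field bounds the
perimeter of the ball from below (\<open>perimeter_ball_lower\<close>).

Finally, \<open>m1 \<le> m2\<close> is automatic: a ball that is not a local minimizer is not a minimizer.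
\<close>

section \<open>Diagonal maps and changes of variables\<close>

text \<open>
Apart from reflections, all linear changes of variables below are diagonal in the standard basis;
their determinant is the product of the coefficients.
\<close>

definition diag_map :: "('a::euclidean_space \<Rightarrow> real) \<Rightarrow> 'a \<Rightarrow> 'a" where
  "diag_map c x = (\<Sum>j\<in>Basis. (c j * (x \<bullet> j)) *\<^sub>R j)"

lemma diag_map_inner: "b \<in> Basis \<Longrightarrow> diag_map c x \<bullet> b = c b * (x \<bullet> b)"
  by (simp add: diag_map_def)

lemma bounded_linear_diag_map: "bounded_linear (diag_map c)"
proof -
  have "linear (diag_map c)"
    by (rule linearI; subst euclidean_eq_iff) (auto simp: diag_map_inner inner_simps algebra_simps)
  then show ?thesis by (simp add: linear_linear)
qed

lemma diag_map_simps:
  "diag_map c (x + y) = diag_map c x + diag_map c y"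
  "diag_map c (x - y) = diag_map c x - diag_map c y"
  "diag_map c (r *\<^sub>R x) = r *\<^sub>R diag_map c x"
  "diag_map c 0 = 0"
  using bounded_linear.linear[OF bounded_linear_diag_map[of c]]
  by (simp_all add: linear_add linear_diff linear_scale linear_0)

lemma borel_measurable_diag_map [measurable]: "diag_map c \<in> borel \<rightarrow>\<^sub>M borel"
  using linear_continuous_on[OF bounded_linear_diag_map] by (rule borel_measurable_continuous_onI)

lemma diag_map_compose: "diag_map c (diag_map d x) = diag_map (\<lambda>b. c b * d b) x"
  by (auto simp: euclidean_eq_iff[where 'a='a] diag_map_inner)

lemma diag_map_one: "(\<And>b. b \<in> Basis \<Longrightarrow> c b = 1) \<Longrightarrow> diag_map c x = x"
  by (auto simp: euclidean_eq_iff[where 'a='a] diag_map_inner)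

lemma norm_diag_map_pos:
  fixes x :: "'a::euclidean_space"
  assumes "\<And>b. b \<in> Basis \<Longrightarrow> c b > 0" "x \<noteq> 0"
  shows "norm (diag_map c x) > 0"
proof -
  obtain b where b: "b \<in> Basis" "x \<bullet> b \<noteq> 0" using \<open>x \<noteq> 0\<close> by (auto simp: euclidean_eq_iff[where 'a='a])
  then have "diag_map c x \<bullet> b \<noteq> 0" using assms(1)[OF b(1)] by (simp add: diag_map_inner)
  then show ?thesis by auto
qed

lemma diag_map_inner_diag_map: "diag_map c x \<bullet> diag_map c y = diag_map (\<lambda>b. (c b)\<^sup>2) x \<bullet> y"
  by (subst (1 2) euclidean_inner) (auto simp: diag_map_inner power2_eq_square intro!: sum.cong)

lemma diag_map_inner_Basis:
  "b \<in> Basis \<Longrightarrow> diag_map d x \<bullet> diag_map d b = (d b)\<^sup>2 * (x \<bullet> b)"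
  by (simp add: diag_map_inner_diag_map diag_map_inner)

lemma norm_diag_map_sq: "(norm (diag_map c x))\<^sup>2 = (\<Sum>b\<in>Basis. (c b)\<^sup>2 * (x \<bullet> b)\<^sup>2)"
  unfolding power2_norm_eq_inner
  by (subst euclidean_inner, intro sum.cong) (auto simp: diag_map_inner power2_eq_square algebra_simps)

text \<open>
Ensures that functions cut off outside the ellipsoid \<open>norm (diag_map d x) < 1\<close> have bounded support.
\<close>

lemma norm_diag_map_lower:
  fixes d :: "'a::euclidean_space \<Rightarrow> real"
  assumes "\<And>b. b \<in> Basis \<Longrightarrow> d b > 0"
  obtains R where "\<And>x. norm x > R \<Longrightarrow> norm (diag_map d x) \<ge> 1"
proof -
  obtain K where K: "K > 0" "\<And>x. norm (diag_map (\<lambda>b. 1 / d b) x) \<le> norm x * K"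
    using bounded_linear.pos_bounded[OF bounded_linear_diag_map] by blast
  have "norm (diag_map d x) \<ge> 1" if "norm x > K" for x
  proof -
    have "x = diag_map (\<lambda>b. 1 / d b) (diag_map d x)"
      unfolding diag_map_compose using assms by (intro diag_map_one[symmetric]) (auto dest: assms)
    then have "norm x \<le> norm (diag_map d x) * K" using K(2) by metis
    then have "1 * K < norm (diag_map d x) * K" using that by linarith
    then show ?thesis using K(1) by (simp add: mult_less_cancel_right)
  qed
  then show ?thesis by (rule that)
qed

lemma diag_map_image_eq:
  assumes c: "\<And>b. b \<in> Basis \<Longrightarrow> c b > 0"
  shows "diag_map c ` S = {y. diag_map (\<lambda>b. 1 / c b) y \<in> S}"
proof -
  have 1: "diag_map c (diag_map (\<lambda>b. 1 / c b) y) = y" for y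
    unfolding diag_map_compose using c by (intro diag_map_one) (auto dest: c)
  have 2: "diag_map (\<lambda>b. 1 / c b) (diag_map c y) = y" for y
    unfolding diag_map_compose using c by (intro diag_map_one) (auto dest: c)
  show ?thesis by (auto simp: 2) (metis 1 imageI)
qed

lemma nn_integral_affine:
  fixes c :: "'a::euclidean_space \<Rightarrow> real"
  assumes [measurable]: "f \<in> borel_measurable borel" and c: "\<And>b. b \<in> Basis \<Longrightarrow> c b \<noteq> 0"
  shows "(\<integral>\<^sup>+x. f x \<partial>lborel) = ennreal (\<Prod>b\<in>Basis. \<bar>c b\<bar>) * (\<integral>\<^sup>+x. f (t + diag_map c x) \<partial>lborel)"
  unfolding diag_map_def
  by (subst lborel_affine_euclidean[where c=c and t=t])
     (use c in \<open>auto simp: nn_integral_density nn_integral_distr nn_integral_cmult prod_ennreal[symmetric]\<close>)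

lemma nn_integral_reflect_translate:
  fixes f :: "'a::euclidean_space \<Rightarrow> ennreal"
  assumes "f \<in> borel_measurable borel"
  shows "(\<integral>\<^sup>+x. f x \<partial>lborel) = (\<integral>\<^sup>+x. f (t - x) \<partial>lborel)"
proof -
  have "diag_map (\<lambda>_. -1) x = - x" for x :: 'a
    by (auto simp: euclidean_eq_iff[where 'a='a] diag_map_inner)
  then show ?thesis
    using nn_integral_affine[OF assms, of "\<lambda>_. -1" t] by simp
qed

lemma nn_integral_diag_map:
  fixes c :: "'a::euclidean_space \<Rightarrow> real"
  assumes "f \<in> borel_measurable borel" and "\<And>b. b \<in> Basis \<Longrightarrow> c b > 0"
  shows "(\<integral>\<^sup>+x. f x \<partial>lborel) = ennreal (\<Prod>b\<in>Basis. c b) * (\<integral>\<^sup>+x. f (diag_map c x) \<partial>lborel)"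
proof -
  have "(\<Prod>b\<in>Basis. \<bar>c b\<bar>) = (\<Prod>b\<in>Basis. c b)"
    by (rule prod.cong) (use assms(2) in \<open>auto simp: less_imp_le\<close>)
  then show ?thesis
    using nn_integral_affine[OF assms(1), of c 0] assms(2) by (auto simp: less_le)
qed

lemma nn_integral_scaleR:
  fixes f :: "'a::euclidean_space \<Rightarrow> ennreal"
  assumes "f \<in> borel_measurable borel" and "r > 0"
  shows "(\<integral>\<^sup>+x. f x \<partial>lborel) = ennreal (r ^ DIM('a)) * (\<integral>\<^sup>+x. f (r *\<^sub>R x) \<partial>lborel)"
proof -
  have "diag_map (\<lambda>_. r) x = r *\<^sub>R x" for x :: 'a
    by (auto simp: euclidean_eq_iff[where 'a='a] diag_map_inner)
  then show ?thesis
    using nn_integral_diag_map[OF assms(1), of "\<lambda>_. r"] assms(2) by simp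
qed

section \<open>Radial weights against homogeneous functions\<close>

lemma nn_integral_powr_tail:
  assumes "a > 0" "e > 0"
  shows "(\<integral>\<^sup>+r. ennreal (r powr (-1 - e)) * indicator {a..} r \<partial>lborel) = ennreal (a powr (-e) / e)"
proof -
  have "(\<integral>\<^sup>+r. ennreal (r powr (-1 - e)) * indicator {a..} r \<partial>lborel) = ennreal (0 - (- (a powr (-e) / e)))"
  proof (rule nn_integral_FTC_atLeast[where F = "\<lambda>r. - (r powr (-e) / e)"])
    show "((\<lambda>r. - (r powr - e / e)) has_real_derivative x powr (- 1 - e)) (at x)" if "a \<le> x" for x
      using assms that by (auto intro!: derivative_eq_intros simp: algebra_simps powr_diff powr_minus field_simps)
    have "((\<lambda>r::real. r powr (-e)) \<longlongrightarrow> 0) at_top"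
      using \<open>e > 0\<close> by (intro tendsto_neg_powr filterlim_ident) auto
    then show "((\<lambda>r. - (r powr - e / e)) \<longlongrightarrow> 0) at_top"
      using tendsto_minus[OF tendsto_divide[OF _ tendsto_const[of e]], of "\<lambda>r. r powr - e" 0] assms by simp
  qed auto
  then show ?thesis by simp
qed

text \<open>
Write \<open>norm (A x)^(-N)\<close> as \<open>N\<close> times the integral of \<open>r^(-1 - N)\<close> over \<open>r \<ge> norm (A x)\<close>, exchange the
integrals and rescale \<open>x\<close> by \<open>r\<close>, then \<open>r\<close> by \<open>norm x\<close>: the two variables separate into
the volume of the ellipsoid \<open>norm (A x) \<le> 1\<close> and a one-dimensional integral of \<open>k\<close>. With \<open>A\<close> the
identity this is integration in polar coordinates; in general it says that the average of
\<open>(norm x / norm (A x))^N\<close> against any radial weight is \<open>1 / det A\<close>.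
\<close>

lemma nn_integral_radial_homogeneous:
  fixes c :: "'a::euclidean_space \<Rightarrow> real" and k :: "real \<Rightarrow> ennreal"
  assumes c: "\<And>b. b \<in> Basis \<Longrightarrow> c b > 0" and [measurable]: "k \<in> borel_measurable borel"
  shows "(\<integral>\<^sup>+x. k (norm x) * ennreal ((norm x / norm (diag_map c x)) ^ DIM('a)) \<partial>lborel) =
     ennreal (DIM('a) * (unit_ball_vol DIM('a) / (\<Prod>b\<in>Basis. c b))) *
       (\<integral>\<^sup>+r. k r * ennreal (r ^ (DIM('a) - 1)) * indicator {0<..} r \<partial>lborel)"
proof -
  let ?N = "DIM('a)"
  let ?A = "diag_map c"
  have N: "real ?N > 0" by simp
  have A0: "norm (?A x) > 0" if "x \<noteq> 0" for x
    by (rule norm_diag_map_pos[OF c that])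
  define I where "I = (\<integral>\<^sup>+r. k r * ennreal (r ^ (?N - 1)) * indicator {0<..} r \<partial>lborel)"
  \<comment> \<open>the integrand of the double integral; \<open>indicator {0..} (r - norm (?A x))\<close> restricts to \<open>r \<ge> norm (?A x)\<close>\<close>
  let ?G = "\<lambda>x r. k (norm x) * ennreal (norm x ^ ?N) * (ennreal (r powr (-1 - real ?N)) * indicator {0..} (r - norm (?A x)) * indicator {0<..} r)"
  have "(\<integral>\<^sup>+x. k (norm x) * ennreal ((norm x / norm (?A x)) ^ ?N) \<partial>lborel)
      = (\<integral>\<^sup>+x. ennreal ?N * (\<integral>\<^sup>+r. ?G x r \<partial>lborel) \<partial>lborel)"
  proof (rule nn_integral_cong_AE, rule AE_mp[OF AE_lborel_singleton[of 0]], rule AE_I2, rule impI)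
    fix x :: 'a assume "x \<noteq> 0"
    note a = A0[OF this]
    have "(\<integral>\<^sup>+r. ?G x r \<partial>lborel) = k (norm x) * ennreal (norm x ^ ?N) *
       (\<integral>\<^sup>+r. ennreal (r powr (-1 - real ?N)) * indicator {0..} (r - norm (?A x)) * indicator {0<..} r \<partial>lborel)"
      by (rule nn_integral_cmult) measurable
    also have "(\<integral>\<^sup>+r. ennreal (r powr (-1 - real ?N)) * indicator {0..} (r - norm (?A x)) * indicator {0<..} r \<partial>lborel)
       = (\<integral>\<^sup>+r. ennreal (r powr (-1 - real ?N)) * indicator {norm (?A x)..} r \<partial>lborel)"
      using a by (intro nn_integral_cong) (auto simp: indicator_def simp del: zero_less_norm_iff)
    also have "\<dots> = ennreal (norm (?A x) powr (- real ?N) / ?N)"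
      using a by (intro nn_integral_powr_tail) auto
    finally have "ennreal ?N * (\<integral>\<^sup>+r. ?G x r \<partial>lborel)
      = k (norm x) * (ennreal ?N * ennreal (norm x ^ ?N) * ennreal (norm (?A x) powr (- real ?N) / ?N))"
      by (simp add: mult_ac)
    also have "ennreal ?N * ennreal (norm x ^ ?N) * ennreal (norm (?A x) powr (- real ?N) / ?N)
        = ennreal ((norm x / norm (?A x)) ^ ?N)"
      using a N by (simp add: powr_minus powr_realpow power_divide field_simps flip: ennreal_mult)
    finally show "k (norm x) * ennreal ((norm x / norm (?A x)) ^ ?N) = ennreal ?N * (\<integral>\<^sup>+r. ?G x r \<partial>lborel)" ..
  qed
  also have "\<dots> = ennreal ?N * (\<integral>\<^sup>+x. (\<integral>\<^sup>+r. ?G x r \<partial>lborel) \<partial>lborel)"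
    by (rule nn_integral_cmult) measurable
  also have "(\<integral>\<^sup>+x. (\<integral>\<^sup>+r. ?G x r \<partial>lborel) \<partial>lborel) = (\<integral>\<^sup>+r. (\<integral>\<^sup>+x. ?G x r \<partial>lborel) \<partial>lborel)"
    by (rule lborel_pair.Fubini'[symmetric]) measurable
  also have "\<dots> = (\<integral>\<^sup>+r. (\<integral>\<^sup>+x. indicator {x. norm (?A x) \<le> 1} x * (ennreal (norm x ^ ?N) *
       (k (r * norm x) * ennreal (r ^ (?N - 1)) * indicator {0<..} r)) \<partial>lborel) \<partial>lborel)"
  proof (rule nn_integral_cong)
    fix r :: real
    show "(\<integral>\<^sup>+x. ?G x r \<partial>lborel) = (\<integral>\<^sup>+x. indicator {x. norm (?A x) \<le> 1} x * (ennreal (norm x ^ ?N) *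
       (k (r * norm x) * ennreal (r ^ (?N - 1)) * indicator {0<..} r)) \<partial>lborel)"
    proof (cases "r > 0")
      case True
      have "(\<integral>\<^sup>+x. ?G x r \<partial>lborel) = ennreal (r ^ ?N) * (\<integral>\<^sup>+x. ?G (r *\<^sub>R x) r \<partial>lborel)"
        using True by (intro nn_integral_scaleR) measurable
      also have "\<dots> = (\<integral>\<^sup>+x. ennreal (r ^ ?N) * ?G (r *\<^sub>R x) r \<partial>lborel)"
        by (rule nn_integral_cmult[symmetric]) measurable
      also have "\<dots> = (\<integral>\<^sup>+x. indicator {x. norm (?A x) \<le> 1} x * (ennreal (norm x ^ ?N) *
       (k (r * norm x) * ennreal (r ^ (?N - 1)) * indicator {0<..} r)) \<partial>lborel)"
      proof (rule nn_integral_cong)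
        fix x :: 'a
        have r1: "r ^ (?N - 1) = r ^ ?N * (r ^ ?N * r powr (-1 - real ?N))"
        proof -
          have "r powr (-1 - real ?N) = r powr (real (?N - 1)) / (r powr ?N * r powr ?N)"
            using True by (subst powr_add[symmetric], subst powr_diff[symmetric]) (simp add: of_nat_diff Suc_leI algebra_simps)
          then show ?thesis using True by (simp only: powr_realpow) simp
        qed
        have "norm (?A (r *\<^sub>R x)) \<le> r \<longleftrightarrow> norm (?A x) \<le> 1"
          using True by (simp add: diag_map_simps)
        then show "ennreal (r ^ ?N) * ?G (r *\<^sub>R x) r = indicator {x. norm (?A x) \<le> 1} x * (ennreal (norm x ^ ?N) *
           (k (r * norm x) * ennreal (r ^ (?N - 1)) * indicator {0<..} r))"
          using True unfolding r1
          by (auto simp: indicator_def power_mult_distrib ennreal_mult mult_ac)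
      qed
      finally show ?thesis .
    qed simp
  qed
  also have "\<dots> = (\<integral>\<^sup>+x. (\<integral>\<^sup>+r. indicator {x. norm (?A x) \<le> 1} x * (ennreal (norm x ^ ?N) *
       (k (r * norm x) * ennreal (r ^ (?N - 1)) * indicator {0<..} r)) \<partial>lborel) \<partial>lborel)"
    by (rule lborel_pair.Fubini') measurable
  also have "\<dots> = (\<integral>\<^sup>+x. indicator {x. norm (?A x) \<le> 1} x * I \<partial>lborel)"
  proof (rule nn_integral_cong_AE, rule AE_mp[OF AE_lborel_singleton[of 0]], rule AE_I2, rule impI)
    fix x :: 'a assume "x \<noteq> 0"
    then have x: "norm x > 0" by simp
    have "I = ennreal (norm x) * (\<integral>\<^sup>+r. k (norm x * r) * ennreal ((norm x * r) ^ (?N - 1)) * indicator {0<..} (norm x * r) \<partial>lborel)"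
      unfolding I_def using x by (subst nn_integral_real_affine[where c="norm x" and t=0]) auto
    also have "\<dots> = (\<integral>\<^sup>+r. ennreal (norm x) * (k (norm x * r) * ennreal ((norm x * r) ^ (?N - 1)) * indicator {0<..} (norm x * r)) \<partial>lborel)"
      by (rule nn_integral_cmult[symmetric]) measurable
    also have "\<dots> = (\<integral>\<^sup>+r. ennreal (norm x ^ ?N) *
       (k (r * norm x) * ennreal (r ^ (?N - 1)) * indicator {0<..} r) \<partial>lborel)"
    proof (rule nn_integral_cong)
      fix r :: real
      have "norm x * (norm x * r) ^ (?N - 1) = norm x ^ ?N * r ^ (?N - 1)"
        by (simp add: power_mult_distrib flip: power_Suc mult.assoc)
      then show "ennreal (norm x) * (k (norm x * r) * ennreal ((norm x * r) ^ (?N - 1)) * indicator {0<..} (norm x * r)) =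
        ennreal (norm x ^ ?N) * (k (r * norm x) * ennreal (r ^ (?N - 1)) * indicator {0<..} r)"
        using x by (auto simp: indicator_def zero_less_mult_iff mult_ac simp flip: ennreal_mult)
          (metis ennreal_mult' mult.assoc mult.commute norm_ge_zero zero_le_power)
    qed
    finally have "I = (\<integral>\<^sup>+r. ennreal (norm x ^ ?N) * (k (r * norm x) * ennreal (r ^ (?N - 1)) * indicator {0<..} r) \<partial>lborel)" .
    then show "(\<integral>\<^sup>+r. indicator {x. norm (?A x) \<le> 1} x * (ennreal (norm x ^ ?N) *
       (k (r * norm x) * ennreal (r ^ (?N - 1)) * indicator {0<..} r)) \<partial>lborel) = indicator {x. norm (?A x) \<le> 1} x * I"
      by (auto simp: indicator_def)
  qed
  also have "\<dots> = (\<integral>\<^sup>+x. indicator {x. norm (?A x) \<le> 1} x \<partial>lborel) * I"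
    by (rule nn_integral_multc) measurable
  also have "(\<integral>\<^sup>+x. indicator {x. norm (?A x) \<le> 1} x \<partial>lborel) = ennreal (unit_ball_vol ?N / (\<Prod>b\<in>Basis. c b))"
  proof -
    have P: "(\<Prod>b\<in>Basis. c b) > 0" using c by (rule prod_pos)
    have "(\<integral>\<^sup>+x. indicator (cball (0::'a) 1) x \<partial>lborel) = ennreal (\<Prod>b\<in>Basis. c b) * (\<integral>\<^sup>+x. indicator {x. norm (?A x) \<le> 1} x \<partial>lborel)"
    proof -
      have "indicator (cball (0::'a) 1) (?A x) = (indicator {x. norm (?A x) \<le> 1} x :: ennreal)" for x
        by (simp add: indicator_def)
      then show ?thesis
        by (subst nn_integral_diag_map[OF _ c]) (auto intro!: borel_measurable_indicator)
    qed
    moreover have "(\<integral>\<^sup>+x. indicator (cball (0::'a) 1) x \<partial>lborel) = ennreal (unit_ball_vol ?N)"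
      by (simp add: emeasure_cball)
    ultimately have eq: "ennreal (unit_ball_vol ?N) = ennreal (\<Prod>b\<in>Basis. c b) * (\<integral>\<^sup>+x. indicator {x. norm (?A x) \<le> 1} x \<partial>lborel)"
      by (simp only:)
    have cancel: "X = ennreal (w / Q)" if "ennreal w = ennreal Q * X" "Q > 0" "w \<ge> 0" for w Q X
    proof -
      have "X = ennreal (1 / Q) * ennreal Q * X" using \<open>Q > 0\<close> by (simp flip: ennreal_mult)
      also have "\<dots> = ennreal (1 / Q) * ennreal w" by (simp only: that(1) mult.assoc)
      also have "\<dots> = ennreal (w / Q)" using that(2,3) by (simp flip: ennreal_mult)
      finally show ?thesis .
    qed
    show ?thesis by (rule cancel[OF eq P]) simp
  qed
  finally show ?thesis
    unfolding I_def by (simp only: ennreal_mult'[of "real ?N"] of_nat_0_le_iff mult.assoc)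
qed

text \<open>
Since \<open>diag_map (\<lambda>_. 1)\<close> is the identity, the homogeneous factor is 1 away from the origin.
\<close>

lemma nn_integral_polar:
  fixes k :: "real \<Rightarrow> ennreal"
  assumes k[measurable]: "k \<in> borel_measurable borel"
  shows "(\<integral>\<^sup>+x. k (norm (x::'a::euclidean_space)) \<partial>lborel) = ennreal (DIM('a) * unit_ball_vol DIM('a)) *
       (\<integral>\<^sup>+r. k r * ennreal (r ^ (DIM('a) - 1)) * indicator {0<..} r \<partial>lborel)"
proof -
  have "(\<integral>\<^sup>+x. k (norm (x::'a)) \<partial>lborel)
    = (\<integral>\<^sup>+x. k (norm x) * ennreal ((norm x / norm (diag_map (\<lambda>_. 1) (x::'a))) ^ DIM('a)) \<partial>lborel)"
  proof (rule nn_integral_cong_AE, rule AE_mp[OF AE_lborel_singleton[of 0]], rule AE_I2, rule impI)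
    fix x :: 'a assume "x \<noteq> 0"
    then show "k (norm x) = k (norm x) * ennreal ((norm x / norm (diag_map (\<lambda>_. 1) x)) ^ DIM('a))"
      by (simp add: diag_map_one)
  qed
  then show ?thesis
    by (subst (asm) nn_integral_radial_homogeneous) auto
qed

lemma nn_integral_radial_homogeneous_det1:
  fixes c :: "'a::euclidean_space \<Rightarrow> real" and k :: "real \<Rightarrow> ennreal"
  assumes "\<And>b. b \<in> Basis \<Longrightarrow> c b > 0" "(\<Prod>b\<in>Basis. c b) = 1" "k \<in> borel_measurable borel"
  shows "(\<integral>\<^sup>+x. k (norm x) * ennreal ((norm x / norm (diag_map c x)) ^ DIM('a)) \<partial>lborel) =
     (\<integral>\<^sup>+x. k (norm (x::'a)) \<partial>lborel)"
  by (simp add: nn_integral_polar nn_integral_radial_homogeneous assms)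

section \<open>Volume-preserving stretches of two axes\<close>

text \<open>
The diagonal coefficients of the maps \<open>A\<close>. The choice \<open>sqrt (1 + \<epsilon>)\<close> makes the quadratic form of
\<open>A\<close> linear in \<open>\<epsilon>\<close> along the stretched axis, and exchanging the two axes gives the inverse of \<open>A\<close>.
\<close>

definition stretch :: "'a \<Rightarrow> 'a \<Rightarrow> real \<Rightarrow> 'a::euclidean_space \<Rightarrow> real" where
  "stretch e f \<epsilon> b = (if b = e then sqrt (1 + \<epsilon>) else if b = f then 1 / sqrt (1 + \<epsilon>) else 1)"

lemma stretch_pos: "\<epsilon> > 0 \<Longrightarrow> stretch e f \<epsilon> b > 0"
  by (auto simp: stretch_def)

definition stretched_ball :: "'a \<Rightarrow> 'a \<Rightarrow> real \<Rightarrow> real \<Rightarrow> 'a::euclidean_space set" where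
  "stretched_ball e f \<epsilon> \<rho> = diag_map (\<lambda>b. \<rho> * stretch e f \<epsilon> b) ` ball 0 1"

locale stretch_dirs =
  fixes e f :: "'a::euclidean_space"
  assumes e: "e \<in> Basis" and f: "f \<in> Basis" and ef: "e \<noteq> f"
begin

lemma stretch_prod: "\<epsilon> > 0 \<Longrightarrow> (\<Prod>b\<in>Basis. stretch e f \<epsilon> b) = 1"
proof -
  assume "\<epsilon> > 0"
  have "(\<Prod>b\<in>Basis. stretch e f \<epsilon> b) = (\<Prod>b\<in>{e, f}. stretch e f \<epsilon> b)"
    using e f by (intro prod.mono_neutral_right) (auto simp: stretch_def)
  then show ?thesis using ef \<open>\<epsilon> > 0\<close> by (simp add: stretch_def)
qed

lemma inverse_stretch: "\<epsilon> > 0 \<Longrightarrow> 1 / stretch e f \<epsilon> b = stretch f e \<epsilon> b"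
  using ef by (auto simp: stretch_def)

lemma norm_stretch_sq:
  assumes "\<epsilon> > 0"
  shows "(norm (diag_map (stretch e f \<epsilon>) x))\<^sup>2 = (norm x)\<^sup>2 + \<epsilon> * (x \<bullet> e)\<^sup>2 - \<epsilon> / (1 + \<epsilon>) * (x \<bullet> f)\<^sup>2"
proof -
  have "(norm (diag_map (stretch e f \<epsilon>) x))\<^sup>2 - (norm x)\<^sup>2 = 
     (\<Sum>b\<in>Basis. ((stretch e f \<epsilon> b)\<^sup>2 - 1) * (x \<bullet> b)\<^sup>2)"
    using norm_diag_map_sq[of "\<lambda>_. 1" x] 
    by (simp add: norm_diag_map_sq diag_map_one left_diff_distrib sum_subtractf)
  also have "\<dots> = (\<Sum>b\<in>{e, f}. ((stretch e f \<epsilon> b)\<^sup>2 - 1) * (x \<bullet> b)\<^sup>2)"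
    using e f by (intro sum.mono_neutral_right) (auto simp: stretch_def)
  also have "\<dots> = \<epsilon> * (x \<bullet> e)\<^sup>2 - \<epsilon> / (1 + \<epsilon>) * (x \<bullet> f)\<^sup>2"
  proof -
    have "1 / (1 + \<epsilon>) - 1 = - (\<epsilon> / (1 + \<epsilon>))" using assms by (simp add: field_simps)
    then show ?thesis using ef assms by (simp add: stretch_def power_divide)
  qed
  finally show ?thesis by simp
qed

text \<open>
The upper bound of order \<open>\<epsilon>\<close> on the relative stretch \<open>t\<close> makes all errors quadratic. The last
bound, on a cone around the axis \<open>e\<close>, shows that the order \<open>\<epsilon>\<close> is attained; it is the source of
the strict gain in the subtracted perimeter.
\<close>

lemma norm_stretch_bounds:
  assumes "\<epsilon> > 0" "\<epsilon> \<le> 1" "x \<noteq> 0"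
  defines "t \<equiv> norm (diag_map (stretch e f \<epsilon>) x) / norm x"
  shows "1 / 2 \<le> t" "t \<le> 2" "\<bar>t - 1\<bar> \<le> \<epsilon>" 
    "2 * (x \<bullet> f)\<^sup>2 \<le> (x \<bullet> e)\<^sup>2 \<Longrightarrow> t - 1 \<ge> \<epsilon> * ((x \<bullet> e) / norm x)\<^sup>2 / 6"
proof -
  define a b where "a = ((x \<bullet> e) / norm x)\<^sup>2" and "b = ((x \<bullet> f) / norm x)\<^sup>2"
  have n: "norm x > 0" using assms by simp
  have ab: "a \<ge> 0" "b \<ge> 0" "a \<le> 1" "b \<le> 1"
    using n Basis_le_norm[OF e, of x] Basis_le_norm[OF f, of x]
    by (auto simp: a_def b_def power_divide abs_le_square_iff[symmetric])
  define d where "d = \<epsilon> / (1 + \<epsilon>)"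
  have d: "0 \<le> d" "d \<le> \<epsilon>" "d \<le> 1/2" using assms(1,2) by (auto simp: d_def field_simps)
  have t0: "t \<ge> 0" by (simp add: t_def)
  have "t\<^sup>2 = ((norm x)\<^sup>2 + \<epsilon> * (x \<bullet> e)\<^sup>2 - d * (x \<bullet> f)\<^sup>2) / (norm x)\<^sup>2"
    unfolding t_def power_divide norm_stretch_sq[OF assms(1)] d_def ..
  also have "\<dots> = 1 + \<epsilon> * a - d * b"
    using n by (simp add: a_def b_def field_simps power_divide)
  finally have t2: "t\<^sup>2 = 1 + \<epsilon> * a - d * b" .
  have ea: "\<epsilon> * a \<le> \<epsilon>" "0 \<le> \<epsilon> * a" using ab assms(1) by (auto simp: mult_left_le)
  have db: "d * b \<le> d" "0 \<le> d * b" using ab d by (auto simp: mult_left_le)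
  have "(1/2)\<^sup>2 \<le> t\<^sup>2" unfolding t2 using ea db d by (simp add: power2_eq_square)
  then show t1: "1 / 2 \<le> t" using t0 by (rule power2_le_imp_le)
  have "t\<^sup>2 \<le> 2\<^sup>2" unfolding t2 using ea db d assms(2) by simp
  then show t3: "t \<le> 2" by (rule power2_le_imp_le) simp
  have f: "(t - 1) * (t + 1) = \<epsilon> * a - d * b" using t2 by (simp add: power2_eq_square algebra_simps)
  have "\<bar>t - 1\<bar> * 1 \<le> \<bar>t - 1\<bar> * (t + 1)" using t0 by (intro mult_left_mono) auto
  also have "\<dots> = \<bar>\<epsilon> * a - d * b\<bar>" unfolding f[symmetric] abs_mult using t0 by simp
  also have "\<dots> \<le> \<epsilon>" using ea db d by linarith
  finally show "\<bar>t - 1\<bar> \<le> \<epsilon>" by simp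
  show "t - 1 \<ge> \<epsilon> * ((x \<bullet> e) / norm x)\<^sup>2 / 6" if "2 * (x \<bullet> f)\<^sup>2 \<le> (x \<bullet> e)\<^sup>2"
  proof -
    have "2 * b \<le> a" using that n by (simp add: a_def b_def power_divide field_simps)
    then have "\<epsilon> * b \<le> \<epsilon> * (a / 2)" using assms(1) by (intro mult_left_mono) auto
    moreover have "d * b \<le> \<epsilon> * b" using d ab by (intro mult_right_mono) auto
    ultimately have l: "\<epsilon> * a / 2 \<le> (t - 1) * (t + 1)" unfolding f by simp
    then have "0 \<le> (t - 1) * (t + 1)" using ea by linarith
    then have "0 \<le> t - 1" using t0 by (simp add: zero_le_mult_iff)
    then have "(t - 1) * (t + 1) \<le> (t - 1) * 3" using t3 by (intro mult_left_mono) auto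
    then have "\<epsilon> * a / 2 \<le> (t - 1) * 3" using l by (rule order_trans[rotated])
    then show ?thesis unfolding a_def[symmetric] by (simp add: field_simps)
  qed
qed

end

section \<open>One-variable power inequalities\<close>

lemma powr_le_of_bounds:
  fixes y :: real
  assumes "K > 1" "1 / K \<le> y" "y \<le> K"
  shows "y powr e \<le> K powr \<bar>e\<bar>"
proof (cases "e \<ge> 0")
  case True
  have "0 < 1 / K" using assms by simp
  then have "0 \<le> y" using assms by linarith
  then show ?thesis using True assms by (simp add: powr_mono2)
next
  case False
  have "0 < 1 / K" using assms by simp
  then have y: "y > 0" using assms by linarith
  have "y powr e = (1/y) powr (-e)" using y by (simp add: powr_divide powr_minus)
  also have "\<dots> \<le> K powr (-e)" using False assms y by (intro powr_mono2) (auto simp: field_simps)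
  finally show ?thesis using False by simp
qed

lemma powr_ge_of_bounds:
  fixes y :: real
  assumes "K > 1" "1 / K \<le> y" "y \<le> K"
  shows "K powr (-\<bar>e\<bar>) \<le> y powr e"
proof -
  have "0 < 1 / K" using assms by simp
  then have y: "y > 0" using assms by linarith
  have "y powr (-e) \<le> K powr \<bar>e\<bar>" using powr_le_of_bounds[OF assms, of "-e"] by simp
  then have "1 / K powr \<bar>e\<bar> \<le> 1 / y powr (-e)" using y assms(1) by (intro divide_left_mono mult_pos_pos) auto
  then show ?thesis by (simp add: powr_minus field_simps)
qed

text \<open>
On \<open>[1/K, K]\<close> the second derivative of the power is bounded below by \<open>2 * c\<close>, so subtracting
\<open>c * (y - 1)\<^sup>2\<close> leaves a convex function, which lies above its tangent at 1.
\<close>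

lemma powr_strongly_convex:
  fixes r K :: real
  assumes "r > 1" "K > 1"
  obtains c where "c > 0" "\<And>y. 1 / K \<le> y \<Longrightarrow> y \<le> K \<Longrightarrow> y powr r \<ge> 1 + r * (y - 1) + c * (y - 1)\<^sup>2"
proof
  define c where "c = r * (r - 1) * K powr (-\<bar>r - 2\<bar>) / 2"
  show "c > 0" using assms by (simp add: c_def)
  fix y assume y: "1 / K \<le> y" "y \<le> K"
  let ?G = "\<lambda>y. y powr r - c * (y - 1)\<^sup>2"
  have pos: "x > 0" if "x \<in> {1/K..K}" for x using that assms order.strict_trans2[of 0 "1/K" x] by simp
  have "convex_on {1/K..K} ?G"
  proof (rule f''_ge0_imp_convex)
    fix x assume x: "x \<in> {1/K..K}"
    note x0 = pos[OF x]
    show "(?G has_real_derivative r * x powr (r - 1) - c * (2 * (x - 1))) (at x)"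
      using x0 by (auto intro!: derivative_eq_intros)
    show "((\<lambda>x. r * x powr (r - 1) - c * (2 * (x - 1))) has_real_derivative r * ((r - 1) * x powr (r - 2)) - c * 2) (at x)"
      using x0 by (auto intro!: derivative_eq_intros simp: algebra_simps)
    have "K powr (-\<bar>r - 2\<bar>) \<le> x powr (r - 2)" using x assms by (intro powr_ge_of_bounds) auto
    then have "r * (r - 1) * K powr (-\<bar>r - 2\<bar>) \<le> r * (r - 1) * x powr (r - 2)"
      using assms by (intro mult_left_mono) auto
    then show "0 \<le> r * ((r - 1) * x powr (r - 2)) - c * 2" by (simp add: c_def mult.assoc)
  qed simp
  moreover have "(?G has_real_derivative r) (at 1 within {1/K..K})"
    by (auto intro!: derivative_eq_intros)
  moreover have "1 \<in> interior {1/K..K}" using assms by (simp add: interior_atLeastAtMost_real)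
  ultimately have "?G y - ?G 1 \<ge> r * (y - 1)"
    using y by (intro convex_on_imp_above_tangent[of "{1/K..K}"]) auto
  then show "y powr r \<ge> 1 + r * (y - 1) + c * (y - 1)\<^sup>2" by simp
qed

text \<open>
The factor \<open>p / n\<close> is chosen so that \<open>t powr p + p / n * t powr (- n)\<close> has a critical point at 1.
\<close>

lemma powr_upper_quadratic:
  fixes p n :: real
  assumes "n > 0"
  obtains M where "M \<ge> 0"
    "\<And>t. 1 / 2 \<le> t \<Longrightarrow> t \<le> 2 \<Longrightarrow> t powr p \<le> 1 - p / n * (t powr (-n) - 1) + M * (t - 1)\<^sup>2"
proof
  define \<kappa> where "\<kappa> = p / n"
  define M where "M = (\<bar>p * (p - 1)\<bar> * 2 powr \<bar>p - 2\<bar> + \<bar>\<kappa> * n * (n + 1)\<bar> * 2 powr \<bar>- n - 2\<bar>) / 2"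
  show "M \<ge> 0" by (simp add: M_def)
  fix t :: real assume t: "1 / 2 \<le> t" "t \<le> 2"
  let ?G = "\<lambda>t. M * (t - 1)\<^sup>2 - t powr p - \<kappa> * t powr (-n)"
  have "convex_on {1/2..2} ?G"
  proof (rule f''_ge0_imp_convex)
    fix x :: real assume x: "x \<in> {1/2..2}"
    then have x0: "x > 0" by simp
    show "(?G has_real_derivative M * (2 * (x - 1)) - p * x powr (p - 1) + \<kappa> * n * x powr (-n - 1)) (at x)"
      using x0 by (auto intro!: derivative_eq_intros)
    show "((\<lambda>x. M * (2 * (x - 1)) - p * x powr (p - 1) + \<kappa> * n * x powr (-n - 1))
       has_real_derivative M * 2 - p * (p - 1) * x powr (p - 2) - \<kappa> * n * (n + 1) * x powr (-n - 2)) (at x)"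
      using x0 by (auto intro!: derivative_eq_intros simp: algebra_simps)
    have a: "a * x powr q \<le> \<bar>a\<bar> * 2 powr \<bar>q\<bar>" for a q
    proof -
      have "a * x powr q \<le> \<bar>a\<bar> * x powr q" by (intro mult_right_mono) auto
      also have "\<dots> \<le> \<bar>a\<bar> * 2 powr \<bar>q\<bar>" using x by (intro mult_left_mono powr_le_of_bounds) auto
      finally show ?thesis .
    qed
    show "0 \<le> M * 2 - p * (p - 1) * x powr (p - 2) - \<kappa> * n * (n + 1) * x powr (-n - 2)"
    proof -
      have "M * 2 = \<bar>p * (p - 1)\<bar> * 2 powr \<bar>p - 2\<bar> + \<bar>\<kappa> * n * (n + 1)\<bar> * 2 powr \<bar>- n - 2\<bar>"
        by (simp add: M_def)
      then show ?thesis
        using a[of "p * (p - 1)" "p - 2"] a[of "\<kappa> * n * (n + 1)" "-n - 2"] by linarith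
    qed
  qed simp
  moreover have "(?G has_real_derivative 0) (at 1 within {1/2..2})"
    using assms by (auto intro!: derivative_eq_intros simp: \<kappa>_def)
  moreover have "1 \<in> interior {1/2..2::real}" by (simp add: interior_atLeastAtMost_real)
  ultimately have "?G t - ?G 1 \<ge> 0 * (t - 1)"
    using t by (intro convex_on_imp_above_tangent[of "{1/2..2}"]) auto
  then show "t powr p \<le> 1 - p / n * (t powr (-n) - 1) + M * (t - 1)\<^sup>2"
    by (simp add: \<kappa>_def algebra_simps)
qed

section \<open>Second-order estimates of spherical averages\<close>

text \<open>
A finite radial measure \<open>\<nu>\<close> on the space; the directions \<open>e\<close> and \<open>f\<close> also serve to fix its type.
\<close>

locale radial_weight = stretch_dirs e f for e f :: "'a::euclidean_space" +
  fixes k :: "real \<Rightarrow> ennreal"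
  assumes k_borel [measurable]: "k \<in> borel_measurable borel"
    and k_finite: "(\<integral>\<^sup>+x. k (norm (x::'a)) \<partial>lborel) < \<infinity>"
begin

definition \<nu> :: "'a measure" where "\<nu> = density lborel (\<lambda>x. k (norm x))"

lemma space_nu [simp]: "space \<nu> = UNIV" and sets_nu [simp, measurable_cong]: "sets \<nu> = sets borel"
  by (simp_all add: \<nu>_def)

lemma emeasure_nu: "emeasure \<nu> UNIV = (\<integral>\<^sup>+x. k (norm (x::'a)) \<partial>lborel)"
  by (simp add: \<nu>_def emeasure_density)

sublocale finite_measure \<nu>
  by standard (use k_finite in \<open>simp add: emeasure_nu\<close>)

lemma AE_nu_nonzero: "AE x in \<nu>. x \<noteq> 0"
proof -
  have "AE x in lborel. k (norm (x::'a)) > 0 \<longrightarrow> x \<noteq> 0"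
    using AE_lborel_singleton[of "0::'a"] by eventually_elim simp
  then show ?thesis unfolding \<nu>_def by (subst AE_density) auto
qed

lemma nn_integral_nu:
  "g \<in> borel_measurable borel \<Longrightarrow> (\<integral>\<^sup>+x. g x \<partial>\<nu>) = (\<integral>\<^sup>+x. k (norm x) * g x \<partial>lborel)"
  unfolding \<nu>_def by (rule nn_integral_density) measurable

end

text \<open>
\<open>\<tau>\<close> is the relative stretch \<open>norm (A x) / norm x\<close>, a function of the direction of \<open>x\<close> only.
\<close>

locale stretched_radial_weight = radial_weight e f k
  for e f :: "'a::euclidean_space" and k +
  fixes \<epsilon> :: real
  assumes eps: "\<epsilon> > 0" "\<epsilon> \<le> 1"
begin

definition \<tau> :: "'a \<Rightarrow> real" where "\<tau> x = norm (diag_map (stretch e f \<epsilon>) x) / norm x"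

lemma \<tau>_borel [measurable]: "\<tau> \<in> borel_measurable borel"
  unfolding \<tau>_def by measurable

lemmas \<tau>_bounds = norm_stretch_bounds[OF eps, folded \<tau>_def]

lemma AE_\<tau>: "AE x in \<nu>. 1 / 2 \<le> \<tau> x \<and> \<tau> x \<le> 2 \<and> \<bar>\<tau> x - 1\<bar> \<le> \<epsilon>"
  using AE_nu_nonzero by eventually_elim (use \<tau>_bounds in auto)

lemma integrable_\<tau>_powr: "integrable \<nu> (\<lambda>x. \<tau> x powr p)"
proof (rule integrable_const_bound)
  show "AE x in \<nu>. norm (\<tau> x powr p) \<le> 2 powr \<bar>p\<bar>"
    using AE_\<tau> by eventually_elim (auto intro!: powr_le_of_bounds)
qed measurable

lemma nn_integral_\<tau>_powr:
  "(\<integral>\<^sup>+x. k (norm x) * ennreal (\<tau> x powr p) \<partial>lborel) = ennreal (\<integral>x. \<tau> x powr p \<partial>\<nu>)"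
proof -
  have "(\<integral>\<^sup>+x. k (norm x) * ennreal (\<tau> x powr p) \<partial>lborel) = (\<integral>\<^sup>+x. ennreal (\<tau> x powr p) \<partial>\<nu>)"
    by (rule nn_integral_nu[symmetric]) measurable
  also have "\<dots> = ennreal (\<integral>x. \<tau> x powr p \<partial>\<nu>)"
    by (rule nn_integral_eq_integral[OF integrable_\<tau>_powr]) auto
  finally show ?thesis .
qed

lemma integral_\<tau>_powr_dim: "(\<integral>x. \<tau> x powr (- real DIM('a)) \<partial>\<nu>) = measure \<nu> UNIV"
proof -
  have "ennreal (\<integral>x. \<tau> x powr (- real DIM('a)) \<partial>\<nu>) = 
     (\<integral>\<^sup>+x. k (norm x) * ennreal (\<tau> x powr (- real DIM('a))) \<partial>lborel)"
    by (rule nn_integral_\<tau>_powr[symmetric])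
  also have "\<dots> = (\<integral>\<^sup>+x. k (norm x) * ennreal ((norm x / norm (diag_map (stretch e f \<epsilon>) x)) ^ DIM('a)) \<partial>lborel)"
  proof (rule nn_integral_cong_AE, rule AE_mp[OF AE_lborel_singleton[of 0]], rule AE_I2, rule impI)
    fix x :: 'a assume "x \<noteq> 0"
    then have "\<tau> x > 0" using \<tau>_bounds(1)[of x] by simp
    then have "\<tau> x powr (- real DIM('a)) = (1 / \<tau> x) ^ DIM('a)"
      by (simp add: powr_minus powr_realpow power_divide field_simps)
    then show "k (norm x) * ennreal (\<tau> x powr (- real DIM('a))) =
       k (norm x) * ennreal ((norm x / norm (diag_map (stretch e f \<epsilon>) x)) ^ DIM('a))"
      by (simp add: \<tau>_def)
  qed
  also have "\<dots> = emeasure \<nu> UNIV"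
    unfolding emeasure_nu using eps stretch_pos stretch_prod
    by (intro nn_integral_radial_homogeneous_det1) auto
  also have "\<dots> = ennreal (measure \<nu> UNIV)" by (rule emeasure_eq_measure)
  finally show ?thesis by (simp add: integral_nonneg_AE)
qed

end

text \<open>
Averaging \<open>powr_upper_quadratic\<close> at \<open>\<tau> x\<close> with \<open>n = DIM('a)\<close> leaves only the quadratic error, because
\<open>\<tau> powr (- DIM('a))\<close> has average 1. The constant \<open>M\<close> depends neither on the weight nor on \<open>\<epsilon>\<close>, as
the case \<open>t = 1\<close> requires: there the weights concentrate on a sphere.
\<close>

lemma radial_average_upper:
  fixes p :: real
  obtains M where "M \<ge> 0"
    "\<And>(e::'a::euclidean_space) f k \<epsilon>. stretched_radial_weight e f k \<epsilon> \<Longrightarrow>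
      (\<integral>\<^sup>+x. k (norm x) * ennreal ((norm (diag_map (stretch e f \<epsilon>) x) / norm x) powr p) \<partial>lborel)
        \<le> ennreal (1 + M * \<epsilon>\<^sup>2) * (\<integral>\<^sup>+x. k (norm (x::'a)) \<partial>lborel)"
proof -
  have "real DIM('a) > 0" by simp
  then obtain M where M: "M \<ge> 0"
    "\<And>t. 1 / 2 \<le> t \<Longrightarrow> t \<le> 2 \<Longrightarrow> t powr p \<le> 1 - p / DIM('a) * (t powr (- real DIM('a)) - 1) + M * (t - 1)\<^sup>2"
    using powr_upper_quadratic[of "real DIM('a)" p] by metis
  show ?thesis
  proof (rule that[OF M(1)])
    fix e f :: 'a and k \<epsilon> assume "stretched_radial_weight e f k \<epsilon>"
    then interpret stretched_radial_weight e f k \<epsilon> .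
    let ?y = "\<lambda>x. \<tau> x powr (- real DIM('a))"
    have int: "integrable \<nu> (\<lambda>x. 1 - p / DIM('a) * (?y x - 1) + M * \<epsilon>\<^sup>2)"
      using integrable_\<tau>_powr by auto
    have "(\<integral>x. \<tau> x powr p \<partial>\<nu>) \<le> (\<integral>x. 1 - p / DIM('a) * (?y x - 1) + M * \<epsilon>\<^sup>2 \<partial>\<nu>)"
    proof (rule integral_mono_AE[OF integrable_\<tau>_powr int])
      show "AE x in \<nu>. \<tau> x powr p \<le> 1 - p / DIM('a) * (?y x - 1) + M * \<epsilon>\<^sup>2"
        using AE_\<tau>
      proof eventually_elim
        case (elim x)
        have "(\<tau> x - 1)\<^sup>2 \<le> \<epsilon>\<^sup>2" using elim eps by (simp add: abs_le_square_iff[symmetric])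
        then have "M * (\<tau> x - 1)\<^sup>2 \<le> M * \<epsilon>\<^sup>2" using M(1) by (rule mult_left_mono)
        then show ?case using M(2)[of "\<tau> x"] elim by auto
      qed
    qed
    also have "\<dots> = measure \<nu> UNIV - p / DIM('a) * (measure \<nu> UNIV - measure \<nu> UNIV) + M * \<epsilon>\<^sup>2 * measure \<nu> UNIV"
      using integrable_\<tau>_powr integral_\<tau>_powr_dim by simp
    finally have "(\<integral>x. \<tau> x powr p \<partial>\<nu>) \<le> (1 + M * \<epsilon>\<^sup>2) * measure \<nu> UNIV" by (simp add: algebra_simps)
    then have "ennreal (\<integral>x. \<tau> x powr p \<partial>\<nu>) \<le> ennreal (1 + M * \<epsilon>\<^sup>2) * emeasure \<nu> UNIV"
      using M(1) by (simp add: emeasure_eq_measure ennreal_mult[symmetric] ennreal_leI del: ennreal_plus)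
    then show "(\<integral>\<^sup>+x. k (norm x) * ennreal ((norm (diag_map (stretch e f \<epsilon>) x) / norm x) powr p) \<partial>lborel)
        \<le> ennreal (1 + M * \<epsilon>\<^sup>2) * (\<integral>\<^sup>+x. k (norm (x::'a)) \<partial>lborel)"
      unfolding emeasure_nu nn_integral_\<tau>_powr[symmetric] unfolding \<tau>_def .
  qed
qed

text \<open>
With \<open>y = \<tau> powr (- DIM('a))\<close> of average 1, the integrand is the strictly convex power
\<open>y powr ((DIM('a) + s) / DIM('a))\<close>. Jensen's inequality with remainder shows that its integral exceeds
the total mass by a multiple of the variance of \<open>y\<close>. That variance is at least of order \<open>\<epsilon>\<^sup>2\<close>, as \<open>1 - y\<close> is at
least of order \<open>\<epsilon>\<close> on the cone \<open>2 * (x \<bullet> f)\<^sup>2 \<le> (x \<bullet> e)\<^sup>2\<close>, on which a radial weight that is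
positive at large radii has positive mass.
\<close>

lemma radial_average_lower:
  fixes s :: real and e f :: "'a::euclidean_space"
  assumes "s > 0" and "radial_weight e f k" and kpos: "\<And>r. r > 2 \<Longrightarrow> k r > 0"
  obtains c where "c > 0"
    "\<And>\<epsilon>. 0 < \<epsilon> \<Longrightarrow> \<epsilon> \<le> 1 \<Longrightarrow>
      (\<integral>\<^sup>+x. k (norm (x::'a)) \<partial>lborel) + ennreal (c * \<epsilon>\<^sup>2) \<le>
      (\<integral>\<^sup>+x. k (norm (x::'a)) * ennreal ((norm (diag_map (stretch e f \<epsilon>) x) / norm x) powr (-(DIM('a) + s))) \<partial>lborel)"
proof -
  interpret radial_weight e f k by fact
  define n where "n = real DIM('a)"
  have n: "n \<ge> 1" unfolding n_def by simp
  define r where "r = (n + s) / n"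
  have r: "r > 1" using n assms(1) by (simp add: r_def)
  have K: "2 powr n > (1::real)" using n by simp
  obtain c0 where c0: "c0 > 0" "\<And>y. 1 / 2 powr n \<le> y \<Longrightarrow> y \<le> 2 powr n \<Longrightarrow> y powr r \<ge> 1 + r * (y - 1) + c0 * (y - 1)\<^sup>2"
    using powr_strongly_convex[OF r K] by metis
  \<comment> \<open>a lower bound for the squared deviation of \<open>\<tau>\<close> from 1, up to a multiple of \<open>\<epsilon>\<^sup>2\<close>\<close>
  define q :: "'a \<Rightarrow> real" where
    "q x = (if 2 * (x \<bullet> f)\<^sup>2 \<le> (x \<bullet> e)\<^sup>2 then ((x \<bullet> e) / norm x) ^ 4 else 0)" for x
  have [measurable]: "q \<in> borel_measurable borel" unfolding q_def by measurable
  have q0: "0 \<le> q x" for x by (simp add: q_def)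
  have q1: "q x \<le> 1" for x
  proof -
    have "\<bar>(x \<bullet> e) / norm x\<bar> \<le> 1" using Basis_le_norm[OF e, of x] by (auto simp: divide_le_eq_1)
    then have "\<bar>(x \<bullet> e) / norm x\<bar> ^ 4 \<le> 1" by (intro power_le_one) auto
    then have "((x \<bullet> e) / norm x) ^ 4 \<le> 1" by (subst (asm) power_even_abs) auto
    then show ?thesis by (simp only: q_def split: if_split) simp
  qed
  have iq: "integrable \<nu> q"
    by (rule integrable_const_bound[where B=1]) (simp_all add: q0 q1)
  have "(\<integral>x. q x \<partial>\<nu>) \<noteq> 0"
  proof
    \<comment> \<open>if the mass were zero, \<open>q\<close> would vanish almost everywhere on this open set\<close>
    define U where "U = {x::'a. norm x > 2} \<inter> {x. 2 * (x \<bullet> f)\<^sup>2 < (x \<bullet> e)\<^sup>2}"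
    assume "(\<integral>x. q x \<partial>\<nu>) = 0"
    then have "AE x in \<nu>. q x = 0"
      using integral_nonneg_eq_0_iff_AE[OF iq] q0 by auto
    then have "AE x in lborel. k (norm (x::'a)) > 0 \<longrightarrow> q x = 0"
      unfolding \<nu>_def by (subst (asm) AE_density) auto
    then have "AE x in lborel. x \<notin> U"
    proof eventually_elim
      case (elim x)
      show ?case
      proof
        assume x: "x \<in> U"
        then have "q x = 0" using elim kpos by (auto simp: U_def)
        moreover have "x \<bullet> e \<noteq> 0" using x zero_le_power2[of "x \<bullet> f"] unfolding U_def by force
        moreover have "2 * (x \<bullet> f)\<^sup>2 \<le> (x \<bullet> e)\<^sup>2" "x \<noteq> 0" using x by (auto simp: U_def)
        ultimately show False by (simp add: q_def)
      qed
    qed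
    moreover have U: "open U" unfolding U_def
      by (intro open_Int open_Collect_less continuous_intros)
    then have "U \<in> sets lborel" by simp
    ultimately have "U \<in> null_sets lborel" by (simp add: AE_iff_null_sets)
    then have "negligible U"
      by (simp add: negligible_iff_null_sets null_sets_completionI)
    moreover have "3 *\<^sub>R e \<in> U"
      using inner_Basis[OF e f] inner_Basis[OF e e] ef e by (simp add: U_def)
    ultimately show False using open_not_negligible[OF U] by blast
  qed
  moreover have "(\<integral>x. q x \<partial>\<nu>) \<ge> 0"
    by (rule integral_nonneg_AE) (simp add: q0)
  ultimately have Q: "(\<integral>x. q x \<partial>\<nu>) > 0" by simp
  \<comment> \<open>144 is the square of the 12 in \<open>1 - y \<ge> \<epsilon> * a / 12\<close> below\<close>
  define c where "c = c0 / 144 * (\<integral>x. q x \<partial>\<nu>)"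
  have "c > 0" using c0 Q by (simp add: c_def)
  then show ?thesis
  proof (rule that)
    fix \<epsilon> :: real assume "0 < \<epsilon>" "\<epsilon> \<le> 1"
    then interpret stretched_radial_weight e f k \<epsilon> by unfold_locales auto
    let ?y = "\<lambda>x. \<tau> x powr (- n)"
    have int: "integrable \<nu> (\<lambda>x. 1 + r * (?y x - 1) + c0 / 144 * \<epsilon>\<^sup>2 * q x)"
      using integrable_\<tau>_powr iq by auto
    have "(\<integral>x. 1 + r * (?y x - 1) + c0 / 144 * \<epsilon>\<^sup>2 * q x \<partial>\<nu>) \<le> (\<integral>x. \<tau> x powr (- (n + s)) \<partial>\<nu>)"
    proof (rule integral_mono_AE[OF int integrable_\<tau>_powr])
      show "AE x in \<nu>. 1 + r * (?y x - 1) + c0 / 144 * \<epsilon>\<^sup>2 * q x \<le> \<tau> x powr (- (n + s))"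
        using AE_nu_nonzero
      proof eventually_elim
        case (elim x)
        note b = \<tau>_bounds[OF elim]
        have "?y x \<le> 2 powr n" "1 / 2 powr n \<le> ?y x"
          using powr_le_of_bounds[of 2 "\<tau> x" "-n"] powr_ge_of_bounds[of 2 "\<tau> x" "-n"] b n 
          by (auto simp: powr_minus field_simps)
        then have "1 + r * (?y x - 1) + c0 * (?y x - 1)\<^sup>2 \<le> ?y x powr r" by (intro c0) auto
        also have "?y x powr r = \<tau> x powr (- (n + s))"
        proof -
          have "- n * r = - (n + s)" using n by (simp add: r_def)
          then show ?thesis by (simp only: powr_powr)
        qed
        finally have 1: "1 + r * (?y x - 1) + c0 * (?y x - 1)\<^sup>2 \<le> \<tau> x powr (- (n + s))" .
        have "\<epsilon>\<^sup>2 / 144 * q x \<le> (?y x - 1)\<^sup>2"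
        proof (cases "2 * (x \<bullet> f)\<^sup>2 \<le> (x \<bullet> e)\<^sup>2")
          case True
          define a where "a = ((x \<bullet> e) / norm x)\<^sup>2"
          have a: "\<epsilon> * a \<ge> 0" using eps by (simp add: a_def)
          have t: "\<tau> x - 1 \<ge> \<epsilon> * a / 6" using b(4)[OF True] by (simp add: a_def)
          then have t1: "\<tau> x \<ge> 1" using a by simp
          have "?y x \<le> \<tau> x powr (-1)" using n t1 by (intro powr_mono) auto
          also have "\<dots> = 1 / \<tau> x" using t1 by (simp add: powr_minus divide_inverse)
          finally have "?y x \<le> 1 / \<tau> x" .
          moreover have "1 - 1 / \<tau> x = (\<tau> x - 1) / \<tau> x" using t1 by (simp add: field_simps)
          moreover have "(\<tau> x - 1) / \<tau> x \<ge> (\<tau> x - 1) / 2" using t1 b(2) by (intro divide_left_mono) auto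
          ultimately have "1 - ?y x \<ge> (\<tau> x - 1) / 2" by linarith
          moreover have "(\<tau> x - 1) / 2 \<ge> \<epsilon> * a / 12" using t by (simp add: field_simps)
          ultimately have "1 - ?y x \<ge> \<epsilon> * a / 12" by (rule order_trans[rotated])
          then have "(\<epsilon> * a / 12)\<^sup>2 \<le> (1 - ?y x)\<^sup>2" using a by (intro power_mono) auto
          moreover have "(\<epsilon> * a / 12)\<^sup>2 = \<epsilon>\<^sup>2 / 144 * q x"
            using True by (simp add: q_def a_def power_mult_distrib power_divide)
          ultimately show ?thesis by (simp add: power2_commute)
        qed (simp add: q_def)
        then have "c0 * (\<epsilon>\<^sup>2 / 144 * q x) \<le> c0 * (?y x - 1)\<^sup>2" using c0(1) by (intro mult_left_mono) auto
        then show ?case using 1 by simp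
      qed
    qed
    moreover have "(\<integral>x. 1 + r * (?y x - 1) + c0 / 144 * \<epsilon>\<^sup>2 * q x \<partial>\<nu>) = measure \<nu> UNIV + c * \<epsilon>\<^sup>2"
      using integrable_\<tau>_powr integral_\<tau>_powr_dim iq by (simp add: c_def n_def)
    ultimately have "measure \<nu> UNIV + c * \<epsilon>\<^sup>2 \<le> (\<integral>x. \<tau> x powr (- (n + s)) \<partial>\<nu>)" by simp
    then have "ennreal (measure \<nu> UNIV + c * \<epsilon>\<^sup>2) \<le> ennreal (\<integral>x. \<tau> x powr (- (n + s)) \<partial>\<nu>)" by (rule ennreal_leI)
    then have "emeasure \<nu> UNIV + ennreal (c * \<epsilon>\<^sup>2) \<le> ennreal (\<integral>x. \<tau> x powr (- (n + s)) \<partial>\<nu>)"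
      using \<open>c > 0\<close> by (simp add: emeasure_eq_measure ennreal_plus[symmetric] del: ennreal_plus)
    then show "(\<integral>\<^sup>+x. k (norm (x::'a)) \<partial>lborel) + ennreal (c * \<epsilon>\<^sup>2) \<le>
      (\<integral>\<^sup>+x. k (norm (x::'a)) * ennreal ((norm (diag_map (stretch e f \<epsilon>) x) / norm x) powr (-(DIM('a) + s))) \<partial>lborel)"
      unfolding emeasure_nu nn_integral_\<tau>_powr[symmetric] unfolding \<tau>_def n_def .
  qed
qed

section \<open>Invariance of Lebesgue measure under reflections\<close>

text \<open>
Reflection in the hyperplane orthogonal to \<open>d\<close>. Any two vectors of equal length are exchanged by
one reflection, so invariance under reflections is all that radial symmetry requires.
\<close>

definition reflection :: "'a::euclidean_space \<Rightarrow> 'a \<Rightarrow> 'a" where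
  "reflection d x = x - (2 * (x \<bullet> d) / (d \<bullet> d)) *\<^sub>R d"

lemma reflection_simps:
  "reflection d (x + y) = reflection d x + reflection d y"
  "reflection d (x - y) = reflection d x - reflection d y"
  by (auto simp: reflection_def inner_simps algebra_simps add_divide_distrib diff_divide_distrib)

lemma norm_reflection: "norm (reflection d x) = norm x"
  unfolding norm_eq reflection_def by (cases "d = 0") (auto simp: inner_simps inner_commute field_simps)

lemma reflection_reflection: "reflection d (reflection d x) = x"
  unfolding reflection_def by (cases "d = 0") (auto simp: inner_simps field_simps)

lemma reflection_maps:
  assumes "norm h = norm k" shows "reflection (h - k) h = k"
proof (cases "h = k")
  case True then show ?thesis by (simp add: reflection_def)
next
  case False
  have "h \<bullet> h = k \<bullet> k" using assms by (simp add: norm_eq)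
  then have e: "(h - k) \<bullet> (h - k) = 2 * (h \<bullet> (h - k))"
    by (simp add: inner_simps inner_commute)
  have "(h - k) \<bullet> (h - k) \<noteq> 0" using False by simp
  then have "2 * (h \<bullet> (h - k)) / ((h - k) \<bullet> (h - k)) = 1" unfolding e[symmetric] by (rule divide_self)
  then show ?thesis unfolding reflection_def by (simp only:) simp
qed

lemma reflection_image_eq_vimage: "reflection d ` S = reflection d -` S"
proof -
  have "x \<in> reflection d ` S" if "reflection d x \<in> S" for x
    using that reflection_reflection[of d x] by (metis imageI)
  then show ?thesis by (auto simp: reflection_reflection)
qed

lemma reflection_ball: "reflection d ` ball x r = ball (reflection d x) r"
proof -
  have "dist (reflection d x) (reflection d y) = dist x y" for x y
    by (simp add: dist_norm norm_reflection flip: reflection_simps)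
  then have "dist (reflection d x) y = dist x (reflection d y)" for y
    by (metis reflection_reflection)
  then show ?thesis by (auto simp: reflection_image_eq_vimage dist_commute)
qed

lemma open_reflection: "open S \<Longrightarrow> open (reflection d ` S)"
proof -
  assume "open S"
  moreover have "continuous_on UNIV (reflection d)"
    unfolding reflection_def by (cases "d = 0") (auto intro!: continuous_intros)
  ultimately show ?thesis
    unfolding reflection_image_eq_vimage by (simp add: open_vimage)
qed

text \<open>
An open set is, up to a null set, a disjoint union of countably many balls (Vitali), and a
reflection moves balls to balls of the same radius. This yields an inequality, and the reflection
being an involution turns it into an equality.
\<close>

lemma emeasure_reflection_open:
  fixes U :: "'a::euclidean_space set"
  assumes "open U"
  shows "emeasure lborel (reflection d ` U) = emeasure lborel U"
proof -
  have le: "emeasure lborel U \<le> emeasure lborel (reflection d ` U)" if "open U" for U :: "'a set"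
  proof -
    \<comment> \<open>the balls contained in \<open>U\<close>, given by centre and radius\<close>
    define K where "K = {p :: 'a \<times> real. ball (fst p) (snd p) \<subseteq> U}"
    have "\<exists>i. i \<in> K \<and> x \<in> ball (fst i) (snd i) \<and> snd i < e" if "x \<in> U" "0 < e" for x e
    proof -
      obtain r where "r > 0" "ball x r \<subseteq> U" using \<open>open U\<close> \<open>x \<in> U\<close> open_contains_ball by blast
      then have "(x, min r (e/2)) \<in> K" by (auto simp: K_def)
      moreover have "x \<in> ball x (min r (e/2))" "min r (e/2) < e" using \<open>r > 0\<close> \<open>0 < e\<close> by auto
      ultimately show ?thesis by force
    qed
    then obtain C where C: "countable C" "C \<subseteq> K"
      and dis: "pairwise (\<lambda>i j. disjnt (ball (fst i) (snd i)) (ball (fst j) (snd j))) C"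
      and neg: "negligible (U - (\<Union>i\<in>C. ball (fst i) (snd i)))"
      by (rule Vitali_covering_theorem_balls[of U K fst snd])
    let ?B = "\<lambda>i::'a \<times> real. ball (fst i) (snd i)"
    have df: "disjoint_family_on ?B C"
      using dis by (auto simp: pairwise_def disjnt_def disjoint_family_on_def)
    then have df': "disjoint_family_on (\<lambda>i. reflection d ` ?B i) C"
      unfolding disjoint_family_on_def reflection_image_eq_vimage by blast
    have eB: "emeasure lborel (reflection d ` ?B i) = emeasure lborel (?B i)" for i
      unfolding reflection_ball
    by (cases "snd i \<ge> 0") (simp_all add: emeasure_ball ball_empty)
    have ms: "U - (\<Union>i\<in>C. ?B i) \<in> sets lborel"
      using \<open>open U\<close> C(1) by (intro sets.Diff sets.countable_UN') auto
    have "emeasure lborel U \<le> emeasure lborel ((\<Union>i\<in>C. ?B i) \<union> (U - (\<Union>i\<in>C. ?B i)))"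
      using ms C(1) by (intro emeasure_mono sets.Un sets.countable_UN') auto
    also have "\<dots> \<le> emeasure lborel (\<Union>i\<in>C. ?B i) + emeasure lborel (U - (\<Union>i\<in>C. ?B i))"
      using ms C(1) by (intro emeasure_subadditive sets.countable_UN') auto
    also have "emeasure lborel (U - (\<Union>i\<in>C. ?B i)) = 0"
      using neg ms by (simp add: negligible_iff_emeasure0 emeasure_completion main_part_sets)
    also have "emeasure lborel (\<Union>i\<in>C. ?B i) = (\<integral>\<^sup>+i. emeasure lborel (?B i) \<partial>count_space C)"
      using C(1) df by (intro emeasure_UN_countable) auto
    also have "\<dots> = (\<integral>\<^sup>+i. emeasure lborel (reflection d ` ?B i) \<partial>count_space C)"
      by (simp only: eB)
    also have "\<dots> = emeasure lborel (\<Union>i\<in>C. reflection d ` ?B i)"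
      using C(1) df' by (intro emeasure_UN_countable[symmetric]) (auto simp: reflection_ball)
    also have "\<dots> \<le> emeasure lborel (reflection d ` U)"
      using C(2) open_reflection[OF \<open>open U\<close>] by (intro emeasure_mono) (auto simp: K_def)
    finally show ?thesis by simp
  qed
  have "emeasure lborel (reflection d ` U) \<le> emeasure lborel (reflection d ` reflection d ` U)"
    by (rule le[OF open_reflection[OF assms]])
  also have "reflection d ` reflection d ` U = U"
    by (simp add: image_image reflection_reflection)
  finally show ?thesis using le[OF assms] by (intro antisym)
qed

section \<open>The fractional perimeter of ellipsoids\<close>

text \<open>
The deficit of the covariogram of the unit ball: the measure of the points that the shift by
\<open>- h\<close> moves out of the ball.
\<close>

definition gap :: "'a::euclidean_space \<Rightarrow> ennreal" where
  "gap h = emeasure lborel (ball 0 1 \<inter> {x. x - h \<notin> ball 0 1})"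

lemma borel_measurable_gap [measurable]: "gap \<in> borel_measurable borel"
proof -
  have [measurable]: "ball (0::'a) 1 \<in> sets borel" "- ball (0::'a) 1 \<in> sets borel" by auto
  have "gap = (\<lambda>h::'a. \<integral>\<^sup>+x. indicator (ball 0 1) x * indicator (- ball 0 1) (x - h) \<partial>lborel)"
    by (auto simp: gap_def fun_eq_iff indicator_def
        intro!: nn_integral_cong simp flip: nn_integral_indicator)
  moreover have "(\<lambda>h::'a. \<integral>\<^sup>+x. indicator (ball 0 1) x * indicator (- ball 0 1) (x - h) \<partial>lborel)
      \<in> borel_measurable borel" by measurable
  ultimately show ?thesis by (simp only:)
qed

lemma gap_eq:
  "gap (h::'a::euclidean_space) = emeasure lborel (ball (0::'a) 1) - emeasure lborel (ball 0 1 \<inter> ball h 1)"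
proof -
  have "ball 0 1 \<inter> {x. x - h \<notin> ball 0 1} = ball 0 1 - ball 0 1 \<inter> ball h 1"
    by (auto simp: dist_norm norm_minus_commute)
  moreover have "emeasure lborel (ball 0 1 \<inter> ball h 1) \<noteq> \<infinity>"
    using emeasure_bounded_finite[of "ball 0 1 \<inter> ball h 1"] by (auto simp: bounded_Int)
  ultimately show ?thesis
    unfolding gap_def by (simp only:) (subst emeasure_Diff, auto)
qed

lemma gap_radial:
  fixes h k :: "'a::euclidean_space"
  assumes "norm h = norm k" shows "gap h = gap k"
proof -
  have "reflection (h - k) ` (ball 0 1 \<inter> ball h 1) = ball 0 1 \<inter> ball k 1"
    using reflection_ball[of "h-k" 0 1] reflection_ball[of "h-k" h 1] reflection_maps[OF assms]
    by (subst image_Int) (auto simp: reflection_def[of _ 0] intro: inj_on_inverseI[of _ _ "reflection (h - k)"] reflection_reflection)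
  then show ?thesis
    unfolding gap_eq using emeasure_reflection_open[of "ball 0 1 \<inter> ball h 1" "h - k"] by (simp add: open_Int)
qed

text \<open>
The intersection of two unit balls at distance \<open>norm h\<close> contains the ball of radius
\<open>1 - norm h\<close>; Bernoulli's inequality does the rest. This linear decay at 0 is what makes the
fractional perimeters of the ball finite.
\<close>

lemma gap_le_linear:
  fixes h :: "'a::euclidean_space"
  assumes "norm h \<le> 1"
  shows "gap h \<le> ennreal (unit_ball_vol DIM('a) * DIM('a) * norm h)"
proof -
  let ?w = "unit_ball_vol (real DIM('a))"
  have "ball 0 (1 - norm h) \<subseteq> ball 0 1 \<inter> ball h 1"
    by (auto simp: dist_norm) (smt (verit) norm_triangle_ineq4 norm_minus_commute norm_ge_zero)+
  then have "emeasure lborel (ball (0::'a) (1 - norm h)) \<le> emeasure lborel (ball 0 1 \<inter> ball h 1)"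
    by (intro emeasure_mono) auto
  then have "gap h \<le> emeasure lborel (ball (0::'a) 1) - emeasure lborel (ball (0::'a) (1 - norm h))"
    unfolding gap_eq by (intro ennreal_minus_mono) auto
  also have "\<dots> = ennreal (?w - ?w * (1 - norm h) ^ DIM('a))"
    using assms by (simp add: emeasure_ball ennreal_minus)
  also have "\<dots> \<le> ennreal (?w * DIM('a) * norm h)"
  proof (rule ennreal_leI)
    have "1 + real DIM('a) * (- norm h) \<le> (1 + (- norm h)) ^ DIM('a)"
      using assms by (intro Bernoulli_inequality) auto
    then have "?w * (1 - (1 - norm h) ^ DIM('a)) \<le> ?w * (DIM('a) * norm h)"
      by (intro mult_left_mono) auto
    then show "?w - ?w * (1 - norm h) ^ DIM('a) \<le> ?w * DIM('a) * norm h"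
      by (simp add: algebra_simps)
  qed
  finally show ?thesis .
qed

lemma gap_le_const: "gap (h::'a::euclidean_space) \<le> ennreal (unit_ball_vol DIM('a))"
  unfolding gap_eq by (simp add: emeasure_ball diff_le_self_ennreal)

lemma gap_far:
  fixes h :: "'a::euclidean_space"
  assumes "norm h \<ge> 2"
  shows "gap h = ennreal (unit_ball_vol DIM('a))"
proof -
  have "ball 0 1 \<inter> ball h 1 = {}"
    using assms by (auto simp: dist_norm) (smt (verit) norm_triangle_ineq4 norm_minus_commute norm_triangle_sub)
  then show ?thesis by (simp add: gap_eq emeasure_ball)
qed

text \<open>
Both variables are pulled back to the unit ball by the linear map, which costs two determinants,
and then \<open>y\<close> is replaced by the difference \<open>h = x - y\<close>, of which alone the kernel depends.
\<close>

lemma frac_perimeter_diag_map: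
  fixes c :: "'a::euclidean_space \<Rightarrow> real" and \<alpha> :: real
  assumes c: "\<And>b. b \<in> Basis \<Longrightarrow> c b > 0"
  shows "frac_perimeter \<alpha> (diag_map c ` ball 0 1) =
     ennreal ((\<Prod>b\<in>Basis. c b)\<^sup>2) *
       (\<integral>\<^sup>+h. gap h * ennreal (1 / norm (diag_map c h) powr (DIM('a) + \<alpha>)) \<partial>lborel)"
proof -
  define p where "p = real DIM('a) + \<alpha>"
  define P where "P = (\<Prod>b\<in>Basis. c b)"
  let ?K = "\<lambda>x::'a. ennreal (1 / norm x powr p)"
  let ?B = "ball (0::'a) 1"
  let ?E = "diag_map c ` ?B"
  have inE: "diag_map c x \<in> ?E \<longleftrightarrow> x \<in> ?B" for x
  proof -
    have "diag_map (\<lambda>b. 1 / c b) (diag_map c x) = x"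
      unfolding diag_map_compose using c by (intro diag_map_one) (auto dest: c)
    then show ?thesis by (simp add: diag_map_image_eq[OF c])
  qed
  have [measurable]: "?B \<in> sets borel" "- ?B \<in> sets borel" by auto
  have P0: "P > 0" unfolding P_def using c by (rule prod_pos)
  have Em[measurable]: "?E \<in> sets borel"
  proof -
    have "open (diag_map (\<lambda>b. 1 / c b) -` ?B)"
      using linear_continuous_on[OF bounded_linear_diag_map, of UNIV] by (intro open_vimage) auto
    moreover have "?E = diag_map (\<lambda>b. 1 / c b) -` ?B"
      using diag_map_image_eq[OF c, where S="?B"] by (auto simp: vimage_def)
    ultimately show ?thesis by simp
  qed
  have 1: "frac_perimeter \<alpha> ?E =
     (\<integral>\<^sup>+x. (\<integral>\<^sup>+y. ?K (x - y) * indicator (- ?E) y \<partial>lborel) * indicator ?E x \<partial>lborel)"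
    unfolding frac_perimeter_def p_def by (simp add: nn_integral_completion)
  also have "\<dots> = ennreal P * (\<integral>\<^sup>+x. (\<integral>\<^sup>+y. ?K (diag_map c x - y) * indicator (- ?E) y \<partial>lborel)
       * indicator ?B x \<partial>lborel)"
    unfolding P_def by (subst nn_integral_diag_map[OF _ c]) (auto simp: inE indicator_def intro!: arg_cong2[where f="(*)"] nn_integral_cong)
  also have "(\<integral>\<^sup>+x. (\<integral>\<^sup>+y. ?K (diag_map c x - y) * indicator (- ?E) y \<partial>lborel) * indicator ?B x \<partial>lborel)
     = (\<integral>\<^sup>+x. ennreal P * (\<integral>\<^sup>+h. ?K (diag_map c h) * (indicator (- ?B) (x - h) * indicator ?B x) \<partial>lborel) \<partial>lborel)"
  proof (rule nn_integral_cong)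
    fix x :: 'a
    have "(\<integral>\<^sup>+y. ?K (diag_map c x - y) * indicator (- ?E) y \<partial>lborel) =
       ennreal P * (\<integral>\<^sup>+y. ?K (diag_map c (x - y)) * indicator (- ?B) y \<partial>lborel)"
      unfolding P_def by (subst nn_integral_diag_map[OF _ c]) (auto simp: inE indicator_def diag_map_simps intro!: arg_cong2[where f="(*)"] nn_integral_cong)
    also have "(\<integral>\<^sup>+y. ?K (diag_map c (x - y)) * indicator (- ?B) y \<partial>lborel)
        = (\<integral>\<^sup>+h. ?K (diag_map c h) * indicator (- ?B) (x - h) \<partial>lborel)"
      by (subst nn_integral_reflect_translate[where t=x]) simp_all
    finally show "(\<integral>\<^sup>+y. ?K (diag_map c x - y) * indicator (- ?E) y \<partial>lborel) * indicator ?B x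
      = ennreal P * (\<integral>\<^sup>+h. ?K (diag_map c h) * (indicator (- ?B) (x - h) * indicator ?B x) \<partial>lborel)"
      by (auto simp: indicator_def)
  qed
  also have "\<dots> = ennreal P * (\<integral>\<^sup>+x. (\<integral>\<^sup>+h. ?K (diag_map c h) * (indicator (- ?B) (x - h) * indicator ?B x) \<partial>lborel) \<partial>lborel)"
    by (rule nn_integral_cmult) measurable
  also have "(\<integral>\<^sup>+x. (\<integral>\<^sup>+h. ?K (diag_map c h) * (indicator (- ?B) (x - h) * indicator ?B x) \<partial>lborel) \<partial>lborel)
     = (\<integral>\<^sup>+h. (\<integral>\<^sup>+x. ?K (diag_map c h) * (indicator (- ?B) (x - h) * indicator ?B x) \<partial>lborel) \<partial>lborel)"
    by (rule lborel_pair.Fubini') measurable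
  also have "\<dots> = (\<integral>\<^sup>+h. gap h * ?K (diag_map c h) \<partial>lborel)"
  proof (rule nn_integral_cong)
    fix h :: 'a
    have "(\<integral>\<^sup>+x. ?K (diag_map c h) * (indicator (- ?B) (x - h) * indicator ?B x) \<partial>lborel)
      = ?K (diag_map c h) * (\<integral>\<^sup>+x. indicator (- ?B) (x - h) * indicator ?B x \<partial>lborel)"
      by (rule nn_integral_cmult) measurable
    also have "(\<integral>\<^sup>+x. indicator (- ?B) (x - h) * indicator ?B x \<partial>lborel) = gap h"
    proof -
      have "indicator (- ?B) (x - h) * indicator ?B x = (indicator (?B \<inter> {x. x - h \<notin> ?B}) x :: ennreal)" for x
        by (auto simp: indicator_def)
      moreover have "?B \<inter> {x. x - h \<notin> ?B} \<in> sets lborel"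
      proof -
        have "?B \<inter> {x. x - h \<notin> ?B} = ?B - ball h 1" by (auto simp: dist_norm norm_minus_commute)
        then show ?thesis by simp
      qed
      ultimately show ?thesis unfolding gap_def by (simp only: nn_integral_indicator)
    qed
    finally show "(\<integral>\<^sup>+x. ?K (diag_map c h) * (indicator (- ?B) (x - h) * indicator ?B x) \<partial>lborel)
      = gap h * ?K (diag_map c h)" by (simp add: mult.commute)
  qed
  finally show ?thesis
    using P0 by (simp add: p_def P_def mult.assoc[symmetric] power2_eq_square ennreal_mult)
qed

text \<open>
The profile of the gap function; by its radial symmetry the axis may be chosen arbitrarily.
\<close>

definition gap_radius :: "'a::euclidean_space itself \<Rightarrow> real \<Rightarrow> ennreal" where
  "gap_radius _ r = gap (r *\<^sub>R (SOME b. b \<in> Basis) :: 'a)"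

lemma borel_measurable_gap_radius [measurable]: "gap_radius TYPE('a::euclidean_space) \<in> borel_measurable borel"
  unfolding gap_radius_def by measurable

lemma gap_radius_norm: "gap_radius TYPE('a::euclidean_space) (norm (h::'a)) = gap h"
  unfolding gap_radius_def by (rule gap_radial) (simp add: some_in_eq)

text \<open>
In polar coordinates the integrand is at most a multiple of \<open>r^(-\<alpha>)\<close> for \<open>r \<le> 1\<close>, where the gap is
at most linear in \<open>r\<close>, and of \<open>r^(-1 - \<alpha>)\<close> for larger \<open>r\<close>, where the gap is bounded.
\<close>

lemma gap_integral_finite:
  fixes \<alpha> :: real
  assumes "0 < \<alpha>" "\<alpha> < 1"
  shows "(\<integral>\<^sup>+h. gap (h::'a::euclidean_space) * ennreal (1 / norm h powr (DIM('a) + \<alpha>)) \<partial>lborel) < \<infinity>"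
proof -
  let ?N = "DIM('a)"
  let ?w = "unit_ball_vol (real ?N)"
  let ?g = "gap_radius TYPE('a)"
  let ?J = "\<lambda>r::real. ?g r * ennreal (1 / r powr (?N + \<alpha>)) * ennreal (r ^ (?N - 1)) * indicator {0<..} r"
  have J: "?J r \<le> ennreal (?w * ?N) * (ennreal (r powr (-\<alpha>)) * indicator {0..1} r)
      + ennreal ?w * (ennreal (r powr (-1 - \<alpha>)) * indicator {1..} r)" for r
  proof (cases "r > 0")
    case True
    have g: "?g r = gap (r *\<^sub>R (SOME b. b \<in> Basis) :: 'a)" by (simp add: gap_radius_def)
    have nb: "norm (r *\<^sub>R (SOME b. b \<in> Basis) :: 'a) = r" using True by (simp add: some_in_eq)
    have rp: "1 / r powr (?N + \<alpha>) * r ^ (?N - 1) = r powr (-1 - \<alpha>)"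
    proof -
      have "r powr (-1-\<alpha>) = r powr (real (?N - 1)) / r powr (?N + \<alpha>)"
        using True by (subst powr_diff[symmetric]) (simp add: of_nat_diff Suc_leI)
      then show ?thesis using True by (simp only: powr_realpow) simp
    qed
    have e: "?J r = ?g r * ennreal (r powr (-1 - \<alpha>))"
      using True by (simp add: mult.assoc flip: ennreal_mult rp)
    show ?thesis
    proof (cases "r \<le> 1")
      case r1: True
      have "?J r \<le> ennreal (?w * ?N * r) * ennreal (r powr (-1 - \<alpha>))"
        unfolding e unfolding g using gap_le_linear[of "r *\<^sub>R (SOME b. b \<in> Basis) :: 'a"] nb r1
        by (intro mult_right_mono) auto
      also have "\<dots> = ennreal (?w * ?N) * ennreal (r powr (-\<alpha>))"
        using True by (simp add: powr_diff powr_minus field_simps flip: ennreal_mult)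
      also have "\<dots> \<le> ennreal (?w * ?N) * (ennreal (r powr (-\<alpha>)) * indicator {0..1} r)
      + ennreal ?w * (ennreal (r powr (-1 - \<alpha>)) * indicator {1..} r)"
        using True r1 by simp
      finally show ?thesis .
    next
      case r1: False
      have "?J r \<le> ennreal ?w * ennreal (r powr (-1 - \<alpha>))"
        unfolding e unfolding g by (intro mult_right_mono gap_le_const) auto
      then show ?thesis using r1 True by simp
    qed
  qed simp
  have "(\<integral>\<^sup>+h. gap (h::'a) * ennreal (1 / norm h powr (?N + \<alpha>)) \<partial>lborel)
     = (\<integral>\<^sup>+h. ?g (norm (h::'a)) * ennreal (1 / norm h powr (?N + \<alpha>)) \<partial>lborel)"
    by (simp add: gap_radius_norm)
  also have "\<dots> = ennreal (?N * ?w) * (\<integral>\<^sup>+r. ?J r \<partial>lborel)"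
    by (subst nn_integral_polar) auto
  also have "\<dots> < \<infinity>"
  proof -
    have "(\<integral>\<^sup>+r. ?J r \<partial>lborel) \<le> (\<integral>\<^sup>+r. ennreal (?w * ?N) * (ennreal (r powr (-\<alpha>)) * indicator {0..1} r)
      + ennreal ?w * (ennreal (r powr (-1 - \<alpha>)) * indicator {1..} r) \<partial>lborel)"
      by (intro nn_integral_mono J)
    also have "\<dots> = ennreal (?w * ?N) * (\<integral>\<^sup>+r. ennreal (r powr (-\<alpha>)) * indicator {0..1} r \<partial>lborel)
      + ennreal ?w * (\<integral>\<^sup>+r. ennreal (r powr (-1 - \<alpha>)) * indicator {1..} r \<partial>lborel)"
      by (subst nn_integral_add) (auto simp: nn_integral_cmult)
    also have "\<dots> < \<infinity>"
    proof -
      have "((\<lambda>r. r powr (-\<alpha>)) has_integral (1 powr (-\<alpha> + 1) / (-\<alpha> + 1))) {0..1}"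
        using assms by (intro has_integral_powr_from_0) auto
      then have "(\<integral>\<^sup>+r. ennreal (r powr (-\<alpha>)) * indicator {0..1} r \<partial>lborel) = ennreal (1 powr (-\<alpha> + 1) / (-\<alpha> + 1))"
        by (intro nn_integral_has_integral_lebesgue'[where \<Omega>="{0..1}"]) (auto)
      then show ?thesis using assms
        by (auto simp: nn_integral_powr_tail ennreal_mult_less_top)
    qed
    finally show ?thesis by (auto simp: ennreal_mult_less_top)
  qed
  finally show ?thesis .
qed

text \<open>
The radial weight whose averages are the fractional perimeters of ellipsoids.
\<close>

definition gap_weight :: "'a::euclidean_space itself \<Rightarrow> real \<Rightarrow> real \<Rightarrow> ennreal" where
  "gap_weight T \<alpha> r = gap_radius T r * ennreal (1 / r powr (real DIM('a) + \<alpha>))"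

lemma gap_weight_norm:
  "gap_weight TYPE('a::euclidean_space) \<alpha> (norm (h::'a)) = gap h * ennreal (1 / norm h powr (real DIM('a) + \<alpha>))"
  by (simp add: gap_weight_def gap_radius_norm)

lemma radial_weight_gap:
  fixes e f :: "'a::euclidean_space"
  assumes "stretch_dirs e f" "0 < \<alpha>" "\<alpha> < 1"
  shows "radial_weight e f (gap_weight TYPE('a) \<alpha>)"
proof -
  interpret stretch_dirs e f by fact
  show ?thesis
  proof
    show "gap_weight TYPE('a) \<alpha> \<in> borel_measurable borel"
      unfolding gap_weight_def[abs_def] by measurable
    show "(\<integral>\<^sup>+x. gap_weight TYPE('a) \<alpha> (norm (x::'a)) \<partial>lborel) < \<infinity>"
      unfolding gap_weight_norm by (rule gap_integral_finite) fact+
  qed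
qed

lemma frac_perimeter_dilated_diag_map:
  fixes c :: "'a::euclidean_space \<Rightarrow> real"
  assumes c: "\<And>b. b \<in> Basis \<Longrightarrow> c b > 0" and det: "(\<Prod>b\<in>Basis. c b) = 1" and \<rho>: "\<rho> > 0"
  shows "frac_perimeter \<alpha> (diag_map (\<lambda>b. \<rho> * c b) ` ball 0 1) =
    ennreal (\<rho> powr (real DIM('a) - \<alpha>)) * (\<integral>\<^sup>+x. gap_weight TYPE('a) \<alpha> (norm x) *
      ennreal ((norm (diag_map c x) / norm x) powr (-(real DIM('a) + \<alpha>))) \<partial>lborel)"
proof -
  let ?N = "real DIM('a)"
  let ?I = "\<lambda>x. gap_weight TYPE('a) \<alpha> (norm x) * ennreal ((norm (diag_map c x) / norm x) powr (-(?N + \<alpha>)))"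
  have cA: "diag_map (\<lambda>b. \<rho> * c b) x = \<rho> *\<^sub>R diag_map c x" for x
    by (simp add: diag_map_def scaleR_sum_right mult.assoc)
  have [measurable]: "gap_weight TYPE('a) \<alpha> \<in> borel_measurable borel"
    unfolding gap_weight_def[abs_def] by measurable
  have "frac_perimeter \<alpha> (diag_map (\<lambda>b. \<rho> * c b) ` ball 0 1) = ennreal ((\<rho> ^ DIM('a))\<^sup>2) *
       (\<integral>\<^sup>+h. gap h * ennreal (1 / norm (diag_map (\<lambda>b. \<rho> * c b) h) powr (?N + \<alpha>)) \<partial>lborel)"
    using frac_perimeter_diag_map[where c="\<lambda>b. \<rho> * c b" and \<alpha>=\<alpha>] c \<rho> by (simp add: prod.distrib det)
  also have "(\<integral>\<^sup>+h. gap h * ennreal (1 / norm (diag_map (\<lambda>b. \<rho> * c b) h) powr (?N + \<alpha>)) \<partial>lborel)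
     = (\<integral>\<^sup>+h. ennreal (\<rho> powr (-(?N + \<alpha>))) * ?I h \<partial>lborel)"
  proof (rule nn_integral_cong_AE, rule AE_mp[OF AE_lborel_singleton[of 0]], rule AE_I2, rule impI)
    fix h :: 'a assume h: "h \<noteq> 0"
    have Ah: "norm (diag_map c h) > 0" by (rule norm_diag_map_pos[OF c h])
    have "1 / norm (diag_map (\<lambda>b. \<rho> * c b) h) powr (?N + \<alpha>) =
       \<rho> powr (-(?N + \<alpha>)) * (1 / norm h powr (?N + \<alpha>) * (norm (diag_map c h) / norm h) powr (-(?N + \<alpha>)))"
    proof -
      have "1 / (\<rho> * a) powr p = \<rho> powr (-p) * (1 / n powr p * (a / n) powr (-p))" if "a > 0" "n > 0" for a n p :: real
        using \<rho> that by (simp add: powr_mult powr_divide powr_minus field_simps)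
      from this[of "norm (diag_map c h)" "norm h"] show ?thesis
        unfolding cA using \<rho> h Ah by simp
    qed
    then show "gap h * ennreal (1 / norm (diag_map (\<lambda>b. \<rho> * c b) h) powr (?N + \<alpha>)) = ennreal (\<rho> powr (-(?N + \<alpha>))) * ?I h"
      by (simp only: gap_weight_norm ennreal_mult powr_ge_zero divide_nonneg_nonneg zero_le_one mult_nonneg_nonneg mult_ac)
  qed
  also have "\<dots> = ennreal (\<rho> powr (-(?N + \<alpha>))) * (\<integral>\<^sup>+h. ?I h \<partial>lborel)"
    by (rule nn_integral_cmult) measurable
  also have "ennreal ((\<rho> ^ DIM('a))\<^sup>2) * \<dots> = ennreal ((\<rho> ^ DIM('a))\<^sup>2 * \<rho> powr (-(?N + \<alpha>))) * (\<integral>\<^sup>+h. ?I h \<partial>lborel)"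
    by (simp only: ennreal_mult powr_ge_zero zero_le_power2 mult.assoc)
  also have "(\<rho> ^ DIM('a))\<^sup>2 * \<rho> powr (-(?N + \<alpha>)) = \<rho> powr (?N - \<alpha>)"
  proof -
    have "(\<rho> ^ DIM('a))\<^sup>2 = \<rho> powr (2 * ?N)"
      using \<rho> by (simp add: powr_realpow[symmetric] power2_eq_square powr_add[symmetric])
    then show ?thesis by (simp only: powr_add[symmetric]) simp
  qed
  finally show ?thesis .
qed

lemma ball_eq_diag_map: "\<rho> > 0 \<Longrightarrow> ball (0::'a::euclidean_space) \<rho> = diag_map (\<lambda>b. \<rho> * 1) ` ball 0 1"
proof -
  assume \<rho>: "\<rho> > 0"
  have "diag_map (\<lambda>b. 1 / (\<rho> * 1)) y = (1 / \<rho>) *\<^sub>R y" for y :: 'a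
    by (rule euclidean_eqI) (simp add: diag_map_inner)
  then show ?thesis using \<rho> by (subst diag_map_image_eq) (auto simp: field_simps)
qed

lemma frac_perimeter_ball:
  assumes "\<rho> > 0"
  shows "frac_perimeter \<alpha> (ball (0::'a::euclidean_space) \<rho>) =
    ennreal (\<rho> powr (real DIM('a) - \<alpha>)) * (\<integral>\<^sup>+x. gap_weight TYPE('a) \<alpha> (norm (x::'a)) \<partial>lborel)"
proof -
  have "gap_weight TYPE('a) \<alpha> (norm x) * ennreal ((norm (diag_map (\<lambda>_. 1) x) / norm x) powr (-(real DIM('a) + \<alpha>)))
     = gap_weight TYPE('a) \<alpha> (norm x)" for x :: 'a
    by (cases "x = 0") (simp_all add: diag_map_one gap_weight_def)
  then show ?thesis
    unfolding ball_eq_diag_map[OF assms] using frac_perimeter_dilated_diag_map[where c="\<lambda>_::'a. 1" and \<rho>=\<rho> and \<alpha>=\<alpha>] assms by simp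
qed

lemma frac_perimeter_stretched_upper:
  assumes \<alpha>: "0 < \<alpha>" "\<alpha> < 1"
  obtains T C where "C \<ge> 0"
    "\<And>\<rho>. \<rho> > 0 \<Longrightarrow> frac_perimeter \<alpha> (ball (0::'a::euclidean_space) \<rho>) = ennreal (\<rho> powr (real DIM('a) - \<alpha>) * T)"
    "\<And>(e::'a) f \<epsilon> \<rho>. stretch_dirs e f \<Longrightarrow> 0 < \<epsilon> \<Longrightarrow> \<epsilon> \<le> 1 \<Longrightarrow> \<rho> > 0 \<Longrightarrow>
       frac_perimeter \<alpha> (stretched_ball e f \<epsilon> \<rho>) \<le> ennreal (\<rho> powr (real DIM('a) - \<alpha>) * (T + C * \<epsilon>\<^sup>2))"
    "T \<ge> 0"
proof -
  let ?S = "\<integral>\<^sup>+x. gap_weight TYPE('a) \<alpha> (norm (x::'a)) \<partial>lborel"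
  define T where "T = enn2real ?S"
  have "?S < \<infinity>" unfolding gap_weight_norm by (rule gap_integral_finite) fact+
  then have S: "?S = ennreal T" by (simp add: T_def)
  have T0: "T \<ge> 0" by (simp add: T_def)
  obtain M where M: "M \<ge> 0"
    "\<And>(e::'a::euclidean_space) f k \<epsilon>. stretched_radial_weight e f k \<epsilon> \<Longrightarrow>
      (\<integral>\<^sup>+x. k (norm x) * ennreal ((norm (diag_map (stretch e f \<epsilon>) x) / norm x) powr (-(real DIM('a) + \<alpha>))) \<partial>lborel)
        \<le> ennreal (1 + M * \<epsilon>\<^sup>2) * (\<integral>\<^sup>+x. k (norm (x::'a)) \<partial>lborel)"
    using radial_average_upper[where 'a='a and p="-(real DIM('a) + \<alpha>)"] by blast
  show ?thesis
  proof (rule that[of "M * T" T])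
    show "M * T \<ge> 0" "T \<ge> 0" using M(1) T0 by auto
    show "frac_perimeter \<alpha> (ball (0::'a) \<rho>) = ennreal (\<rho> powr (real DIM('a) - \<alpha>) * T)" if "\<rho> > 0" for \<rho>
      unfolding frac_perimeter_ball[OF that] S using T0 by (simp add: ennreal_mult)
    fix e f :: 'a and \<epsilon> \<rho> :: real
    assume d: "stretch_dirs e f" and eps: "0 < \<epsilon>" "\<epsilon> \<le> 1" and \<rho>: "\<rho> > 0"
    interpret radial_weight e f "gap_weight TYPE('a) \<alpha>" by (rule radial_weight_gap[OF d \<alpha>])
    interpret stretched_radial_weight e f "gap_weight TYPE('a) \<alpha>" \<epsilon> by unfold_locales fact+
    have "frac_perimeter \<alpha> (stretched_ball e f \<epsilon> \<rho>) =
      ennreal (\<rho> powr (real DIM('a) - \<alpha>)) * (\<integral>\<^sup>+x. gap_weight TYPE('a) \<alpha> (norm x) *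
      ennreal ((norm (diag_map (stretch e f \<epsilon>) x) / norm x) powr (-(real DIM('a) + \<alpha>))) \<partial>lborel)"
      unfolding stretched_ball_def
      by (rule frac_perimeter_dilated_diag_map) (auto simp: stretch_pos[OF eps(1)] stretch_prod[OF eps(1)] \<rho>)
    also have "\<dots> \<le> ennreal (\<rho> powr (real DIM('a) - \<alpha>)) * (ennreal (1 + M * \<epsilon>\<^sup>2) * ?S)"
      by (intro mult_left_mono M(2)) (unfold_locales, auto)
    also have "\<dots> = ennreal (\<rho> powr (real DIM('a) - \<alpha>) * ((1 + M * \<epsilon>\<^sup>2) * T))"
      unfolding S using T0 M(1) by (simp only: ennreal_mult powr_ge_zero add_nonneg_nonneg mult_nonneg_nonneg zero_le_one zero_le_power2)
    also have "(1 + M * \<epsilon>\<^sup>2) * T = T + M * T * \<epsilon>\<^sup>2" by (simp add: algebra_simps)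
    finally show "frac_perimeter \<alpha> (stretched_ball e f \<epsilon> \<rho>) \<le> ennreal (\<rho> powr (real DIM('a) - \<alpha>) * (T + M * T * \<epsilon>\<^sup>2))" .
  qed
qed

lemma frac_perimeter_stretched_lower:
  fixes e f :: "'a::euclidean_space"
  assumes d: "stretch_dirs e f" and \<alpha>: "0 < \<alpha>" "\<alpha> < 1"
  obtains S c where "c > 0" "S \<ge> 0"
    "\<And>\<rho>. \<rho> > 0 \<Longrightarrow> frac_perimeter \<alpha> (ball (0::'a) \<rho>) = ennreal (\<rho> powr (real DIM('a) - \<alpha>) * S)"
    "\<And>\<epsilon> \<rho>. 0 < \<epsilon> \<Longrightarrow> \<epsilon> \<le> 1 \<Longrightarrow> \<rho> > 0 \<Longrightarrow>
       ennreal (\<rho> powr (real DIM('a) - \<alpha>) * (S + c * \<epsilon>\<^sup>2)) \<le> frac_perimeter \<alpha> (stretched_ball e f \<epsilon> \<rho>)"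
proof -
  let ?S = "\<integral>\<^sup>+x. gap_weight TYPE('a) \<alpha> (norm (x::'a)) \<partial>lborel"
  define S where "S = enn2real ?S"
  have "?S < \<infinity>" unfolding gap_weight_norm by (rule gap_integral_finite) fact+
  then have S: "?S = ennreal S" by (simp add: S_def)
  have S0: "S \<ge> 0" by (simp add: S_def)
  interpret radial_weight e f "gap_weight TYPE('a) \<alpha>" by (rule radial_weight_gap[OF d \<alpha>])
  have pos: "gap_weight TYPE('a) \<alpha> r > 0" if "r > 2" for r
  proof -
    have n: "norm (r *\<^sub>R e) = r" using that e by simp
    have "gap_weight TYPE('a) \<alpha> r = gap (r *\<^sub>R e) * ennreal (1 / r powr (real DIM('a) + \<alpha>))"
      using gap_weight_norm[of \<alpha> "r *\<^sub>R e"] unfolding n .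
    also have "gap (r *\<^sub>R e) = ennreal (unit_ball_vol DIM('a))" using that n by (intro gap_far) simp
    finally show ?thesis using that by (simp add: ennreal_mult[symmetric])
  qed
  obtain c where c: "c > 0" "\<And>\<epsilon>. 0 < \<epsilon> \<Longrightarrow> \<epsilon> \<le> 1 \<Longrightarrow>
      ?S + ennreal (c * \<epsilon>\<^sup>2) \<le> (\<integral>\<^sup>+x. gap_weight TYPE('a) \<alpha> (norm (x::'a)) *
         ennreal ((norm (diag_map (stretch e f \<epsilon>) x) / norm x) powr (-(real DIM('a) + \<alpha>))) \<partial>lborel)"
    using radial_average_lower[OF \<alpha>(1) radial_weight_gap[OF d \<alpha>] pos] by blast
  show ?thesis
  proof (rule that[OF c(1) S0])
    show "frac_perimeter \<alpha> (ball (0::'a) \<rho>) = ennreal (\<rho> powr (real DIM('a) - \<alpha>) * S)" if "\<rho> > 0" for \<rho>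
      unfolding frac_perimeter_ball[OF that] S using S0 by (simp add: ennreal_mult)
    fix \<epsilon> \<rho> :: real
    assume eps: "0 < \<epsilon>" "\<epsilon> \<le> 1" and \<rho>: "\<rho> > 0"
    have "ennreal (\<rho> powr (real DIM('a) - \<alpha>) * (S + c * \<epsilon>\<^sup>2)) = ennreal (\<rho> powr (real DIM('a) - \<alpha>)) * (?S + ennreal (c * \<epsilon>\<^sup>2))"
      unfolding S using S0 c(1) by (simp add: ennreal_mult)
    also have "\<dots> \<le> ennreal (\<rho> powr (real DIM('a) - \<alpha>)) * (\<integral>\<^sup>+x. gap_weight TYPE('a) \<alpha> (norm x) *
      ennreal ((norm (diag_map (stretch e f \<epsilon>) x) / norm x) powr (-(real DIM('a) + \<alpha>))) \<partial>lborel)"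
      by (intro mult_left_mono c(2) eps) auto
    also have "\<dots> = frac_perimeter \<alpha> (stretched_ball e f \<epsilon> \<rho>)"
      unfolding stretched_ball_def
      by (rule frac_perimeter_dilated_diag_map[symmetric]) (auto simp: stretch_pos[OF eps(1)] stretch_prod[OF eps(1)] \<rho>)
    finally show "ennreal (\<rho> powr (real DIM('a) - \<alpha>) * (S + c * \<epsilon>\<^sup>2)) \<le> frac_perimeter \<alpha> (stretched_ball e f \<epsilon> \<rho>)" .
  qed
qed

section \<open>Cutoff functions and the divergence theorem\<close>

lemma sqpos_deriv: "((\<lambda>v::real. (max 0 v)\<^sup>2) has_real_derivative 2 * max 0 v) (at v)"
proof -
  consider "v > 0" | "v < 0" | "v = 0" by linarith
  then show ?thesis
  proof cases
    case 1
    have "((\<lambda>v::real. v\<^sup>2) has_real_derivative 2 * max 0 v) (at v)"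
      using 1 by (auto intro!: derivative_eq_intros)
    then show ?thesis
      by (rule has_field_derivative_transform_within_open[of _ _ _ "{0<..}"]) (use 1 in auto)
  next
    case 2
    have "((\<lambda>v::real. 0) has_real_derivative 2 * max 0 v) (at v)"
      using 2 by (auto intro!: derivative_eq_intros)
    then show ?thesis
      by (rule has_field_derivative_transform_within_open[of _ _ _ "{..<0}"]) (use 2 in auto)
  next
    case 3
    have "((\<lambda>h::real. ((max 0 h)\<^sup>2 - (max 0 0)\<^sup>2) / (h - 0)) \<longlongrightarrow> 0) (at 0)"
    proof (rule Lim_null_comparison[of _ "\<lambda>h. \<bar>h\<bar>"])
      have "norm (((max 0 h)\<^sup>2 - (max 0 0)\<^sup>2) / (h - 0)) \<le> \<bar>h\<bar>" for h :: real
        by (auto simp: power2_eq_square max_def)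
      then show "\<forall>\<^sub>F h in at 0. norm (((max 0 h)\<^sup>2 - (max 0 0)\<^sup>2) / (h - 0)) \<le> \<bar>h::real\<bar>" by simp
      show "((\<lambda>h::real. \<bar>h\<bar>) \<longlongrightarrow> 0) (at 0)" by (rule tendsto_eq_intros | simp)+
    qed
    then show ?thesis using 3 by (simp add: has_field_derivative_iff)
  qed
qed

text \<open>
A continuously differentiable transition from 1 on \<open>v \<le> 0\<close> to 0 on \<open>v \<ge> 1\<close>.
\<close>

definition step :: "real \<Rightarrow> real" where "step v = (max 0 (1 - (max 0 v)\<^sup>2))\<^sup>2"
definition step' :: "real \<Rightarrow> real" where "step' v = - 4 * max 0 (1 - (max 0 v)\<^sup>2) * max 0 v"

lemma step_deriv: "(step has_real_derivative step' v) (at v)"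
proof -
  have "((\<lambda>v. 1 - (max 0 v)\<^sup>2) has_real_derivative - (2 * max 0 v)) (at v)"
    using DERIV_diff[OF DERIV_const sqpos_deriv[of v], of 1] by simp
  from DERIV_chain2[OF sqpos_deriv this] show ?thesis
    by (simp add: step_def[abs_def] step'_def mult_ac)
qed

lemma continuous_step': "continuous_on UNIV step'"
  unfolding step'_def[abs_def] by (intro continuous_intros)

lemma step_props:
  "0 \<le> step v" "step v \<le> 1" "v \<le> 0 \<Longrightarrow> step v = 1" "v \<ge> 1 \<Longrightarrow> step v = 0"
  "step' v \<le> 0" "v \<le> 0 \<Longrightarrow> step' v = 0" "v \<ge> 1 \<Longrightarrow> step' v = 0"
proof -
  have *: "1 - (max 0 v)\<^sup>2 \<le> 0" if "v \<ge> 1" using that by (simp add: one_le_power)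
  show "0 \<le> step v" by (simp add: step_def)
  show "step v \<le> 1" unfolding step_def by (intro power_le_one) auto
  show "v \<le> 0 \<Longrightarrow> step v = 1" "v \<le> 0 \<Longrightarrow> step' v = 0" by (simp_all add: step_def step'_def)
  show "v \<ge> 1 \<Longrightarrow> step v = 0" "v \<ge> 1 \<Longrightarrow> step' v = 0" using * by (simp_all add: step_def step'_def max_absorb1)
  show "step' v \<le> 0" by (simp add: step'_def)
qed

text \<open>
Applied to the squared norm, a \<open>C\<^sup>1\<close> approximation from inside of the indicator of the unit ball,
equal to 1 where the squared norm is at most \<open>1 - \<delta>\<close>.
\<close>

definition cutoff :: "real \<Rightarrow> real \<Rightarrow> real" where "cutoff \<delta> u = step ((u - (1 - \<delta>)) / \<delta>)"
definition cutoff' :: "real \<Rightarrow> real \<Rightarrow> real" where "cutoff' \<delta> u = step' ((u - (1 - \<delta>)) / \<delta>) / \<delta>"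

lemma cutoff_deriv:
  assumes "\<delta> > 0" shows "(cutoff \<delta> has_real_derivative cutoff' \<delta> u) (at u)"
proof -
  have "((\<lambda>u. (u - (1 - \<delta>)) / \<delta>) has_real_derivative 1 / \<delta>) (at u)"
    using assms by (auto intro!: derivative_eq_intros)
  from DERIV_chain2[OF step_deriv this] show ?thesis by (simp add: cutoff_def[abs_def] cutoff'_def)
qed

lemma continuous_cutoff': "\<delta> > 0 \<Longrightarrow> continuous_on UNIV (cutoff' \<delta>)"
  unfolding cutoff'_def[abs_def]
  by (intro continuous_intros continuous_on_compose2[OF continuous_step']) auto

lemma cutoff_props:
  assumes "\<delta> > 0"
  shows "0 \<le> cutoff \<delta> u" "cutoff \<delta> u \<le> 1" "u \<le> 1 - \<delta> \<Longrightarrow> cutoff \<delta> u = 1" "u \<ge> 1 \<Longrightarrow> cutoff \<delta> u = 0"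
    "cutoff' \<delta> u \<le> 0" "u \<le> 1 - \<delta> \<Longrightarrow> cutoff' \<delta> u = 0" "u \<ge> 1 \<Longrightarrow> cutoff' \<delta> u = 0"
  using assms by (auto simp: cutoff_def cutoff'_def step_props field_simps divide_nonpos_pos)

lemma integrable_compact_support:
  fixes g :: "'a::euclidean_space \<Rightarrow> real"
  assumes "continuous_on UNIV g" "\<And>x. norm x > R \<Longrightarrow> g x = 0"
  shows "integrable lborel g"
proof -
  have "integrable lborel (\<lambda>x. indicator (cball 0 R) x *\<^sub>R g x)"
    using assms(1) by (intro borel_integrable_compact continuous_on_subset[OF assms(1)]) auto
  also have "(\<lambda>x. indicator (cball 0 R) x *\<^sub>R g x) = g"
    using assms(2) by (auto simp: fun_eq_iff indicator_def not_le)
  finally show ?thesis .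
qed

text \<open>
The integral of each difference quotient vanishes by translation invariance, and the quotients
converge boundedly to the derivative.
\<close>

lemma integral_directional_derivative_eq_0:
  fixes f :: "'a::euclidean_space \<Rightarrow> real"
  assumes f: "\<And>x. (f has_derivative D x) (at x)"
    and cont: "continuous_on UNIV (\<lambda>x. D x b)"
    and supp: "\<And>x. norm x > R \<Longrightarrow> f x = 0"
  shows "(\<integral>x. D x b \<partial>lborel) = 0"
proof -
  have fc: "continuous_on UNIV f"
    using f by (intro continuous_at_imp_continuous_on ballI has_derivative_continuous)
  have line: "((\<lambda>\<tau>. f (x + \<tau> *\<^sub>R b)) has_real_derivative D (x + \<tau> *\<^sub>R b) b) (at \<tau>)" for x \<tau>
  proof -
    have "((\<lambda>\<tau>. x + \<tau> *\<^sub>R b) has_derivative (\<lambda>h. h *\<^sub>R b)) (at \<tau>)"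
      by (auto intro!: derivative_eq_intros)
    from has_derivative_compose[OF this f]
    have "((\<lambda>\<tau>. f (x + \<tau> *\<^sub>R b)) has_derivative (\<lambda>h. D (x + \<tau> *\<^sub>R b) (h *\<^sub>R b))) (at \<tau>)" .
    moreover have "D (x + \<tau> *\<^sub>R b) (h *\<^sub>R b) = D (x + \<tau> *\<^sub>R b) b * h" for h
      using linear_scale[OF has_derivative_linear[OF f]] by (simp add: mult.commute)
    ultimately show ?thesis by (simp add: has_field_derivative_def mult_commute_abs)
  qed
  have D0: "D x b = 0" if "norm x > R" for x
  proof -
    have "((\<lambda>_. 0) has_derivative D x) (at x)"
    proof (rule has_derivative_transform_within_open[OF f, where s="{x. norm x > R}"])
      show "open {x::'a. norm x > R}" by (intro open_Collect_less continuous_intros)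
    qed (use that supp in auto)
    from has_derivative_unique[OF this has_derivative_const] show ?thesis by simp
  qed
  have "compact ((\<lambda>x. D x b) ` cball 0 R)"
    by (intro compact_continuous_image continuous_on_subset[OF cont]) auto
  then obtain C where C: "\<forall>y\<in>(\<lambda>x. D x b) ` cball 0 R. norm y \<le> C"
    using compact_imp_bounded bounded_iff by metis
  define C' where "C' = max 0 C"
  have DC: "\<bar>D x b\<bar> \<le> C'" for x
    using C D0[of x] by (cases "norm x \<le> R") (force simp: C'_def max_def)+
  \<comment> \<open>difference quotients in direction \<open>b\<close> with step \<open>1 / (n + 1)\<close>\<close>
  define q where "q n x = (f (x + (1 / real (Suc n)) *\<^sub>R b) - f x) / (1 / real (Suc n))" for n x
  have qlim: "(\<lambda>n. q n x) \<longlonglongrightarrow> D x b" for x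
  proof -
    have "((\<lambda>h. (f (x + h *\<^sub>R b) - f x) / h) \<longlongrightarrow> D x b) (at 0)"
      using line[of x 0] by (simp add: DERIV_def)
    moreover have "filterlim (\<lambda>n. 1 / real (Suc n)) (at 0) sequentially"
      using LIMSEQ_inverse_real_of_nat by (intro filterlim_atI) (auto simp: inverse_eq_divide)
    ultimately show ?thesis unfolding q_def by (rule filterlim_compose)
  qed
  have qb: "\<bar>q n x\<bar> \<le> C' * indicator (cball 0 (R + norm b)) x" for n x
  proof -
    define h where "h = 1 / real (Suc n)"
    have h: "h > 0" "h \<le> 1" by (auto simp: h_def)
    obtain z where "f (x + h *\<^sub>R b) - f (x + 0 *\<^sub>R b) = (h - 0) * D (x + z *\<^sub>R b) b"
      using MVT2[OF h(1), of "\<lambda>\<tau>. f (x + \<tau> *\<^sub>R b)" "\<lambda>\<tau>. D (x + \<tau> *\<^sub>R b) b"] line by blast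
    then have qe: "q n x = D (x + z *\<^sub>R b) b" using h(1) unfolding q_def h_def[symmetric] by simp
    show ?thesis
    proof (cases "norm x \<le> R + norm b")
      case True
      then show ?thesis using qe DC by simp
    next
      case False
      have "norm (h *\<^sub>R b) \<le> norm b" using h by (simp add: mult_left_le_one_le)
      then have "norm (x + h *\<^sub>R b) > R" "norm x > R"
        using False norm_diff_ineq[of x "h *\<^sub>R b"] norm_ge_zero[of b] by linarith+
      then show ?thesis using supp False by (simp add: q_def h_def)
    qed
  qed
  have fi: "integrable lborel f" by (rule integrable_compact_support[OF fc supp])
  have trans: "integrable lborel (\<lambda>x. f (x + a))" "(\<integral>x. f (x + a) \<partial>lborel) = (\<integral>x. f x \<partial>lborel)" for a
  proof -
    have [measurable]: "f \<in> borel_measurable borel" using fc by (rule borel_measurable_continuous_onI)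
    have "integrable (distr lborel borel ((+) a)) f" using fi by (simp add: lborel_distr_plus)
    then show "integrable lborel (\<lambda>x. f (x + a))" by (subst (asm) integrable_distr_eq) (auto simp: add.commute)
    have "(\<integral>x. f x \<partial>distr lborel borel ((+) a)) = (\<integral>x. f (a + x) \<partial>lborel)" by (rule integral_distr) auto
    then show "(\<integral>x. f (x + a) \<partial>lborel) = (\<integral>x. f x \<partial>lborel)" by (simp add: lborel_distr_plus add.commute)
  qed
  have "(\<lambda>n. \<integral>x. q n x \<partial>lborel) \<longlonglongrightarrow> (\<integral>x. D x b \<partial>lborel)"
  proof (rule integral_dominated_convergence[where w="\<lambda>x. C' * indicator (cball 0 (R + norm b)) x"])
    show "(\<lambda>x. D x b) \<in> borel_measurable lborel" using borel_measurable_continuous_onI[OF cont] by simp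
    show "q n \<in> borel_measurable lborel" for n
      unfolding q_def using fi trans(1) by (intro borel_measurable_divide borel_measurable_diff borel_measurable_integrable) auto
    show "integrable lborel (\<lambda>x. C' * indicator (cball 0 (R + norm b)) x)"
      by (intro integrable_mult_right integrable_real_indicator) (use emeasure_bounded_finite[OF bounded_cball, of 0 "R + norm b"] in auto)
  qed (use qlim qb in auto)
  moreover have "(\<integral>x. q n x \<partial>lborel) = 0" for n
    unfolding q_def using fi trans by simp
  ultimately show ?thesis by (simp add: LIMSEQ_const_iff)
qed

text \<open>
The divergence theorem for the field \<open>\<phi>\<close> multiplied by the cutoff \<open>w\<close> of the quadratic form
\<open>(norm (diag_map d x))\<^sup>2\<close>, whose gradient at \<open>x\<close> is \<open>2 * diag_map (\<lambda>b. (d b)\<^sup>2) x\<close>. The gradient of the cutoff replaces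
the surface measure of the ellipsoid weighted with its normal.
\<close>

lemma integral_cutoff_divergence:
  fixes \<phi> :: "'a::euclidean_space \<Rightarrow> 'a"
  assumes \<phi>: "\<And>x. (\<phi> has_derivative D x) (at x)"
    and D: "\<And>b. b \<in> Basis \<Longrightarrow> continuous_on UNIV (\<lambda>x. D x b)"
    and w: "\<And>u. (w has_real_derivative w' u) (at u)" and w': "continuous_on UNIV w'"
    and supp: "\<And>x. norm x > R \<Longrightarrow> w ((norm (diag_map d x))\<^sup>2) = 0 \<and> w' ((norm (diag_map d x))\<^sup>2) = 0"
  shows "integrable lborel (\<lambda>x. w ((norm (diag_map d x))\<^sup>2) * (\<Sum>b\<in>Basis. D x b \<bullet> b))" (is ?th1)
    and "integrable lborel (\<lambda>x. - 2 * w' ((norm (diag_map d x))\<^sup>2) * (\<phi> x \<bullet> diag_map (\<lambda>b. (d b)\<^sup>2) x))" (is ?th2)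
    and "(\<integral>x. w ((norm (diag_map d x))\<^sup>2) * (\<Sum>b\<in>Basis. D x b \<bullet> b) \<partial>lborel) =
      (\<integral>x. - 2 * w' ((norm (diag_map d x))\<^sup>2) * (\<phi> x \<bullet> diag_map (\<lambda>b. (d b)\<^sup>2) x) \<partial>lborel)" (is ?th3)
proof -
  let ?Q = "\<lambda>x. (norm (diag_map d x))\<^sup>2"
  have cA: "continuous_on UNIV (diag_map c)" for c :: "'a \<Rightarrow> real"
    by (rule linear_continuous_on[OF bounded_linear_diag_map])
  have cw: "continuous_on UNIV w" using w by (intro continuous_at_imp_continuous_on ballI DERIV_isCont)
  have c\<phi>: "continuous_on UNIV \<phi>"
    using \<phi> by (intro continuous_at_imp_continuous_on ballI has_derivative_continuous)
  have cQ: "continuous_on UNIV ?Q" by (intro continuous_intros cA)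
  note cc = continuous_on_compose2[OF cw cQ] continuous_on_compose2[OF w' cQ]
  have i1: "integrable lborel (\<lambda>x. w (?Q x) * (D x b \<bullet> b))" if "b \<in> Basis" for b
    by (rule integrable_compact_support[of _ R]) (use supp D[OF that] in \<open>auto intro!: continuous_intros cc\<close>)
  have i2: "integrable lborel (\<lambda>x. - 2 * w' (?Q x) * ((\<phi> x \<bullet> b) * ((d b)\<^sup>2 * (x \<bullet> b))))" for b
    by (rule integrable_compact_support[of _ R]) (use supp in \<open>auto intro!: continuous_intros cc c\<phi>\<close>)
  have e2: "- 2 * w' (?Q x) * (\<phi> x \<bullet> diag_map (\<lambda>b. (d b)\<^sup>2) x) =
     (\<Sum>b\<in>Basis. - 2 * w' (?Q x) * ((\<phi> x \<bullet> b) * ((d b)\<^sup>2 * (x \<bullet> b))))" for x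
    by (subst euclidean_inner) (simp add: diag_map_inner sum_distrib_left)
  show ?th1 unfolding sum_distrib_left by (intro Bochner_Integration.integrable_sum i1)
  show ?th2 unfolding e2 by (intro Bochner_Integration.integrable_sum i2)
  have key: "(\<integral>x. w (?Q x) * (D x b \<bullet> b) \<partial>lborel) = (\<integral>x. - 2 * w' (?Q x) * ((\<phi> x \<bullet> b) * ((d b)\<^sup>2 * (x \<bullet> b))) \<partial>lborel)"
    if b: "b \<in> Basis" for b
  proof -
    define F where "F x v = w (?Q x) * (D x v \<bullet> b) + w' (?Q x) * (2 * (diag_map d x \<bullet> diag_map d v)) * (\<phi> x \<bullet> b)" for x v
    have Fb: "F x b = w (?Q x) * (D x b \<bullet> b) - (- 2 * w' (?Q x) * ((\<phi> x \<bullet> b) * ((d b)\<^sup>2 * (x \<bullet> b))))" for x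
      unfolding F_def diag_map_inner_Basis[OF b] by (simp only: mult_ac minus_mult_left[symmetric] diff_minus_eq_add)
    have "(\<integral>x. F x b \<partial>lborel) = 0"
    proof (rule integral_directional_derivative_eq_0[where f="\<lambda>x. w (?Q x) * (\<phi> x \<bullet> b)" and R=R])
      fix x
      have dQ: "(?Q has_derivative (\<lambda>v. 2 * (diag_map d x \<bullet> diag_map d v))) (at x)"
      proof -
        note h = bounded_linear_imp_has_derivative[OF bounded_linear_diag_map[of d], of "at x"]
        have "(\<lambda>v. diag_map d x \<bullet> diag_map d v + diag_map d v \<bullet> diag_map d x) = (\<lambda>v. 2 * (diag_map d x \<bullet> diag_map d v))"
          by (rule ext) (simp add: inner_commute[of _ "diag_map d x"])
        then show ?thesis
          using has_derivative_inner[OF h h] by (simp only: power2_norm_eq_inner)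
      qed
      have dw: "(w has_derivative (\<lambda>h. w' (?Q x) * h)) (at (?Q x))"
        by (rule w[unfolded has_field_derivative_def])
      have W: "((\<lambda>x. w (?Q x)) has_derivative (\<lambda>v. w' (?Q x) * (2 * (diag_map d x \<bullet> diag_map d v)))) (at x)"
        by (rule has_derivative_compose[OF dQ dw])
      show "((\<lambda>x. w (?Q x) * (\<phi> x \<bullet> b)) has_derivative F x) (at x)"
        unfolding F_def using has_derivative_mult[OF W has_derivative_inner_left[OF \<phi>[of x], of b]] by simp
    next
      show "continuous_on UNIV (\<lambda>x. F x b)" unfolding Fb
        using D[OF b] by (auto intro!: continuous_intros cc c\<phi>)
    qed (use supp in auto)
    then show ?thesis unfolding Fb using i1[OF b] i2[of b] by simp
  qed
  show ?th3 unfolding e2 sum_distrib_left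
    by (subst Bochner_Integration.integral_sum[OF i1], assumption,
        subst Bochner_Integration.integral_sum[OF i2]) (intro sum.cong refl key)
qed

lemma set_lebesgue_integral_eq_lborel:
  fixes g :: "'a::euclidean_space \<Rightarrow> real"
  assumes "E \<in> sets borel" "g \<in> borel_measurable borel"
  shows "set_lebesgue_integral lebesgue E g = (\<integral>x. indicator E x * g x \<partial>lborel)"
  unfolding set_lebesgue_integral_def using assms by (subst integral_completion) auto

section \<open>The classical perimeter of ellipsoids\<close>

text \<open>
The left-hand side approximates the area of the unit sphere. Taking the identity as field in the
divergence theorem gives the same integral with \<open>(norm x)\<^sup>2\<close> instead of \<open>norm x\<close>; the two differ
little, since the derivative of the cutoff lives where \<open>(norm x)\<^sup>2 \<ge> 1 - \<delta>\<close>.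
\<close>

lemma nn_integral_cutoff_gradient_le:
  assumes \<delta>: "0 < \<delta>" "\<delta> < 1"
  shows "(\<integral>\<^sup>+x. ennreal (- 2 * cutoff' \<delta> ((norm (x::'a::euclidean_space))\<^sup>2) * norm x) \<partial>lborel)
        \<le> ennreal (DIM('a) * unit_ball_vol DIM('a) / sqrt (1 - \<delta>))"
proof -
  let ?w = "cutoff \<delta>" and ?w' = "cutoff' \<delta>"
  have one: "diag_map (\<lambda>_. 1) x = x" "diag_map (\<lambda>_. 1\<^sup>2) x = x" for x :: 'a
    by (simp_all add: diag_map_one)
  have supp: "?w ((norm (diag_map (\<lambda>_. 1) x))\<^sup>2) = 0 \<and> ?w' ((norm (diag_map (\<lambda>_. 1) x))\<^sup>2) = 0"
    if "norm x > 1" for x :: 'a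
    using that \<delta> by (simp add: one cutoff_props one_le_power)
  have id: "((\<lambda>x::'a. x) has_derivative (\<lambda>v. v)) (at x)" for x by (rule has_derivative_ident)
  note div = integral_cutoff_divergence[where d="\<lambda>_. 1" and R=1 and w="?w" and w'="?w'",
      OF id continuous_on_const cutoff_deriv[OF \<delta>(1)] continuous_cutoff'[OF \<delta>(1)] supp,
      unfolded one inner_same_Basis]
  let ?g = "\<lambda>x::'a. - 2 * ?w' ((norm x)\<^sup>2) * (x \<bullet> x)"
  have bb: "(\<Sum>b\<in>(Basis::'a set). b \<bullet> b) = real DIM('a)" by simp
  have "(\<integral>x. ?g x \<partial>lborel) = (\<integral>x. ?w ((norm x)\<^sup>2) * (\<Sum>b\<in>(Basis::'a set). b \<bullet> b) \<partial>(lborel :: 'a measure))"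
    by (rule div(3)[symmetric])
  also have "\<dots> \<le> (\<integral>x. indicator (ball 0 1) x * real DIM('a) \<partial>(lborel :: 'a measure))"
  proof (rule integral_mono)
    show "integrable lborel (\<lambda>x::'a. ?w ((norm x)\<^sup>2) * (\<Sum>b\<in>(Basis::'a set). b \<bullet> b))" by (rule div(1))
    show "integrable lborel (\<lambda>x::'a. indicator (ball 0 1) x * real DIM('a))"
      using emeasure_bounded_finite[OF bounded_ball, of "0::'a" 1]
      by (intro integrable_mult_left integrable_real_indicator) auto
    show "?w ((norm x)\<^sup>2) * (\<Sum>b\<in>(Basis::'a set). b \<bullet> b) \<le> indicator (ball 0 1) x * real DIM('a)" for x :: 'a
    proof (cases "norm x < 1")
      case True
      then show ?thesis using cutoff_props(2)[OF \<delta>(1)] by (simp add: mult_left_le_one_le cutoff_props(1)[OF \<delta>(1)])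
    next
      case False
      then have "(norm x)\<^sup>2 \<ge> 1" by (simp add: one_le_power)
      then show ?thesis using \<delta>(1) by (simp add: cutoff_props)
    qed
  qed
  also have "\<dots> = DIM('a) * unit_ball_vol DIM('a)"
    by (simp add: content_ball)
  finally have I: "(\<integral>x. ?g x \<partial>lborel) \<le> DIM('a) * unit_ball_vol DIM('a)" .
  have g0: "?g x \<ge> 0" for x
    using cutoff_props(5)[OF \<delta>(1)] by (simp add: mult_nonpos_nonneg)
  have "(\<integral>\<^sup>+x. ennreal (- 2 * ?w' ((norm (x::'a))\<^sup>2) * norm x) \<partial>lborel)
      \<le> (\<integral>\<^sup>+x. ennreal (?g x * (1 / sqrt (1 - \<delta>))) \<partial>lborel)"
  proof (intro nn_integral_mono ennreal_leI)
    fix x :: 'a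
    show "- 2 * ?w' ((norm x)\<^sup>2) * norm x \<le> ?g x * (1 / sqrt (1 - \<delta>))"
    proof (cases "(norm x)\<^sup>2 \<le> 1 - \<delta>")
      case True
      then show ?thesis using \<delta> by (simp add: cutoff_props)
    next
      case False
      then have "sqrt (1 - \<delta>) \<le> norm x" by (simp add: real_le_lsqrt real_sqrt_le_iff less_imp_le sqrt_le_D)
      then have "norm x * sqrt (1 - \<delta>) \<le> norm x * norm x" by (intro mult_left_mono) auto
      then have "norm x \<le> (x \<bullet> x) * (1 / sqrt (1 - \<delta>))"
        using \<delta> by (simp add: field_simps dot_square_norm power2_eq_square)
      then have "- 2 * ?w' ((norm x)\<^sup>2) * norm x \<le> - 2 * ?w' ((norm x)\<^sup>2) * ((x \<bullet> x) * (1 / sqrt (1 - \<delta>)))"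
        using cutoff_props(5)[OF \<delta>(1)] by (intro mult_left_mono) (auto simp: mult_nonpos_nonneg)
      then show ?thesis by (simp only: mult.assoc)
    qed
  qed
  also have "\<dots> = ennreal (\<integral>x. ?g x * (1 / sqrt (1 - \<delta>)) \<partial>lborel)"
  proof (rule nn_integral_eq_integral)
    show "integrable lborel (\<lambda>x. ?g x * (1 / sqrt (1 - \<delta>)))"
      by (intro integrable_mult_left div(2))
    show "AE x in lborel. 0 \<le> ?g x * (1 / sqrt (1 - \<delta>))"
      using \<delta> by (intro AE_I2 mult_nonneg_nonneg[OF g0]) auto
  qed
  also have "\<dots> = ennreal ((\<integral>x. ?g x \<partial>lborel) * (1 / sqrt (1 - \<delta>)))"
    by (subst Bochner_Integration.integral_mult_left_zero) (rule refl)
  also have "\<dots> \<le> ennreal (DIM('a) * unit_ball_vol DIM('a) * (1 / sqrt (1 - \<delta>)))"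
    using I \<delta> by (intro ennreal_leI mult_right_mono) auto
  finally show ?thesis by simp
qed

text \<open>
For a field bounded by 1, the divergence theorem with cutoff bounds the integral of the
divergence by that of the length of the cutoff's gradient. Pulled back to the unit ball, this length
is \<open>norm (inv A x) / (\<rho> * norm x)\<close> times that of a radial cutoff, and \<open>inv A\<close> is again a stretch,
so \<open>radial_average_upper\<close> with exponent 1 applies.
\<close>

lemma perimeter_stretched_ball_upper:
  obtains M where "M \<ge> 0"
    "\<And>(e::'a::euclidean_space) f \<epsilon> \<rho>. stretch_dirs e f \<Longrightarrow> 0 < \<epsilon> \<Longrightarrow> \<epsilon> \<le> 1 \<Longrightarrow> \<rho> > 0 \<Longrightarrow>
      perimeter (diag_map (\<lambda>b. \<rho> * stretch e f \<epsilon> b) ` ball 0 1)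
        \<le> ereal (\<rho> ^ (DIM('a) - 1) * (1 + M * \<epsilon>\<^sup>2) * (DIM('a) * unit_ball_vol DIM('a)))"
proof -
  let ?N = "DIM('a)"
  let ?W = "real ?N * unit_ball_vol ?N"
  obtain M where M: "M \<ge> 0"
    "\<And>(e::'a::euclidean_space) f k \<epsilon>. stretched_radial_weight e f k \<epsilon> \<Longrightarrow>
      (\<integral>\<^sup>+x. k (norm x) * ennreal ((norm (diag_map (stretch e f \<epsilon>) x) / norm x) powr 1) \<partial>lborel)
        \<le> ennreal (1 + M * \<epsilon>\<^sup>2) * (\<integral>\<^sup>+x. k (norm (x::'a)) \<partial>lborel)"
    using radial_average_upper[where 'a='a and p=1] by blast
  show ?thesis
  proof (rule that[OF M(1)])
    fix e f :: 'a and \<epsilon> \<rho> :: real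
    assume dirs: "stretch_dirs e f" and eps: "0 < \<epsilon>" "\<epsilon> \<le> 1" and \<rho>: "\<rho> > 0"
    interpret stretch_dirs e f by fact
    interpret inv: stretch_dirs f e using e f ef by unfold_locales auto
    define c where "c b = \<rho> * stretch e f \<epsilon> b" for b
    define d where "d b = 1 / c b" for b
    have c0: "c b > 0" for b by (simp add: c_def \<rho> stretch_pos[OF eps(1)])
    have d0: "d b > 0" for b using c0 by (simp add: d_def)
    have dc: "d b * c b = 1" for b using c0[of b] by (simp add: d_def)
    have P: "(\<Prod>b\<in>Basis. c b) = \<rho> ^ ?N"
      by (simp add: c_def prod.distrib stretch_prod[OF eps(1)])
    define Q where "Q x = (norm (diag_map d x))\<^sup>2" for x
    define E where "E = diag_map c ` ball 0 1"
    have E: "E = {x. Q x < 1}"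
      unfolding E_def Q_def d_def by (subst diag_map_image_eq) (auto simp: c0 abs_square_less_1)
    have cA: "continuous_on UNIV (diag_map c)" for c :: "'a \<Rightarrow> real"
      by (rule linear_continuous_on[OF bounded_linear_diag_map])
    have cQ: "continuous_on UNIV Q" unfolding Q_def by (intro continuous_intros cA)
    have Eb: "E \<in> sets borel" unfolding E by (intro borel_open open_Collect_less cQ continuous_intros)
    obtain R where R: "\<And>x. norm x > R \<Longrightarrow> norm (diag_map d x) \<ge> 1" using norm_diag_map_lower[of d] d0 by blast
    then have QR: "Q x \<ge> 1" if "norm x > R" for x using that by (simp add: Q_def one_le_power)
    define B where "B = \<rho> ^ (?N - 1) * (1 + M * \<epsilon>\<^sup>2) * ?W"
    have B0: "B \<ge> 0" using \<rho> M(1) by (simp add: B_def)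
    show "perimeter (diag_map (\<lambda>b. \<rho> * stretch e f \<epsilon> b) ` ball 0 1)
        \<le> ereal (\<rho> ^ (?N - 1) * (1 + M * \<epsilon>\<^sup>2) * ?W)"
      unfolding c_def[symmetric] E_def[symmetric] B_def[symmetric] perimeter_def
    proof (rule SUP_least)
      fix \<phi> :: "'a \<Rightarrow> 'a"
      assume "\<phi> \<in> {\<phi>. C1_field \<phi> \<and> compact (closure {x. \<phi> x \<noteq> 0}) \<and> (\<forall>x. norm (\<phi> x) \<le> 1)}"
      then obtain D where D: "\<And>x. (\<phi> has_derivative blinfun_apply (D x)) (at x)" and Dc: "continuous_on UNIV D"
        and \<phi>1: "\<And>x. norm (\<phi> x) \<le> 1" by (auto simp: C1_field_def)
      have Dcb: "continuous_on UNIV (\<lambda>x. blinfun_apply (D x) b)" for b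
        using Dc by (intro continuous_intros)
      have dv: "divergence \<phi> x = (\<Sum>b\<in>Basis. D x b \<bullet> b)" for x
        unfolding divergence_def using frechet_derivative_at[OF D[of x]] by simp
      have dvc: "continuous_on UNIV (divergence \<phi>)"
        unfolding dv by (intro continuous_intros Dcb)
      have le: "(\<integral>x. cutoff \<delta> (Q x) * divergence \<phi> x \<partial>lborel) \<le> B / sqrt (1 - \<delta>)" if \<delta>: "0 < \<delta>" "\<delta> < 1" for \<delta>
      proof -
        have supp: "cutoff \<delta> ((norm (diag_map d x))\<^sup>2) = 0 \<and> cutoff' \<delta> ((norm (diag_map d x))\<^sup>2) = 0"
          if "norm x > R" for x
          using QR[OF that] \<delta>(1) by (simp add: Q_def cutoff_props)
        note div = integral_cutoff_divergence[OF D Dcb cutoff_deriv[OF \<delta>(1)] continuous_cutoff'[OF \<delta>(1)] supp,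
            folded Q_def dv]
        define h where "h x = - 2 * cutoff' \<delta> (Q x) * norm (diag_map (\<lambda>b. (d b)\<^sup>2) x)" for x
        have h0: "h x \<ge> 0" for x using cutoff_props(5)[OF \<delta>(1)] by (simp add: h_def mult_nonpos_nonneg)
        have hc: "continuous_on UNIV h" unfolding h_def
          by (intro continuous_intros continuous_on_compose2[OF continuous_cutoff'[OF \<delta>(1)] cQ] cA) auto
        have hi: "integrable lborel h"
          by (rule integrable_compact_support[OF hc, of R]) (use supp in \<open>simp add: h_def Q_def\<close>)
        have "(\<integral>x. cutoff \<delta> (Q x) * divergence \<phi> x \<partial>lborel) =
           (\<integral>x. - 2 * cutoff' \<delta> (Q x) * (\<phi> x \<bullet> diag_map (\<lambda>b. (d b)\<^sup>2) x) \<partial>lborel)" by (rule div(3))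
        also have "\<dots> \<le> (\<integral>x. h x \<partial>lborel)"
        proof (rule integral_mono[OF div(2) hi])
          fix x
          have "\<phi> x \<bullet> diag_map (\<lambda>b. (d b)\<^sup>2) x \<le> norm (\<phi> x) * norm (diag_map (\<lambda>b. (d b)\<^sup>2) x)"
            by (rule norm_cauchy_schwarz)
          also have "\<dots> \<le> 1 * norm (diag_map (\<lambda>b. (d b)\<^sup>2) x)" using \<phi>1 by (intro mult_right_mono) auto
          finally show "- 2 * cutoff' \<delta> (Q x) * (\<phi> x \<bullet> diag_map (\<lambda>b. (d b)\<^sup>2) x) \<le> h x"
            unfolding h_def using cutoff_props(5)[OF \<delta>(1)] by (intro mult_left_mono) auto
        qed
        finally have 1: "(\<integral>x. cutoff \<delta> (Q x) * divergence \<phi> x \<partial>lborel) \<le> (\<integral>x. h x \<partial>lborel)" .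
        \<comment> \<open>the gradient length of the radial cutoff, as a weight to be averaged\<close>
        define k where "k r = ennreal (- 2 * cutoff' \<delta> (r\<^sup>2) * r)" for r
        have k_borel: "k \<in> borel_measurable borel"
        proof -
          have "continuous_on UNIV (\<lambda>r. - 2 * cutoff' \<delta> (r\<^sup>2) * r)"
            by (intro continuous_intros continuous_on_compose2[OF continuous_cutoff'[OF \<delta>(1)]]) auto
          then show ?thesis unfolding k_def[abs_def]
            by (intro measurable_compose[OF _ measurable_ennreal] borel_measurable_continuous_onI)
        qed
        have kW: "(\<integral>\<^sup>+x. k (norm (x::'a)) \<partial>lborel) \<le> ennreal (?W / sqrt (1 - \<delta>))"
          unfolding k_def using nn_integral_cutoff_gradient_le[OF \<delta>, where 'a='a] by simp
        have srw: "stretched_radial_weight f e k \<epsilon>"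
          by unfold_locales (use k_borel eps kW order.strict_trans1[OF kW] in \<open>auto simp: top.not_eq_extremum\<close>)
        have hd: "ennreal (h (diag_map c x)) =
            ennreal (1 / \<rho>) * (k (norm x) * ennreal ((norm (diag_map (stretch f e \<epsilon>) x) / norm x) powr 1))" for x
        proof (cases "x = 0")
          case True then show ?thesis by (simp add: h_def k_def diag_map_simps)
        next
          case False
          have q: "Q (diag_map c x) = (norm x)\<^sup>2"
            unfolding Q_def diag_map_compose by (subst diag_map_one) (auto simp: dc)
          have "(d b)\<^sup>2 * c b = 1 / \<rho> * stretch f e \<epsilon> b" for b
          proof -
            have "(d b)\<^sup>2 * c b = d b" using dc[of b] by (simp add: power2_eq_square)
            also have "\<dots> = 1 / \<rho> * (1 / stretch e f \<epsilon> b)" by (simp add: d_def c_def)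
            finally show ?thesis by (simp only: inverse_stretch[OF eps(1)])
          qed
          then have "diag_map (\<lambda>b. (d b)\<^sup>2) (diag_map c x) = (1 / \<rho>) *\<^sub>R diag_map (stretch f e \<epsilon>) x"
            unfolding diag_map_compose by (simp add: diag_map_def scaleR_sum_right mult.assoc)
          then have "norm (diag_map (\<lambda>b. (d b)\<^sup>2) (diag_map c x)) = 1 / \<rho> * norm (diag_map (stretch f e \<epsilon>) x)"
            using \<rho> by simp
          then have "h (diag_map c x) = 1 / \<rho> * ((- 2 * cutoff' \<delta> ((norm x)\<^sup>2) * norm x) *
              (norm (diag_map (stretch f e \<epsilon>) x) / norm x))"
            using False by (simp add: h_def q)
          moreover have "- 2 * cutoff' \<delta> ((norm x)\<^sup>2) * norm x \<ge> 0"
            using cutoff_props(5)[OF \<delta>(1)] by (simp add: mult_nonpos_nonneg)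
          ultimately show ?thesis
            using \<rho> by (simp only: k_def ennreal_mult' powr_one norm_ge_zero divide_nonneg_nonneg zero_le_one less_imp_le)
        qed
        have "ennreal (\<integral>x. h x \<partial>lborel) = (\<integral>\<^sup>+x. ennreal (h x) \<partial>lborel)"
          using h0 by (intro nn_integral_eq_integral[symmetric] hi) auto
        also have "\<dots> = ennreal (\<rho> ^ ?N) * (\<integral>\<^sup>+x. ennreal (h (diag_map c x)) \<partial>lborel)"
          unfolding P[symmetric] using hi c0 by (intro nn_integral_diag_map) (auto dest!: borel_measurable_integrable)
        also have "(\<integral>\<^sup>+x. ennreal (h (diag_map c x)) \<partial>lborel) = ennreal (1 / \<rho>) *
            (\<integral>\<^sup>+x. k (norm x) * ennreal ((norm (diag_map (stretch f e \<epsilon>) x) / norm x) powr 1) \<partial>lborel)"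
          unfolding hd by (rule nn_integral_cmult) (use k_borel in measurable)
        also have "ennreal (\<rho> ^ ?N) * \<dots> \<le> ennreal (\<rho> ^ ?N) * (ennreal (1 / \<rho>) * (ennreal (1 + M * \<epsilon>\<^sup>2) * ennreal (?W / sqrt (1 - \<delta>))))"
          by (intro mult_left_mono order_trans[OF M(2)[OF srw]] kW) auto
        also have "\<dots> = ennreal (\<rho> ^ ?N * (1 / \<rho> * ((1 + M * \<epsilon>\<^sup>2) * (?W / sqrt (1 - \<delta>)))))"
          using \<rho> M(1) \<delta> by (simp only: ennreal_mult' zero_le_power less_imp_le divide_nonneg_nonneg add_nonneg_nonneg mult_nonneg_nonneg zero_le_one zero_le_power2)
        also have "\<rho> ^ ?N * (1 / \<rho> * ((1 + M * \<epsilon>\<^sup>2) * (?W / sqrt (1 - \<delta>)))) = B / sqrt (1 - \<delta>)"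
        proof -
          have "\<rho> ^ ?N = \<rho> ^ (?N - 1) * \<rho>" by (metis DIM_positive Suc_diff_1 power_Suc2)
          then show ?thesis using \<rho> by (simp add: B_def)
        qed
        finally have "(\<integral>x. h x \<partial>lborel) \<le> B / sqrt (1 - \<delta>)"
          using B0 \<delta> by (subst (asm) ennreal_le_iff) auto
        with 1 show ?thesis by linarith
      qed
      \<comment> \<open>starting at 1/2, since the cutoff estimate requires \<open>\<delta> < 1\<close>\<close>
      define \<delta> where "\<delta> n = 1 / real (Suc (Suc n))" for n
      have \<delta>01: "0 < \<delta> n" "\<delta> n < 1" for n by (auto simp: \<delta>_def)
      have \<delta>lim: "\<delta> \<longlonglongrightarrow> 0"
        unfolding \<delta>_def using LIMSEQ_Suc[OF LIMSEQ_inverse_real_of_nat] by (simp add: inverse_eq_divide)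
      have "(\<lambda>n. \<integral>x. cutoff (\<delta> n) (Q x) * divergence \<phi> x \<partial>lborel) \<longlonglongrightarrow> (\<integral>x. indicator E x * divergence \<phi> x \<partial>lborel)"
      proof (rule integral_dominated_convergence[where w="\<lambda>x. indicator (cball 0 R) x *\<^sub>R \<bar>divergence \<phi> x\<bar>"])
        have [measurable]: "divergence \<phi> \<in> borel_measurable borel" by (rule borel_measurable_continuous_onI[OF dvc])
        show "(\<lambda>x. indicator E x * divergence \<phi> x) \<in> borel_measurable lborel" using Eb by measurable
        show "(\<lambda>x. cutoff (\<delta> n) (Q x) * divergence \<phi> x) \<in> borel_measurable lborel" for n
        proof -
          have "continuous_on UNIV (cutoff (\<delta> n))"
            using cutoff_deriv[OF \<delta>01(1)] by (intro continuous_at_imp_continuous_on ballI DERIV_isCont)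
          then have "continuous_on UNIV (\<lambda>x. cutoff (\<delta> n) (Q x))" by (rule continuous_on_compose2[OF _ cQ]) auto
          then have "continuous_on UNIV (\<lambda>x. cutoff (\<delta> n) (Q x) * divergence \<phi> x)" by (intro continuous_on_mult dvc)
          then show ?thesis by (simp add: borel_measurable_continuous_onI)
        qed
        show "integrable lborel (\<lambda>x. indicator (cball 0 R) x *\<^sub>R \<bar>divergence \<phi> x\<bar>)"
          by (intro borel_integrable_compact continuous_on_subset[OF continuous_on_rabs[OF dvc]]) auto
        show "AE x in lborel. norm (cutoff (\<delta> n) (Q x) * divergence \<phi> x) \<le> indicator (cball 0 R) x *\<^sub>R \<bar>divergence \<phi> x\<bar>" for n
        proof (rule AE_I2)
          fix x
          show "norm (cutoff (\<delta> n) (Q x) * divergence \<phi> x) \<le> indicator (cball 0 R) x *\<^sub>R \<bar>divergence \<phi> x\<bar>"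
          proof (cases "norm x \<le> R")
            case True
            then show ?thesis using cutoff_props(1,2)[OF \<delta>01(1)] by (simp add: abs_mult mult_left_le_one_le)
          next
            case False
            then show ?thesis using QR[of x] cutoff_props(4)[OF \<delta>01(1)] by simp
          qed
        qed
        show "AE x in lborel. (\<lambda>n. cutoff (\<delta> n) (Q x) * divergence \<phi> x) \<longlonglongrightarrow> indicator E x * divergence \<phi> x"
        proof (rule AE_I2)
          fix x
          have "(\<lambda>n. cutoff (\<delta> n) (Q x)) \<longlonglongrightarrow> indicator E x"
          proof (cases "Q x < 1")
            case True
            then have "\<forall>\<^sub>F n in sequentially. \<delta> n < 1 - Q x" by (intro order_tendstoD(2)[OF \<delta>lim]) simp
            then have "\<forall>\<^sub>F n in sequentially. cutoff (\<delta> n) (Q x) = indicator E x"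
              by eventually_elim (use True cutoff_props(3)[OF \<delta>01(1)] in \<open>simp add: E\<close>)
            then show ?thesis by (rule tendsto_eventually)
          next
            case False
            then show ?thesis using cutoff_props(4)[OF \<delta>01(1)] by (simp add: E)
          qed
          then show "(\<lambda>n. cutoff (\<delta> n) (Q x) * divergence \<phi> x) \<longlonglongrightarrow> indicator E x * divergence \<phi> x"
            by (intro tendsto_mult tendsto_const)
        qed
      qed
      moreover have "(\<lambda>n. B / sqrt (1 - \<delta> n)) \<longlonglongrightarrow> B / sqrt (1 - 0)"
        by (intro tendsto_intros \<delta>lim) auto
      ultimately have "(\<integral>x. indicator E x * divergence \<phi> x \<partial>lborel) \<le> B / sqrt (1 - 0)"
        using le[OF \<delta>01] by (intro LIMSEQ_le) auto
      then show "ereal (set_lebesgue_integral lebesgue E (divergence \<phi>)) \<le> ereal B"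
        using set_lebesgue_integral_eq_lborel[OF Eb borel_measurable_continuous_onI[OF dvc]] by simp
    qed
  qed
qed

text \<open>
The field \<open>x / \<rho>\<close> has the right flux, but is only admissible inside the ball. Continuing it by a
\<open>C\<^sup>1\<close> transition to 0 in the shell up to radius \<open>\<rho> * sqrt (1 + \<delta>)\<close> makes its norm exceed 1 by a
factor of at most \<open>sqrt (1 + \<delta>)\<close>, by which it is divided.
\<close>

lemma perimeter_ball_lower:
  assumes \<rho>: "\<rho> > 0"
  shows "ereal (\<rho> ^ (DIM('a) - 1) * (DIM('a) * unit_ball_vol DIM('a))) \<le> perimeter (ball (0::'a::euclidean_space) \<rho>)"
proof -
  let ?N = "DIM('a)"
  let ?W = "real ?N * unit_ball_vol ?N"
  let ?B = "ball (0::'a) \<rho>"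
  have le: "ereal (\<rho> ^ (?N - 1) * ?W / sqrt (1 + \<delta>)) \<le> perimeter ?B" if \<delta>: "\<delta> > 0" for \<delta>
  proof -
    define \<kappa> where "\<kappa> = 1 / (\<rho> * sqrt (1 + \<delta>))"
    have \<kappa>0: "\<kappa> > 0" using \<rho> \<delta> by (simp add: \<kappa>_def)
    define a where "a u = step ((u / \<rho>\<^sup>2 - 1) / \<delta>) * \<kappa>" for u
    define a' where "a' u = step' ((u / \<rho>\<^sup>2 - 1) / \<delta>) * (1 / \<rho>\<^sup>2 / \<delta>) * \<kappa>" for u
    have da: "(a has_real_derivative a' u) (at u)" for u
    proof -
      have "((\<lambda>u. (u / \<rho>\<^sup>2 - 1) / \<delta>) has_real_derivative (1 / \<rho>\<^sup>2 - 0) / \<delta>) (at u)"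
        by (intro DERIV_cdivide DERIV_diff DERIV_ident DERIV_const)
      then have "((\<lambda>u. (u / \<rho>\<^sup>2 - 1) / \<delta>) has_real_derivative 1 / \<rho>\<^sup>2 / \<delta>) (at u)"
        by (simp only: diff_zero)
      from DERIV_cmult_right[OF DERIV_chain2[OF step_deriv this], of \<kappa>]
      show ?thesis by (simp add: a_def[abs_def] a'_def)
    qed
    have ca: "continuous_on UNIV a" using da by (intro continuous_at_imp_continuous_on ballI DERIV_isCont)
    have ca': "continuous_on UNIV a'" unfolding a'_def[abs_def] using \<delta> \<rho>
      by (intro continuous_intros continuous_on_compose2[OF continuous_step']) auto
    define \<phi> :: "'a \<Rightarrow> 'a" where "\<phi> x = a (x \<bullet> x) *\<^sub>R x" for x
    define F :: "'a \<Rightarrow> 'a \<Rightarrow> 'a" where "F x v = a (x \<bullet> x) *\<^sub>R v + (a' (x \<bullet> x) * (x \<bullet> v + v \<bullet> x)) *\<^sub>R x" for x v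
    have dF: "(\<phi> has_derivative F x) (at x)" for x
    proof -
      have "((\<lambda>x. x \<bullet> x) has_derivative (\<lambda>v. x \<bullet> v + v \<bullet> x)) (at x)"
        by (rule has_derivative_inner[OF has_derivative_ident has_derivative_ident])
      from has_derivative_compose[OF this da[unfolded has_field_derivative_def]]
      have "((\<lambda>x. a (x \<bullet> x)) has_derivative (\<lambda>v. a' (x \<bullet> x) * (x \<bullet> v + v \<bullet> x))) (at x)" .
      from has_derivative_scaleR[OF this has_derivative_ident]
      show ?thesis by (simp add: \<phi>_def[abs_def] F_def[abs_def])
    qed
    have cF: "continuous_on UNIV (\<lambda>x. F x v)" for v
      unfolding F_def by (intro continuous_intros continuous_on_compose2[OF ca] continuous_on_compose2[OF ca']) auto
    have bl: "bounded_linear (F x)" for x using dF by (rule has_derivative_bounded_linear)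
    have C1: "C1_field \<phi>"
      unfolding C1_field_def
    proof (intro exI[of _ "\<lambda>x. Blinfun (F x)"] conjI allI)
      show "(\<phi> has_derivative blinfun_apply (Blinfun (F x))) (at x)" for x
        by (simp add: bounded_linear_Blinfun_apply[OF bl] dF)
      show "continuous_on UNIV (\<lambda>x. Blinfun (F x))"
        by (rule continuous_on_blinfun_componentwise) (simp add: bounded_linear_Blinfun_apply[OF bl] cF)
    qed
    have \<phi>0: "\<phi> x = 0" if "norm x > \<rho> * sqrt (1 + \<delta>)" for x
    proof -
      have "(\<rho> * sqrt (1 + \<delta>))\<^sup>2 \<le> (norm x)\<^sup>2" using that \<rho> \<delta> by (intro power_mono) auto
      then have "\<rho>\<^sup>2 * (1 + \<delta>) \<le> x \<bullet> x" using \<delta> by (simp add: power_mult_distrib dot_square_norm)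
      then have "(x \<bullet> x / \<rho>\<^sup>2 - 1) / \<delta> \<ge> 1" using \<rho> \<delta> by (simp add: field_simps)
      then show ?thesis by (simp add: \<phi>_def a_def step_props)
    qed
    have "{x. \<phi> x \<noteq> 0} \<subseteq> cball 0 (\<rho> * sqrt (1 + \<delta>))" using \<phi>0 by (auto simp: not_less[symmetric])
    then have cpt: "compact (closure {x. \<phi> x \<noteq> 0})"
      by (meson bounded_cball bounded_subset compact_closure)
    have n1: "norm (\<phi> x) \<le> 1" for x
    proof (cases "norm x > \<rho> * sqrt (1 + \<delta>)")
      case True then show ?thesis using \<phi>0 by simp
    next
      case False
      have "norm (\<phi> x) = step ((x \<bullet> x / \<rho>\<^sup>2 - 1) / \<delta>) * (\<kappa> * norm x)"
        using \<kappa>0 step_props(1) by (simp add: \<phi>_def a_def abs_mult)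
      also have "\<dots> \<le> 1 * 1"
        using False \<rho> \<delta> \<kappa>0 by (intro mult_mono step_props) (auto simp: \<kappa>_def field_simps)
      finally show ?thesis by simp
    qed
    have dv: "divergence \<phi> x = (\<Sum>b\<in>Basis. F x b \<bullet> b)" for x
      unfolding divergence_def using frechet_derivative_at[OF dF[of x]] by simp
    have dvc: "divergence \<phi> \<in> borel_measurable borel"
      unfolding dv[abs_def] by (intro borel_measurable_continuous_onI continuous_intros cF)
    have dvB: "divergence \<phi> x = real ?N * \<kappa>" if "x \<in> ?B" for x
    proof -
      have "(norm x)\<^sup>2 \<le> \<rho>\<^sup>2" using that by (intro power_mono) auto
      then have "(x \<bullet> x / \<rho>\<^sup>2 - 1) / \<delta> \<le> 0" using \<rho> \<delta> by (simp add: field_simps dot_square_norm divide_nonpos_pos)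
      then have "a (x \<bullet> x) = \<kappa>" "a' (x \<bullet> x) = 0" by (simp_all add: a_def a'_def step_props)
      then show ?thesis by (simp add: dv F_def)
    qed
    have "set_lebesgue_integral lebesgue ?B (divergence \<phi>) = (\<integral>x. indicator ?B x * divergence \<phi> x \<partial>lborel)"
      using dvc by (intro set_lebesgue_integral_eq_lborel) auto
    also have "\<dots> = (\<integral>x. indicator ?B x * (real ?N * \<kappa>) \<partial>lborel)"
      by (intro Bochner_Integration.integral_cong) (auto simp: dvB indicator_def)
    also have "\<dots> = measure lborel ?B * (real ?N * \<kappa>)" by simp
    also have "\<dots> = unit_ball_vol ?N * \<rho> ^ ?N * (real ?N * \<kappa>)"
      using \<rho> content_ball[of \<rho> "0::'a"] by simp
    also have "\<dots> = \<rho> ^ (?N - 1) * ?W / sqrt (1 + \<delta>)"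
    proof -
      have "\<rho> ^ ?N = \<rho> ^ (?N - 1) * \<rho>" by (metis DIM_positive Suc_diff_1 power_Suc2)
      then show ?thesis using \<rho> by (simp add: \<kappa>_def)
    qed
    finally show ?thesis
      unfolding perimeter_def using C1 cpt n1 by (intro SUP_upper2[of \<phi>]) auto
  qed
  define \<delta> where "\<delta> n = 1 / real (Suc n)" for n
  have \<delta>lim: "\<delta> \<longlonglongrightarrow> 0"
    unfolding \<delta>_def using LIMSEQ_inverse_real_of_nat by (simp add: inverse_eq_divide)
  have "(\<lambda>n. \<rho> ^ (?N - 1) * ?W / sqrt (1 + \<delta> n)) \<longlonglongrightarrow> \<rho> ^ (?N - 1) * ?W / sqrt (1 + 0)"
    by (intro tendsto_intros \<delta>lim) auto
  then have "(\<lambda>n. ereal (\<rho> ^ (?N - 1) * ?W / sqrt (1 + \<delta> n))) \<longlonglongrightarrow> ereal (\<rho> ^ (?N - 1) * ?W / sqrt (1 + 0))"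
    by (rule tendsto_ereal)
  then show ?thesis
    using le by (auto intro!: LIMSEQ_le_const2 simp: \<delta>_def)
qed

section \<open>Ellipsoids as normal graphs over the sphere\<close>

text \<open>
Differentiating along the great circle through \<open>x\<close> in the direction of the difference of two
tangential gradients shows that this difference vanishes.
\<close>

lemma sphere_gradient_unique:
  fixes u :: "'a::euclidean_space \<Rightarrow> real"
  assumes x: "norm x = 1" and g: "has_sphere_gradient u x g" and h: "has_sphere_gradient u x h"
  shows "g = h"
proof (rule ccontr)
  assume "g \<noteq> h"
  define e where "e = (g - h) /\<^sub>R norm (g - h)"
  have e1: "norm e = 1" using \<open>g \<noteq> h\<close> by (simp add: e_def)
  have gx: "g \<bullet> x = 0" "h \<bullet> x = 0" using g h by (auto simp: has_sphere_gradient_def)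
  then have ex: "e \<bullet> x = 0" by (simp add: e_def inner_diff_left)
  define \<gamma> where "\<gamma> \<tau> = cos \<tau> *\<^sub>R x + sin \<tau> *\<^sub>R e" for \<tau>
  have xx: "x \<bullet> x = 1" "e \<bullet> e = 1" using x e1 by (simp_all add: dot_square_norm)
  have \<gamma>S: "\<gamma> ` UNIV \<subseteq> sphere 0 1"
  proof -
    have "\<gamma> \<tau> \<bullet> \<gamma> \<tau> = 1" for \<tau>
      using ex xx sin_cos_squared_add2[of \<tau>] by (simp add: \<gamma>_def inner_simps inner_commute power2_eq_square)
    then show ?thesis by (auto simp: norm_eq_1)
  qed
  have \<gamma>0: "\<gamma> 0 = x" by (simp add: \<gamma>_def)
  have d\<gamma>: "(\<gamma> has_derivative (\<lambda>\<tau>. \<tau> *\<^sub>R e)) (at 0)"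
    unfolding \<gamma>_def[abs_def] by (auto intro!: derivative_eq_intros)
  have "((\<lambda>\<tau>. u (\<gamma> \<tau>)) has_derivative (\<lambda>\<tau>. k \<bullet> (\<tau> *\<^sub>R e))) (at 0)" if "has_sphere_gradient u x k" for k
  proof -
    have "(u has_derivative (\<lambda>v. k \<bullet> v)) (at (\<gamma> 0) within \<gamma> ` UNIV)"
      using that \<gamma>S unfolding \<gamma>0 has_sphere_gradient_def by (auto intro: has_derivative_subset)
    from has_derivative_in_compose[OF d\<gamma> this] show ?thesis .
  qed
  from has_derivative_unique[OF this[OF g] this[OF h]]
  have "g \<bullet> (1 *\<^sub>R e) = h \<bullet> (1 *\<^sub>R e)" by meson
  then have "(g - h) \<bullet> e = 0" by (simp add: inner_diff_left)
  then have "(g - h) \<bullet> (g - h) = 0" using \<open>g \<noteq> h\<close> by (simp add: e_def)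
  then show False using \<open>g \<noteq> h\<close> by simp
qed

text \<open>
The ellipsoid \<open>norm (diag_map c x) = 1\<close> is the graph over the sphere of this function. It is defined
as a function homogeneous of degree 0 on the whole space, so that its ordinary gradient at points
of the sphere is already tangential.
\<close>

definition radial_height :: "('a::euclidean_space \<Rightarrow> real) \<Rightarrow> 'a \<Rightarrow> real" where
  "radial_height c x = norm x / norm (diag_map c x) - 1"

definition radial_height_grad :: "('a::euclidean_space \<Rightarrow> real) \<Rightarrow> 'a \<Rightarrow> 'a" where
  "radial_height_grad c x =
     ((norm (diag_map c x))\<^sup>2 *\<^sub>R x - diag_map (\<lambda>b. (c b)\<^sup>2) x) /\<^sub>R (norm (diag_map c x)) ^ 3"

lemma radial_height_gradient:
  fixes x :: "'a::euclidean_space"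
  assumes c: "\<And>b. b \<in> Basis \<Longrightarrow> c b > 0" and x: "norm x = 1"
  shows "has_sphere_gradient (radial_height c) x (radial_height_grad c x)"
proof -
  define q where "q = norm (diag_map c x)"
  have x0: "x \<noteq> 0" using x by auto
  have q: "q > 0" unfolding q_def by (rule norm_diag_map_pos[OF c x0])
  then have A0: "diag_map c x \<noteq> 0" by (auto simp: q_def)
  have xx: "x \<bullet> x = 1" using x by (simp add: dot_square_norm)
  have qq: "diag_map (\<lambda>b. (c b)\<^sup>2) x \<bullet> x = q\<^sup>2"
    by (simp add: q_def power2_norm_eq_inner diag_map_inner_diag_map)
  have tang: "radial_height_grad c x \<bullet> x = 0"
    unfolding radial_height_grad_def q_def[symmetric] by (simp add: inner_diff_left qq xx)
  have dn: "(norm has_derivative (\<lambda>h. h \<bullet> sgn y)) (at y)" if "y \<noteq> 0" for y :: 'a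
    by (rule has_derivative_norm[OF that])
  have dA: "((\<lambda>y. norm (diag_map c y)) has_derivative (\<lambda>h. diag_map c h \<bullet> sgn (diag_map c x))) (at x)"
    by (rule has_derivative_compose[OF bounded_linear_imp_has_derivative[OF bounded_linear_diag_map] dn[OF A0]])
  have qn: "norm (diag_map c x) \<noteq> 0" using A0 by simp
  have "((\<lambda>y. norm y / norm (diag_map c y) - 1) has_derivative
      (\<lambda>h. ((h \<bullet> sgn x) * norm (diag_map c x) - norm x * (diag_map c h \<bullet> sgn (diag_map c x)))
            / (norm (diag_map c x) * norm (diag_map c x)) - 0)) (at x)"
    by (intro has_derivative_diff has_derivative_divide'[OF dn[OF x0] dA qn] has_derivative_const)
  moreover have "((h \<bullet> sgn x) * norm (diag_map c x) - norm x * (diag_map c h \<bullet> sgn (diag_map c x)))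
            / (norm (diag_map c x) * norm (diag_map c x)) - 0 = radial_height_grad c x \<bullet> h" for h
  proof -
    have 1: "h \<bullet> sgn x = x \<bullet> h" using x by (simp add: sgn_div_norm inner_commute)
    have "diag_map c h \<bullet> sgn (diag_map c x) = (diag_map c x \<bullet> diag_map c h) / q"
      by (simp add: sgn_div_norm q_def inner_commute divide_inverse mult.commute)
    then have 2: "diag_map c h \<bullet> sgn (diag_map c x) = (diag_map (\<lambda>b. (c b)\<^sup>2) x \<bullet> h) / q"
      by (simp only: diag_map_inner_diag_map)
    show ?thesis
      unfolding 1 2 x radial_height_grad_def q_def[symmetric]
      using q by (simp add: inner_diff_left field_simps power2_eq_square power3_eq_cube)
  qed
  ultimately have "(radial_height c has_derivative (\<lambda>h. radial_height_grad c x \<bullet> h)) (at x)"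
    unfolding radial_height_def[abs_def] by (simp only:)
  then show ?thesis
    unfolding has_sphere_gradient_def using tang has_derivative_at_withinI by blast
qed

lemma sphere_gradient_radial_height:
  assumes "\<And>b. b \<in> Basis \<Longrightarrow> c b > 0" "norm x = 1"
  shows "sphere_gradient (radial_height c) x = radial_height_grad c x"
proof -
  have g: "has_sphere_gradient (radial_height c) x (radial_height_grad c x)"
    by (rule radial_height_gradient) (use assms in auto)
  show ?thesis
    unfolding sphere_gradient_def
    by (rule the_equality[where P="has_sphere_gradient (radial_height c) x", OF g]) (rule sphere_gradient_unique[OF assms(2) _ g])
qed

lemma C1_sphere_radial_height:
  fixes c :: "'a::euclidean_space \<Rightarrow> real"
  assumes c: "\<And>b. b \<in> Basis \<Longrightarrow> c b > 0"
  shows "C1_sphere (radial_height c)"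
proof -
  have cA: "continuous_on S (diag_map c)" for c :: "'a \<Rightarrow> real" and S
    by (rule linear_continuous_on[OF bounded_linear_diag_map])
  have "norm (diag_map c x) \<noteq> 0" if "x \<in> sphere 0 1" for x
    using norm_diag_map_pos[OF c, where x=x] that by force
  then have "continuous_on (sphere 0 1) (radial_height_grad c)"
    unfolding radial_height_grad_def by (intro continuous_intros cA) auto
  then have "continuous_on (sphere 0 1) (sphere_gradient (radial_height c))"
    by (rule continuous_on_eq) (simp add: sphere_gradient_radial_height[OF c])
  moreover have "\<exists>g. has_sphere_gradient (radial_height c) x g" if "x \<in> sphere 0 1" for x
    by (rule exI, rule radial_height_gradient) (use c that in auto)
  ultimately show ?thesis unfolding C1_sphere_def by blast
qed

context stretch_dirs
begin

text \<open>
Let \<open>A\<close> be the stretch and \<open>q = norm (A x)\<close>. At a unit vector \<open>x\<close> the height is \<open>(1 - q) / q\<close> and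
its gradient is \<open>(q^2 * x - A (A x)) / q^3\<close>. Here \<open>q \<ge> 1/2\<close>, while \<open>q\<close> and the coefficients of \<open>A^2\<close>
deviate from 1 by at most \<open>\<epsilon>\<close>.
\<close>

lemma C1_norm_radial_height_stretch:
  assumes eps: "0 < \<epsilon>" "\<epsilon> \<le> 1"
  shows "C1_norm_sphere (radial_height (stretch e f \<epsilon>)) \<le> 34 * \<epsilon>"
proof -
  let ?c = "stretch e f \<epsilon>"
  have ne: "sphere (0::'a) 1 \<noteq> {}" using e by (auto intro!: exI[of _ e])
  have u: "\<bar>radial_height ?c x\<bar> \<le> 2 * \<epsilon>" and g: "norm (sphere_gradient (radial_height ?c) x) \<le> 32 * \<epsilon>"
    if "x \<in> sphere 0 1" for x
  proof -
    have x: "norm x = 1" "x \<noteq> 0" using that by auto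
    define q where "q = norm (diag_map ?c x)"
    have q: "1 / 2 \<le> q" "q \<le> 2" "\<bar>q - 1\<bar> \<le> \<epsilon>"
      using norm_stretch_bounds[OF eps x(2)] x by (simp_all add: q_def)
    have "radial_height ?c x = (1 - q) / q" using q x by (simp add: radial_height_def q_def[symmetric] field_simps)
    then have "\<bar>radial_height ?c x\<bar> = \<bar>q - 1\<bar> * (1 / q)" using q by (simp add: abs_minus_commute)
    also have "\<dots> \<le> \<epsilon> * 2" using q by (intro mult_mono) (auto simp: field_simps)
    finally show "\<bar>radial_height ?c x\<bar> \<le> 2 * \<epsilon>" by simp
    have d1: "\<bar>1 - (?c b)\<^sup>2\<bar> \<le> \<epsilon>" for b
      using eps by (auto simp: stretch_def power_divide field_simps)
    have "(norm (diag_map (\<lambda>b. 1 - (?c b)\<^sup>2) x))\<^sup>2 \<le> (\<Sum>b\<in>Basis. \<epsilon>\<^sup>2 * (x \<bullet> b)\<^sup>2)"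
      unfolding norm_diag_map_sq
    proof (rule sum_mono)
      fix b :: 'a
      have "(1 - (?c b)\<^sup>2)\<^sup>2 \<le> \<epsilon>\<^sup>2" using d1[of b] eps by (simp add: abs_le_square_iff[symmetric])
      then show "(1 - (?c b)\<^sup>2)\<^sup>2 * (x \<bullet> b)\<^sup>2 \<le> \<epsilon>\<^sup>2 * (x \<bullet> b)\<^sup>2" by (rule mult_right_mono) simp
    qed
    also have "\<dots> = \<epsilon>\<^sup>2 * (norm x)\<^sup>2"
      using norm_diag_map_sq[of "\<lambda>_. 1" x] by (simp add: diag_map_one sum_distrib_left)
    finally have d2: "norm (diag_map (\<lambda>b. 1 - (?c b)\<^sup>2) x) \<le> \<epsilon>"
      using x eps by (auto intro: power2_le_imp_le)
    have "diag_map (\<lambda>b. 1 - (?c b)\<^sup>2) x = x - diag_map (\<lambda>b. (?c b)\<^sup>2) x"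
      by (rule euclidean_eqI) (simp add: diag_map_inner inner_diff_left algebra_simps)
    then have d3: "norm (x - diag_map (\<lambda>b. (?c b)\<^sup>2) x) \<le> \<epsilon>" using d2 by simp
    have q2: "\<bar>q\<^sup>2 - 1\<bar> \<le> 3 * \<epsilon>"
    proof -
      have "\<bar>q\<^sup>2 - 1\<bar> = (q + 1) * \<bar>q - 1\<bar>"
      proof -
        have "q\<^sup>2 - 1 = (q + 1) * (q - 1)" by (simp add: power2_eq_square algebra_simps)
        then show ?thesis using q by (simp add: abs_mult)
      qed
      also have "\<dots> \<le> 3 * \<epsilon>" using q by (intro mult_mono) auto
      finally show ?thesis .
    qed
    have "norm (q\<^sup>2 *\<^sub>R x - diag_map (\<lambda>b. (?c b)\<^sup>2) x) = norm ((q\<^sup>2 - 1) *\<^sub>R x + (x - diag_map (\<lambda>b. (?c b)\<^sup>2) x))"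
      by (simp add: algebra_simps)
    also have "\<dots> \<le> \<bar>q\<^sup>2 - 1\<bar> * norm x + norm (x - diag_map (\<lambda>b. (?c b)\<^sup>2) x)"
      by (rule order_trans[OF norm_triangle_ineq]) simp
    also have "\<dots> \<le> 4 * \<epsilon>" using q2 d3 x by simp
    finally have n: "norm (q\<^sup>2 *\<^sub>R x - diag_map (\<lambda>b. (?c b)\<^sup>2) x) \<le> 4 * \<epsilon>" .
    have "(1/2) ^ 3 \<le> q ^ 3" using q by (intro power_mono) auto
    then have q3: "1 / q ^ 3 \<le> 8" using q by (simp add: field_simps power3_eq_cube)
    have "norm (radial_height_grad ?c x) = 1 / q ^ 3 * norm (q\<^sup>2 *\<^sub>R x - diag_map (\<lambda>b. (?c b)\<^sup>2) x)"
    proof -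
      have "\<bar>inverse (q ^ 3)\<bar> = 1 / q ^ 3" using q by (simp add: inverse_eq_divide)
      then show ?thesis unfolding radial_height_grad_def q_def[symmetric] norm_scaleR by (simp only:)
    qed
    also have "\<dots> \<le> 8 * (4 * \<epsilon>)" using q3 n by (intro mult_mono) auto
    finally show "norm (sphere_gradient (radial_height ?c) x) \<le> 32 * \<epsilon>"
      by (subst sphere_gradient_radial_height) (auto simp: x stretch_pos[OF eps(1)])
  qed
  have "(SUP x\<in>sphere 0 1. \<bar>radial_height ?c x\<bar>) \<le> 2 * \<epsilon>" by (rule cSUP_least[OF ne u])
  moreover have "(SUP x\<in>sphere 0 1. norm (sphere_gradient (radial_height ?c) x)) \<le> 32 * \<epsilon>"
    by (rule cSUP_least[OF ne g])
  ultimately show ?thesis unfolding C1_norm_sphere_def by simp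
qed

end

lemma frontier_diag_map_ball:
  fixes c :: "'a::euclidean_space \<Rightarrow> real"
  assumes c: "\<And>b. b \<in> Basis \<Longrightarrow> c b > 0"
  shows "frontier (diag_map c ` ball 0 1) =
    (\<lambda>x. (1 + radial_height (\<lambda>b. 1 / c b) x) *\<^sub>R x) ` sphere 0 1"
proof -
  let ?d = "\<lambda>b. 1 / c b"
  have cd: "diag_map c (diag_map ?d x) = x" and dc: "diag_map ?d (diag_map c x) = x" for x
    unfolding diag_map_compose using c by (intro diag_map_one; force dest: c)+
  have lin: "linear (diag_map c)" using bounded_linear_diag_map by (rule bounded_linear.linear)
  have inj: "inj (diag_map c)" by (rule inj_on_inverseI[of _ "diag_map ?d"]) (rule dc)
  have "frontier (diag_map c ` ball 0 1) = diag_map c ` sphere 0 1"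
    unfolding frontier_def closure_injective_linear_image[OF lin inj, symmetric]
      interior_injective_linear_image[OF lin inj]
    by (simp add: image_set_diff[OF inj, symmetric]) (metis cball_diff_eq_sphere)
  also have "\<dots> = (\<lambda>x. (1 + radial_height ?d x) *\<^sub>R x) ` sphere 0 1"
  proof -
    have eq: "(1 + radial_height ?d x) *\<^sub>R x = diag_map c ((1 / norm (diag_map ?d x)) *\<^sub>R diag_map ?d x)"
      if "x \<in> sphere 0 1" for x
      using that by (simp add: radial_height_def diag_map_simps cd)
    have S: "(1 / norm (diag_map ?d x)) *\<^sub>R diag_map ?d x \<in> sphere 0 1" if "x \<in> sphere 0 1" for x
      using norm_diag_map_pos[of ?d x] c that by force
    have surj: "diag_map c z \<in> (\<lambda>x. (1 + radial_height ?d x) *\<^sub>R x) ` sphere 0 1" if z: "z \<in> sphere 0 1" for z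
    proof -
      have Az: "norm (diag_map c z) > 0" using norm_diag_map_pos[OF c, where x=z] z by force
      define x where "x = diag_map c z /\<^sub>R norm (diag_map c z)"
      have xS: "x \<in> sphere 0 1" using Az by (simp add: x_def)
      have "diag_map ?d x = z /\<^sub>R norm (diag_map c z)" by (simp add: x_def diag_map_simps dc)
      then have "diag_map c z = (1 + radial_height ?d x) *\<^sub>R x"
        using z Az by (simp add: radial_height_def) (simp add: x_def)
      then show ?thesis using xS by (rule image_eqI)
    qed
    show ?thesis
    proof (intro antisym image_subsetI)
      show "(1 + radial_height ?d x) *\<^sub>R x \<in> diag_map c ` sphere 0 1" if "x \<in> sphere 0 1" for x
        unfolding eq[OF that] by (rule imageI[OF S[OF that]])
    qed (rule surj)
  qed
  finally show ?thesis .
qed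

lemma has_volume_stretched_ball:
  fixes e f :: "'a::euclidean_space"
  assumes d: "stretch_dirs e f" and eps: "0 < \<epsilon>" and m: "m > 0"
  shows "has_volume (stretched_ball e f \<epsilon> (vol_radius TYPE('a) m)) m"
proof -
  interpret stretch_dirs e f by fact
  define \<rho> where "\<rho> = vol_radius TYPE('a) m"
  have w: "measure lebesgue (ball (0::'a) 1) > 0" by (simp add: content_ball)
  have \<rho>: "\<rho> > 0" using m w by (simp add: \<rho>_def vol_radius_def)
  define c where "c b = \<rho> * stretch e f \<epsilon> b" for b
  have c: "c b > 0" for b by (simp add: c_def \<rho> stretch_pos[OF eps])
  have P: "(\<Prod>b\<in>Basis. c b) = \<rho> ^ DIM('a)" by (simp add: c_def prod.distrib stretch_prod[OF eps])
  have E: "stretched_ball e f \<epsilon> \<rho> = diag_map (\<lambda>b. 1 / c b) -` ball 0 1"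
    unfolding stretched_ball_def c_def[symmetric] by (subst diag_map_image_eq) (auto simp: c)
  have meas: "stretched_ball e f \<epsilon> \<rho> \<in> sets borel"
    unfolding E using linear_continuous_on[OF bounded_linear_diag_map, of UNIV "\<lambda>b. 1 / c b"]
    by (intro borel_open open_vimage) auto
  have dc: "diag_map (\<lambda>b. 1 / c b) (diag_map c x) = x" for x
    unfolding diag_map_compose using c by (intro diag_map_one) (auto simp: less_imp_neq[symmetric])
  have "emeasure lborel (stretched_ball e f \<epsilon> \<rho>) = (\<integral>\<^sup>+x. indicator (stretched_ball e f \<epsilon> \<rho>) x \<partial>lborel)"
    using meas by simp
  also have "\<dots> = ennreal (\<rho> ^ DIM('a)) * (\<integral>\<^sup>+x. indicator (stretched_ball e f \<epsilon> \<rho>) (diag_map c x) \<partial>lborel)"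
    unfolding P[symmetric] using meas c by (intro nn_integral_diag_map) auto
  also have "(\<integral>\<^sup>+x. indicator (stretched_ball e f \<epsilon> \<rho>) (diag_map c x) \<partial>lborel) = (\<integral>\<^sup>+x. indicator (ball (0::'a) 1) x \<partial>lborel)"
    unfolding E by (intro nn_integral_cong) (simp add: indicator_def dc)
  also have "\<dots> = ennreal (unit_ball_vol DIM('a))" by (simp add: emeasure_ball)
  also have "ennreal (\<rho> ^ DIM('a)) * \<dots> = emeasure lborel (ball (0::'a) \<rho>)"
    using \<rho> by (simp add: emeasure_ball ennreal_mult[symmetric] mult.commute)
  also have "\<dots> = ennreal m"
    using has_volume_vol_ball[OF m, where 'a='a] by (simp add: has_volume_def vol_ball_def \<rho>_def)
  finally show ?thesis
    using meas unfolding has_volume_def \<rho>_def[symmetric] by (simp add: main_part_sets)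
qed

lemma near_ball_stretched_ball:
  fixes e f :: "'a::euclidean_space"
  assumes d: "stretch_dirs e f" and eps: "0 < \<epsilon>" "\<epsilon> \<le> 1" "34 * \<epsilon> \<le> \<eta>" and \<rho>: "\<rho> > 0"
  shows "near_ball \<eta> \<rho> (stretched_ball e f \<epsilon> \<rho>)"
proof -
  interpret stretch_dirs e f by fact
  interpret inv: stretch_dirs f e using e f ef by unfold_locales auto
  let ?u = "radial_height (stretch f e \<epsilon>)"
  have scale: "stretched_ball e f \<epsilon> \<rho> = (*\<^sub>R) \<rho> ` diag_map (stretch e f \<epsilon>) ` ball 0 1"
    by (auto simp: stretched_ball_def image_image diag_map_def scaleR_sum_right mult.assoc)
  have bd: "bounded (diag_map (stretch e f \<epsilon>) ` ball 0 1)"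
    by (intro bounded_linear_image bounded_linear_diag_map) simp
  have "frontier (stretched_ball e f \<epsilon> \<rho>) = (*\<^sub>R) \<rho> ` frontier (diag_map (stretch e f \<epsilon>) ` ball 0 1)"
    unfolding scale frontier_def closure_scaleR[symmetric] using \<rho>
    by (simp add: interior_injective_linear_image linear_scaleR injective_scaleR image_set_diff[OF injective_scaleR, symmetric])
  also have "\<dots> = (\<lambda>x. (\<rho> * (1 + ?u x)) *\<^sub>R x) ` sphere 0 1"
    by (subst frontier_diag_map_ball) (simp_all add: stretch_pos[OF eps(1)] image_image inverse_stretch[OF eps(1)])
  finally have fr: "frontier (stretched_ball e f \<epsilon> \<rho>) = (\<lambda>x. (\<rho> * (1 + ?u x)) *\<^sub>R x) ` sphere 0 1" .
  have "C1_norm_sphere ?u \<le> \<eta>" using inv.C1_norm_radial_height_stretch[OF eps(1,2)] eps(3) by linarith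
  moreover have "C1_sphere ?u" by (rule C1_sphere_radial_height) (simp add: stretch_pos[OF eps(1)])
  moreover have "bounded (stretched_ball e f \<epsilon> \<rho>)" unfolding scale by (rule bounded_scaling[OF bd])
  ultimately show ?thesis unfolding near_ball_def using fr by blast
qed

section \<open>Energy comparison\<close>

text \<open>
The energy \<open>energy s t E\<close> without its subtracted term.
\<close>

definition leading_energy :: "real \<Rightarrow> 'a::euclidean_space set \<Rightarrow> ereal" where
  "leading_energy t E =
     (if t = 1 then ereal (real DIM('a) * measure lebesgue (ball (0::'a) 1)) * perimeter E
      else ereal (1 - t) * enn2ereal (frac_perimeter t E))"

text \<open>
The comparison of energies needs the ball bounded from below and the ellipsoid from above with the
same leading constant \<open>T\<close>. For \<open>t = 1\<close> this \<open>T\<close> is the square of the area of the unit sphere, the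
second factor coming from the normalization of the perimeter in the energy.
\<close>

lemma leading_energy_stretched:
  assumes "0 < t" "t \<le> 1"
  obtains T C where "C \<ge> 0"
    "\<And>\<rho>. \<rho> > 0 \<Longrightarrow> ereal (\<rho> powr (real DIM('a) - t) * T) \<le> leading_energy t (ball (0::'a::euclidean_space) \<rho>)"
    "\<And>(e::'a) f \<epsilon> \<rho>. stretch_dirs e f \<Longrightarrow> 0 < \<epsilon> \<Longrightarrow> \<epsilon> \<le> 1 \<Longrightarrow> \<rho> > 0 \<Longrightarrow>
       leading_energy t (stretched_ball e f \<epsilon> \<rho>) \<le> ereal (\<rho> powr (real DIM('a) - t) * (T + C * \<epsilon>\<^sup>2))"
proof (cases "t = 1")
  case True
  let ?W = "DIM('a) * unit_ball_vol DIM('a)"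
  have W: "real DIM('a) * measure lebesgue (ball (0::'a) 1) = ?W" by (simp add: content_ball)
  have W0: "?W \<ge> 0" by simp
  have pw: "\<rho> powr (real DIM('a) - 1) = \<rho> ^ (DIM('a) - 1)" if "\<rho> > 0" for \<rho>
    using powr_realpow[OF that, of "DIM('a) - 1"] by (simp add: of_nat_diff Suc_leI)
  obtain M where M: "M \<ge> 0"
    "\<And>(e::'a::euclidean_space) f \<epsilon> \<rho>. stretch_dirs e f \<Longrightarrow> 0 < \<epsilon> \<Longrightarrow> \<epsilon> \<le> 1 \<Longrightarrow> \<rho> > 0 \<Longrightarrow>
      perimeter (stretched_ball e f \<epsilon> \<rho>) \<le> ereal (\<rho> ^ (DIM('a) - 1) * (1 + M * \<epsilon>\<^sup>2) * ?W)"
    using perimeter_stretched_ball_upper[where 'a='a] unfolding stretched_ball_def by blast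
  show ?thesis
  proof (rule that[of "?W * M * ?W" "?W * ?W"])
    show "0 \<le> ?W * M * ?W" using M(1) by simp
    show "ereal (\<rho> powr (real DIM('a) - t) * (?W * ?W)) \<le> leading_energy t (ball (0::'a) \<rho>)" if "\<rho> > 0" for \<rho>
    proof -
      have "ereal ?W * ereal (\<rho> ^ (DIM('a) - 1) * ?W) \<le> ereal ?W * perimeter (ball (0::'a) \<rho>)"
        using W0 perimeter_ball_lower[OF that, where 'a='a] by (intro ereal_mult_left_mono) auto
      then show ?thesis
        unfolding leading_energy_def True W pw[OF that] by (simp add: mult_ac)
    qed
    fix e f :: 'a and \<epsilon> \<rho> :: real
    assume *: "stretch_dirs e f" "0 < \<epsilon>" "\<epsilon> \<le> 1" "\<rho> > 0"
    have "ereal ?W * perimeter (stretched_ball e f \<epsilon> \<rho>) \<le> ereal ?W * ereal (\<rho> ^ (DIM('a) - 1) * (1 + M * \<epsilon>\<^sup>2) * ?W)"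
      using W0 M(2)[OF *] by (intro ereal_mult_left_mono) auto
    also have "\<dots> = ereal (\<rho> powr (real DIM('a) - t) * (?W * ?W + ?W * M * ?W * \<epsilon>\<^sup>2))"
      by (simp add: True pw[OF *(4)] algebra_simps)
    finally show "leading_energy t (stretched_ball e f \<epsilon> \<rho>) \<le> ereal (\<rho> powr (real DIM('a) - t) * (?W * ?W + ?W * M * ?W * \<epsilon>\<^sup>2))"
      unfolding leading_energy_def W using True by simp
  qed
next
  case False
  then have t: "0 < t" "t < 1" using assms by auto
  obtain T C where TC: "C \<ge> 0"
    "\<And>\<rho>. \<rho> > 0 \<Longrightarrow> frac_perimeter t (ball (0::'a::euclidean_space) \<rho>) = ennreal (\<rho> powr (real DIM('a) - t) * T)"
    "\<And>(e::'a) f \<epsilon> \<rho>. stretch_dirs e f \<Longrightarrow> 0 < \<epsilon> \<Longrightarrow> \<epsilon> \<le> 1 \<Longrightarrow> \<rho> > 0 \<Longrightarrow>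
       frac_perimeter t (stretched_ball e f \<epsilon> \<rho>) \<le> ennreal (\<rho> powr (real DIM('a) - t) * (T + C * \<epsilon>\<^sup>2))"
    "T \<ge> 0"
    using frac_perimeter_stretched_upper[OF t, where 'a='a] by metis
  show ?thesis
  proof (rule that[of "(1 - t) * C" "(1 - t) * T"])
    show "0 \<le> (1 - t) * C" using t TC(1) by simp
    show "ereal (\<rho> powr (real DIM('a) - t) * ((1 - t) * T)) \<le> leading_energy t (ball (0::'a) \<rho>)" if "\<rho> > 0" for \<rho>
      using TC(4) by (simp add: leading_energy_def False TC(2)[OF that] enn2ereal_ennreal mult_ac)
    fix e f :: 'a and \<epsilon> \<rho> :: real
    assume *: "stretch_dirs e f" "0 < \<epsilon>" "\<epsilon> \<le> 1" "\<rho> > 0"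
    have nn: "0 \<le> \<rho> powr (real DIM('a) - t) * (T + C * \<epsilon>\<^sup>2)" using TC by simp
    have "enn2ereal (frac_perimeter t (stretched_ball e f \<epsilon> \<rho>)) \<le> ereal (\<rho> powr (real DIM('a) - t) * (T + C * \<epsilon>\<^sup>2))"
      using TC(3)[OF *] nn by (simp add: less_eq_ennreal.rep_eq enn2ereal_ennreal)
    then have "ereal (1 - t) * enn2ereal (frac_perimeter t (stretched_ball e f \<epsilon> \<rho>)) \<le> ereal (1 - t) * ereal (\<rho> powr (real DIM('a) - t) * (T + C * \<epsilon>\<^sup>2))"
      using t by (intro ereal_mult_left_mono) auto
    then show "leading_energy t (stretched_ball e f \<epsilon> \<rho>) \<le> ereal (\<rho> powr (real DIM('a) - t) * ((1 - t) * T + (1 - t) * C * \<epsilon>\<^sup>2))"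
      by (simp add: leading_energy_def False algebra_simps)
  qed
qed

text \<open>
Beyond the radius \<open>(C / (s * c)) powr (1 / (t - s))\<close> the gain \<open>s * c * \<epsilon>\<^sup>2 * \<rho> powr (N - s)\<close> exceeds the
loss \<open>C * \<epsilon>\<^sup>2 * \<rho> powr (N - t)\<close>. Neither constant depends on \<open>\<epsilon>\<close>, so \<open>\<epsilon>\<close> is free to be adapted to \<open>\<eta>\<close>.
\<close>

lemma vol_ball_not_local_minimizer_large:
  assumes dim: "DIM('a::euclidean_space) \<ge> 2" and st: "0 < s" "s < t" "t \<le> 1"
  obtains m2 where "m2 \<ge> 0" "\<And>m. m > m2 \<Longrightarrow> vol_ball_not_local_minimizer TYPE('a) s t m"
proof -
  obtain e f :: 'a where "e \<in> Basis" "f \<in> Basis" "e \<noteq> f"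
    using dim by (metis card_le_Suc0_iff_eq finite_Basis not_less_eq_eq numeral_2_eq_2)
  then have dirs: "stretch_dirs e f" by unfold_locales
  let ?N = "real DIM('a)"
  obtain T C where TC: "C \<ge> 0"
    "\<And>\<rho>. \<rho> > 0 \<Longrightarrow> ereal (\<rho> powr (?N - t) * T) \<le> leading_energy t (ball (0::'a) \<rho>)"
    "\<And>\<epsilon> \<rho>. 0 < \<epsilon> \<Longrightarrow> \<epsilon> \<le> 1 \<Longrightarrow> \<rho> > 0 \<Longrightarrow>
       leading_energy t (stretched_ball e f \<epsilon> \<rho>) \<le> ereal (\<rho> powr (?N - t) * (T + C * \<epsilon>\<^sup>2))"
  proof -
    have "0 < t" using st by simp
    from leading_energy_stretched[OF this st(3), where 'a='a] show ?thesis
      using that dirs by metis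
  qed
  have "s < 1" using st by simp
  then obtain S c where Sc: "c > 0" "S \<ge> 0"
    "\<And>\<rho>. \<rho> > 0 \<Longrightarrow> frac_perimeter s (ball (0::'a) \<rho>) = ennreal (\<rho> powr (?N - s) * S)"
    "\<And>\<epsilon> \<rho>. 0 < \<epsilon> \<Longrightarrow> \<epsilon> \<le> 1 \<Longrightarrow> \<rho> > 0 \<Longrightarrow>
       ennreal (\<rho> powr (?N - s) * (S + c * \<epsilon>\<^sup>2)) \<le> frac_perimeter s (stretched_ball e f \<epsilon> \<rho>)"
    using frac_perimeter_stretched_lower[OF dirs st(1)] by metis
  define w where "w = measure lebesgue (ball (0::'a) 1)"
  have w: "w > 0" by (simp add: w_def content_ball)
  define \<rho>0 where "\<rho>0 = (C / (s * c)) powr (1 / (t - s))"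
  have \<rho>0: "\<rho>0 \<ge> 0" by (simp add: \<rho>0_def)
  show ?thesis
  proof (rule that[of "w * \<rho>0 powr ?N"])
    show "0 \<le> w * \<rho>0 powr ?N" using w by simp
    fix m assume m: "m > w * \<rho>0 powr ?N"
    have m0: "m > 0" using m w order.strict_trans1[of 0 "w * \<rho>0 powr ?N" m] by simp
    define \<rho> where "\<rho> = vol_radius TYPE('a) m"
    have \<rho>: "\<rho> > 0" using m0 w by (simp add: \<rho>_def vol_radius_def w_def[symmetric])
    have "\<rho>0 < \<rho>"
    proof -
      have "\<rho>0 powr ?N < m / w" using m w by (simp add: field_simps)
      then have "(\<rho>0 powr ?N) powr (1 / ?N) < (m / w) powr (1 / ?N)" by (intro powr_less_mono2) auto
      then show ?thesis using \<rho>0 by (simp add: powr_powr \<rho>_def vol_radius_def w_def)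
    qed
    then have "\<rho>0 powr (t - s) < \<rho> powr (t - s)" using \<rho>0 st by (intro powr_less_mono2) auto
    moreover have "\<rho>0 powr (t - s) = C / (s * c)"
      using st Sc(1) TC(1) by (simp add: \<rho>0_def powr_powr)
    ultimately have "C < s * c * \<rho> powr (t - s)" using st Sc(1) by (simp add: field_simps)
    then have "\<rho> powr (?N - t) * C < \<rho> powr (?N - t) * (s * c * \<rho> powr (t - s))"
      using \<rho> by (intro mult_strict_left_mono) auto
    also have "\<rho> powr (?N - t) * (s * c * \<rho> powr (t - s)) = s * c * \<rho> powr (?N - s)"
      using powr_add[of \<rho> "?N - t" "t - s"] by (simp add: mult_ac)
    finally have key: "\<rho> powr (?N - t) * C < s * c * \<rho> powr (?N - s)" .
    show "vol_ball_not_local_minimizer TYPE('a) s t m"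
      unfolding vol_ball_not_local_minimizer_def
    proof (intro allI impI)
      fix \<eta> :: real assume \<eta>: "\<eta> > 0"
      \<comment> \<open>34 is the constant of \<open>C1_norm_radial_height_stretch\<close>\<close>
      define \<epsilon> where "\<epsilon> = min 1 (\<eta> / 34)"
      have eps: "0 < \<epsilon>" "\<epsilon> \<le> 1" "34 * \<epsilon> \<le> \<eta>" using \<eta> by (auto simp: \<epsilon>_def)
      let ?E = "stretched_ball e f \<epsilon> \<rho>"
      have en: "energy s t X = leading_energy t X - ereal s * enn2ereal (frac_perimeter s X)" for X :: "'a set"
        by (simp add: energy_def leading_energy_def)
      have "ereal (\<rho> powr (?N - s) * (S + c * \<epsilon>\<^sup>2)) \<le> enn2ereal (frac_perimeter s ?E)"
        using Sc(4)[OF eps(1,2) \<rho>] Sc(1,2) by (simp add: less_eq_ennreal.rep_eq enn2ereal_ennreal)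
      then have "ereal s * ereal (\<rho> powr (?N - s) * (S + c * \<epsilon>\<^sup>2)) \<le> ereal s * enn2ereal (frac_perimeter s ?E)"
        using st by (intro ereal_mult_left_mono) auto
      then have "energy s t ?E \<le> ereal (\<rho> powr (?N - t) * (T + C * \<epsilon>\<^sup>2)) - ereal s * ereal (\<rho> powr (?N - s) * (S + c * \<epsilon>\<^sup>2))"
        unfolding en by (intro ereal_minus_mono TC(3)[OF eps(1,2) \<rho>])
      also have "\<dots> = ereal (\<rho> powr (?N - t) * (T + C * \<epsilon>\<^sup>2) - s * (\<rho> powr (?N - s) * (S + c * \<epsilon>\<^sup>2)))" by simp
      also have "\<dots> < ereal (\<rho> powr (?N - t) * T - s * (\<rho> powr (?N - s) * S))"
      proof -
        have "\<rho> powr (?N - t) * C * \<epsilon>\<^sup>2 < s * c * \<rho> powr (?N - s) * \<epsilon>\<^sup>2"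
          using key eps(1) by (intro mult_strict_right_mono) auto
        then show ?thesis by (simp add: algebra_simps)
      qed
      also have "\<dots> = ereal (\<rho> powr (?N - t) * T) - ereal s * ereal (\<rho> powr (?N - s) * S)" by simp
      also have "\<dots> \<le> energy s t (ball (0::'a) \<rho>)"
        unfolding en Sc(3)[OF \<rho>] using Sc(2) by (intro ereal_minus_mono TC(2)[OF \<rho>]) (simp add: enn2ereal_ennreal)
      finally have "energy s t ?E < energy s t (vol_ball m :: 'a set)"
        by (simp add: vol_ball_def \<rho>_def)
      moreover have "has_volume ?E m" unfolding \<rho>_def by (rule has_volume_stretched_ball[OF dirs eps(1) m0])
      moreover have "near_ball \<eta> (vol_radius TYPE('a) m) ?E"
        unfolding \<rho>_def[symmetric] by (rule near_ball_stretched_ball[OF dirs eps \<rho>])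
      ultimately show "\<exists>E :: 'a set. has_volume E m \<and> near_ball \<eta> (vol_radius TYPE('a) m) E \<and>
        energy s t E < energy s t (vol_ball m :: 'a set)" by blast
    qed
  qed
qed

theorem theorem6p3:
  fixes s t :: real
  assumes "DIM('a::euclidean_space) \<ge> 2"
    and "0 < s" and "s < t" and "t \<le> 1"
  shows "\<exists>m2 :: real. \<forall>m1 > 0.
           (\<forall>m. 0 < m \<and> m < m1 \<longrightarrow> is_only_minimizer s t m (vol_ball m :: 'a set)) \<longrightarrow>
           m1 \<le> m2 \<and> (\<forall>m > m2. vol_ball_not_local_minimizer TYPE('a) s t m)"
proof -
  obtain m2 where m2: "m2 \<ge> 0" "\<And>m. m > m2 \<Longrightarrow> vol_ball_not_local_minimizer TYPE('a) s t m"
    using vol_ball_not_local_minimizer_large[OF assms] by blast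
  have "m1 \<le> m2" if min: "\<And>m. 0 < m \<and> m < m1 \<Longrightarrow> is_only_minimizer s t m (vol_ball m :: 'a set)" for m1
  proof (rule ccontr)
    assume "\<not> m1 \<le> m2"
    then obtain m where m: "m2 < m" "m < m1" using dense[of m2 m1] by auto
    then have "is_minimizer s t m (vol_ball m :: 'a set)" using min m2(1) by (auto simp: is_only_minimizer_def)
    moreover obtain E :: "'a set" where "has_volume E m" "energy s t E < energy s t (vol_ball m :: 'a set)"
      using m2(2)[OF m(1)] unfolding vol_ball_not_local_minimizer_def by (meson zero_less_one)
    ultimately show False unfolding is_minimizer_def by (meson not_less)
  qed
  then show ?thesis using m2(2) by blast
qed

end
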